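(* Let $\pi$ be a recursive supernatural number. Then the pseudovariety $\mathsf{Ab}_\pi$ is completely $\sigma_\pi$-tame.
   Context: Supernatural numbers. $\mathbb{N}$ contains $0$. A supernatural number is a function $\pi$ from the set of primes to $\mathbb{N}\cup\{\infty\}$; positive integers are regarded as supernatural numbers via their prime factorization; $\pi'$ divides $\pi$ if $\pi'(p)\le\pi(p)$ for all primes $p$. $\pi$ is recursive if $\pi(p)\in\mathbb{N}\cup\{\infty\}$ is computable from $p$. $P_\pi$ is the set of primes $p$ with $\pi(p)\in\mathbb{N}$ (i.e. $\pi(p)\ne\infty$). $\mathsf{Ab}_\pi$ is the class of all finite abelian groups whose exponent divides $\pi$. Profinite semigroups. A pseudovariety is a class of finite semigroups closed under subsemigroups, homomorphic images and finite direct products. $\mathsf{S}$ is the pseudovariety of all finite semigroups. For a pseudovariety $\mathsf{V}$ and a finite set $A$, $\overline{\Omega}_A\mathsf{V}$ is the free pro-$\mathsf{V}$ semigroup on $A$, and $\psi_{\mathsf V}:\overline{\Omega}_A\mathsf{S}\to\overline{\Omega}_A\mathsf{V}$ is the continuous homomorphism restricting to the identity on $A$. $\mathsf V$ satisfies $u=v$ ($u,v\in\overline{\Omega}_A\mathsf{S}$) if $\psi_{\mathsf V}(u)=\psi_{\mathsf V}(v)$. Each $w\in\overline{\Omega}_A\mathsf{S}$ induces an $A$-ary operation $\varphi\mapsto\hat\varphi(w)$ on every profinite semigroup $S$, where $\hat\varphi:\overline{\Omega}_A\mathsf S\to S$ is the continuous homomorphism extending $\varphi:A\to S$; these are the implicit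 operations. An implicit signature $\sigma$ is a set of implicit operations including multiplication; when algorithms are considered, its operation symbols form a recursively enumerable set. $\Omega_A^\sigma\mathsf{V}$ is the $\sigma$-subalgebra of $\overline{\Omega}_A\mathsf{V}$ generated by $A$. Signature. $\kappa$ consists of multiplication and $x\mapsto x^{\omega-1}=\lim_k x^{k!-1}$. For $n\ge1$, $x^{n^{\omega-1}}=\lim_{k}x^{n^{k!-1}}$. Put $\sigma_\pi=\kappa\cup\{x\mapsto x^{p^{\omega-1}}\mid p\in P_\pi\}$. Systems. Let $X$ (variables), $P$ (parameters) be disjoint finite sets, $A$ a finite alphabet. A system of equations of $\sigma$-terms consists of finitely many equations $u_i=v_i$ with $u_i,v_i\in\Omega^\sigma_{X\cup P}\mathsf{S}$, rational constraints $L_x\subseteq A^*$ ($x\in X$), and elements $w_p\in\Omega_A^\sigma\mathsf{S}$ ($p\in P$). $Cl(L_x)$ is the closure of $L_x$ in $(\overline{\Omega}_A\mathsf{S})^1$ (the adjoined $1$ being isolated). A solution modulo $\mathsf{V}$ is a continuous homomorphism $\delta:\overline{\Omega}_{X\cup P}\mathsf{S}\to\overline{\Omega}_A\mathsf{S}$ with $\delta(x)\in Cl(L_x)$ for $x\in X$, $\delta(p)=w_p$ for $p\in P$, and such that $\mathsf V$ satisfies $\delta(u_i)=\delta(v_i)$ for all $i$. $\mathsf V$ is $\sigma$-reducible for the system if, whenever the system has a solution modulo $\mathsf V$, it has a solution $\delta$ modulo $\mathsf V$ with $\delta(x)\in\Omega_A^\sigma\mathsf{S}$ for all $x\in X$.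 Tameness. The word problem is decidable in $\Omega_A^\sigma\mathsf{V}$ if there is an algorithm which, given two $\sigma$-terms over $A$, decides whether they represent the same element of $\Omega_A^\sigma\mathsf V$. $\mathsf V$ is $\sigma$-tame with respect to a class $\mathfrak{C}$ of systems of equations of $\sigma$-terms if: $\mathsf V$ is $\sigma$-reducible for every system in $\mathfrak C$; the word problem is decidable in $\Omega_A^\sigma\mathsf{V}$ (for every finite $A$); and $\mathsf V$ is recursively enumerable (some Turing machine outputs successively representatives of all isomorphism classes of members of $\mathsf V$). $\mathsf V$ is completely $\sigma$-tame if it is $\sigma$-tame with respect to every class of such systems. *)

theory Defs
  imports
    "HOL-Analysis.Abstract_Limits"
    "HOL-Analysis.Function_Topology"
    "HOL-Algebra.Group"
    "HOL-Computational_Algebra.Primes"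
    "HOL-Library.Extended_Nat"
    "HOL-Library.Nat_Bijection"
begin

section \<open>Computability\<close>

text \<open>Unary partial recursive functions: pairs are coded by the (computable) Cantor pairing
  \<^const>\<open>prod_encode\<close>, so that functions of several arguments need no separate treatment.\<close>

inductive partrec :: "(nat \<Rightarrow> nat option) \<Rightarrow> bool" where
  zero: "partrec (\<lambda>_. Some 0)"
| succ: "partrec (\<lambda>n. Some (Suc n))"
| left: "partrec (\<lambda>n. Some (fst (prod_decode n)))"
| right: "partrec (\<lambda>n. Some (snd (prod_decode n)))"
| pair: "partrec f \<Longrightarrow> partrec g \<Longrightarrow>
    partrec (\<lambda>n. Option.bind (f n) (\<lambda>a. Option.bind (g n) (\<lambda>b. Some (prod_encode (a, b)))))"
| comp: "partrec f \<Longrightarrow> partrec g \<Longrightarrow> partrec (\<lambda>n. Option.bind (g n) f)"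
| prec: "partrec f \<Longrightarrow> partrec g \<Longrightarrow>
    partrec (\<lambda>n. case prod_decode n of (a, k) \<Rightarrow>
      rec_nat (f a) (\<lambda>y r. Option.bind r (\<lambda>i. g (prod_encode (a, prod_encode (y, i))))) k)"
| mu: "partrec f \<Longrightarrow>
    partrec (\<lambda>a. if \<exists>n. f (prod_encode (a, n)) = Some 0 \<and> (\<forall>m<n. f (prod_encode (a, m)) \<noteq> None)
                 then Some (LEAST n. f (prod_encode (a, n)) = Some 0) else None)"

definition recursively_enumerable :: "nat set \<Rightarrow> bool" where
  "recursively_enumerable R \<longleftrightarrow> (\<exists>f. partrec f \<and> R = {y. \<exists>x. f x = Some y})"


section \<open>Supernatural numbers\<close>

text \<open>A supernatural number is a function \<open>nat \<Rightarrow> enat\<close> of which only the values at primes are used.\<close>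

type_synonym supernatural = "nat \<Rightarrow> enat"

definition supernatural_of :: "nat \<Rightarrow> supernatural" where
  "supernatural_of n = (\<lambda>p. enat (multiplicity p n))"

definition supernatural_dvd :: "supernatural \<Rightarrow> supernatural \<Rightarrow> bool" where
  "supernatural_dvd \<pi>' \<pi> \<longleftrightarrow> (\<forall>p. prime p \<longrightarrow> \<pi>' p \<le> \<pi> p)"

fun enat_encode :: "enat \<Rightarrow> nat" where
  "enat_encode \<infinity> = 0"
| "enat_encode (enat n) = Suc n"

definition recursive_supernatural :: "supernatural \<Rightarrow> bool" where
  "recursive_supernatural \<pi> \<longleftrightarrow>
     (\<exists>f. partrec f \<and> (\<forall>p. prime p \<longrightarrow> f p = Some (enat_encode (\<pi> p))))"

definition finite_primes :: "supernatural \<Rightarrow> nat set" where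
  "finite_primes \<pi> = {p. prime p \<and> \<pi> p \<noteq> \<infinity>}"


section \<open>Semigroups and pseudovarieties\<close>

record 'a sgrp = "'a partial_object" +
  smult :: "'a \<Rightarrow> 'a \<Rightarrow> 'a"

definition semigroup_on :: "('a, 'm) sgrp_scheme \<Rightarrow> bool" where
  "semigroup_on S \<longleftrightarrow> carrier S \<noteq> {} \<and>
     (\<forall>x\<in>carrier S. \<forall>y\<in>carrier S. smult S x y \<in> carrier S) \<and>
     (\<forall>x\<in>carrier S. \<forall>y\<in>carrier S. \<forall>z\<in>carrier S.
        smult S (smult S x y) z = smult S x (smult S y z))"

definition shom :: "('a, 'm) sgrp_scheme \<Rightarrow> ('b, 'n) sgrp_scheme \<Rightarrow> ('a \<Rightarrow> 'b) set" where
  "shom S T = {h. h \<in> carrier S \<rightarrow> carrier T \<and>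
     (\<forall>x\<in>carrier S. \<forall>y\<in>carrier S. h (smult S x y) = smult T (h x) (h y))}"

definition sgrp_iso :: "('a, 'm) sgrp_scheme \<Rightarrow> ('b, 'n) sgrp_scheme \<Rightarrow> bool" where
  "sgrp_iso S T \<longleftrightarrow> (\<exists>h\<in>shom S T. bij_betw h (carrier S) (carrier T))"

definition sgrp_prod :: "'a sgrp \<Rightarrow> 'b sgrp \<Rightarrow> ('a \<times> 'b) sgrp" where
  "sgrp_prod S T = \<lparr>carrier = carrier S \<times> carrier T,
     smult = (\<lambda>x y. (smult S (fst x) (fst y), smult T (snd x) (snd y)))\<rparr>"

text \<open>Classes of finite semigroups are represented by sets of semigroups whose elements are natural
  numbers; every finite semigroup has an isomorphic copy of this kind. The pseudovariety of all finite
  semigroups is \<open>Fin_Sgrp\<close>.\<close>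

definition Fin_Sgrp :: "nat sgrp set" where
  "Fin_Sgrp = {S. semigroup_on S \<and> finite (carrier S)}"

text \<open>The last clause is closure under products with zero factors.\<close>

definition pseudovariety :: "nat sgrp set \<Rightarrow> bool" where
  "pseudovariety V \<longleftrightarrow> V \<subseteq> Fin_Sgrp \<and>
     (\<forall>S\<in>V. \<forall>T\<in>Fin_Sgrp. carrier T \<subseteq> carrier S \<and> (\<lambda>x. x) \<in> shom T S \<longrightarrow> T \<in> V) \<and>
     (\<forall>S\<in>V. \<forall>T\<in>Fin_Sgrp. (\<exists>h\<in>shom S T. h ` carrier S = carrier T) \<longrightarrow> T \<in> V) \<and>
     (\<forall>S\<in>V. \<forall>T\<in>V. \<forall>U\<in>Fin_Sgrp. sgrp_iso U (sgrp_prod S T) \<longrightarrow> U \<in> V) \<and>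
     (\<forall>U\<in>Fin_Sgrp. card (carrier U) = 1 \<longrightarrow> U \<in> V)"

definition group_exponent :: "('a, 'm) monoid_scheme \<Rightarrow> nat" where
  "group_exponent G = (LEAST n. 0 < n \<and> (\<forall>x\<in>carrier G. x [^]\<^bsub>G\<^esub> n = \<one>\<^bsub>G\<^esub>))"

definition Ab :: "supernatural \<Rightarrow> nat sgrp set" where
  "Ab \<pi> = {S. finite (carrier S) \<and>
     (\<exists>e. let G = \<lparr>carrier = carrier S, monoid.mult = smult S, one = e\<rparr> in
        comm_group G \<and> supernatural_dvd (supernatural_of (group_exponent G)) \<pi>)}"


section \<open>Free profinite semigroups\<close>

record 'a top_sgrp = "'a sgrp" +
  topo :: "'a topology"

definition cont_hom :: "'a top_sgrp \<Rightarrow> 'b top_sgrp \<Rightarrow> ('a \<Rightarrow> 'b) set" where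
  "cont_hom S T = {h \<in> shom S T. h \<in> extensional (carrier S) \<and> continuous_map (topo S) (topo T) h}"

text \<open>The free pro-\<open>V\<close> semigroup on a finite set \<open>A\<close> is the projective limit, with the topology
  induced from the product of discrete spaces, of all pairs \<open>(S, \<phi>)\<close> with \<open>S\<close> in \<open>V\<close> and
  \<open>\<phi> : A \<rightarrow> S\<close>, the connecting maps \<open>(S, \<phi>) \<rightarrow> (T, h \<circ> \<phi>)\<close> being the homomorphisms \<open>h : S \<rightarrow> T\<close>.\<close>

type_synonym pro_elem = "nat sgrp \<times> (nat \<Rightarrow> nat) \<Rightarrow> nat"

definition pro_index :: "nat sgrp set \<Rightarrow> nat set \<Rightarrow> (nat sgrp \<times> (nat \<Rightarrow> nat)) set" where
  "pro_index V A = (SIGMA S:V. A \<rightarrow>\<^sub>E carrier S)"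

definition pro_carrier :: "nat sgrp set \<Rightarrow> nat set \<Rightarrow> pro_elem set" where
  "pro_carrier V A = {w \<in> (\<Pi>\<^sub>E i\<in>pro_index V A. carrier (fst i)).
     \<forall>S\<in>V. \<forall>T\<in>V. \<forall>\<phi> \<in> A \<rightarrow>\<^sub>E carrier S. \<forall>h\<in>shom S T. w (T, compose A h \<phi>) = h (w (S, \<phi>))}"

definition Free_Pro :: "nat sgrp set \<Rightarrow> nat set \<Rightarrow> pro_elem top_sgrp" where
  "Free_Pro V A = \<lparr>carrier = pro_carrier V A,
     smult = (\<lambda>u v. \<lambda>i\<in>pro_index V A. smult (fst i) (u i) (v i)),
     topo = subtopology (product_topology (\<lambda>i. discrete_topology (carrier (fst i))) (pro_index V A))
              (pro_carrier V A)\<rparr>"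

definition gen :: "nat sgrp set \<Rightarrow> nat set \<Rightarrow> nat \<Rightarrow> pro_elem" where
  "gen V A a = (\<lambda>i\<in>pro_index V A. snd i a)"

definition lift :: "nat set \<Rightarrow> 'b top_sgrp \<Rightarrow> (nat \<Rightarrow> 'b) \<Rightarrow> pro_elem \<Rightarrow> 'b" where
  "lift A S \<phi> = (THE h. h \<in> cont_hom (Free_Pro Fin_Sgrp A) S \<and>
     (\<forall>a\<in>A. h (gen Fin_Sgrp A a) = \<phi> a))"

definition psi :: "nat sgrp set \<Rightarrow> nat set \<Rightarrow> pro_elem \<Rightarrow> pro_elem" where
  "psi V A = lift A (Free_Pro V A) (gen V A)"

definition satisfies :: "nat sgrp set \<Rightarrow> nat set \<Rightarrow> pro_elem \<Rightarrow> pro_elem \<Rightarrow> bool" where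
  "satisfies V A u v \<longleftrightarrow> psi V A u = psi V A v"


section \<open>Implicit operations and implicit signatures\<close>

text \<open>An \<open>n\<close>-ary implicit operation is an element of the free profinite semigroup on
  \<open>{..<n}\<close>; the following is its value on \<open>S\<close> at \<open>\<phi> 0, \<dots>, \<phi> (n - 1)\<close>.\<close>

definition apply_op :: "nat \<Rightarrow> pro_elem \<Rightarrow> 'b top_sgrp \<Rightarrow> (nat \<Rightarrow> 'b) \<Rightarrow> 'b" where
  "apply_op n w S \<phi> = lift {..<n} S \<phi> w"

text \<open>Operation symbols are natural numbers, so that terms can be handed to algorithms.\<close>

record signature =
  symbols :: "nat set"
  arity :: "nat \<Rightarrow> nat"
  interp :: "nat \<Rightarrow> pro_elem"

definition mult_op :: pro_elem where
  "mult_op = smult (Free_Pro Fin_Sgrp {..<2}) (gen Fin_Sgrp {..<2} 0) (gen Fin_Sgrp {..<2} 1)"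

definition implicit_signature :: "signature \<Rightarrow> bool" where
  "implicit_signature \<sigma> \<longleftrightarrow>
     (\<forall>f\<in>symbols \<sigma>. interp \<sigma> f \<in> carrier (Free_Pro Fin_Sgrp {..<arity \<sigma> f})) \<and>
     (\<exists>f\<in>symbols \<sigma>. arity \<sigma> f = 2 \<and> interp \<sigma> f = mult_op) \<and>
     recursively_enumerable (symbols \<sigma>)"

text \<open>\<open>spow S x n\<close> is the \<open>n\<close>-th power for \<open>n \<ge> 1\<close>; the value \<open>x\<close> at \<open>n = 0\<close> is irrelevant.\<close>

definition spow :: "('a, 'm) sgrp_scheme \<Rightarrow> 'a \<Rightarrow> nat \<Rightarrow> 'a" where
  "spow S x n = ((\<lambda>y. smult S y x) ^^ (n - 1)) x"

definition power_limit :: "(nat \<Rightarrow> nat) \<Rightarrow> pro_elem" where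
  "power_limit e = (THE y. limitin (topo (Free_Pro Fin_Sgrp {..<1}))
     (\<lambda>k. spow (Free_Pro Fin_Sgrp {..<1}) (gen Fin_Sgrp {..<1} 0) (e k)) y sequentially)"

definition omega_minus_one_op :: pro_elem where
  "omega_minus_one_op = power_limit (\<lambda>k. fact k - 1)"

definition nat_omega_minus_one_op :: "nat \<Rightarrow> pro_elem" where
  "nat_omega_minus_one_op n = power_limit (\<lambda>k. n ^ (fact k - 1))"

text \<open>The symbols 0 and 1 form \<open>\<kappa>\<close>; a prime \<open>p\<close>, being different from 0 and 1, serves as the
  symbol of the operation indexed by \<open>p\<close>.\<close>

definition sigma_pi :: "supernatural \<Rightarrow> signature" where
  "sigma_pi \<pi> = \<lparr>symbols = {0, 1} \<union> finite_primes \<pi>,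
     arity = (\<lambda>f. if f = 0 then 2 else 1),
     interp = (\<lambda>f. if f = 0 then mult_op else if f = 1 then omega_minus_one_op
                   else nat_omega_minus_one_op f)\<rparr>"

inductive_set Omega_sig :: "signature \<Rightarrow> nat sgrp set \<Rightarrow> nat set \<Rightarrow> pro_elem set"
  for \<sigma> :: signature and V :: "nat sgrp set" and A :: "nat set" where
  "a \<in> A \<Longrightarrow> gen V A a \<in> Omega_sig \<sigma> V A"
| "f \<in> symbols \<sigma> \<Longrightarrow> (\<And>i. i < arity \<sigma> f \<Longrightarrow> s i \<in> Omega_sig \<sigma> V A) \<Longrightarrow>
     apply_op (arity \<sigma> f) (interp \<sigma> f) (Free_Pro V A) s \<in> Omega_sig \<sigma> V A"


section \<open>Systems of equations\<close>

inductive rational :: "nat set \<Rightarrow> nat list set \<Rightarrow> bool" for A :: "nat set" where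
  "rational A {}"
| "rational A {[]}"
| "a \<in> A \<Longrightarrow> rational A {[a]}"
| "rational A K \<Longrightarrow> rational A L \<Longrightarrow> rational A (K \<union> L)"
| "rational A K \<Longrightarrow> rational A L \<Longrightarrow> rational A {u @ v | u v. u \<in> K \<and> v \<in> L}"
| "rational A L \<Longrightarrow> rational A {concat ws | ws. set ws \<subseteq> L}"

text \<open>\<open>None\<close> is the adjoined identity, an isolated point.\<close>

definition adjoin_one_topo :: "'a topology \<Rightarrow> 'a option topology" where
  "adjoin_one_topo T = topology_generated_by (insert {None} {Some ` U | U. openin T U})"

fun word_elem :: "nat set \<Rightarrow> nat list \<Rightarrow> pro_elem option" where
  "word_elem A [] = None"
| "word_elem A (a # u) =
     Some (foldl (smult (Free_Pro Fin_Sgrp A)) (gen Fin_Sgrp A a) (map (gen Fin_Sgrp A) u))"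

definition Cl :: "nat set \<Rightarrow> nat list set \<Rightarrow> pro_elem option set" where
  "Cl A L = adjoin_one_topo (topo (Free_Pro Fin_Sgrp A)) closure_of (word_elem A ` L)"

text \<open>Variables, parameters and letters are natural numbers; the sets of variables and of letters
  may overlap.\<close>

record system =
  vars :: "nat set"
  params :: "nat set"
  alphabet :: "nat set"
  eqs :: "(pro_elem \<times> pro_elem) set"
  constraint :: "nat \<Rightarrow> nat list set"
  param_val :: "nat \<Rightarrow> pro_elem"

definition is_system :: "signature \<Rightarrow> system \<Rightarrow> bool" where
  "is_system \<sigma> \<Sigma> \<longleftrightarrow>
     finite (vars \<Sigma>) \<and> finite (params \<Sigma>) \<and> vars \<Sigma> \<inter> params \<Sigma> = {} \<and> finite (alphabet \<Sigma>) \<and>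
     finite (eqs \<Sigma>) \<and>
     (\<forall>(u, v)\<in>eqs \<Sigma>. u \<in> Omega_sig \<sigma> Fin_Sgrp (vars \<Sigma> \<union> params \<Sigma>) \<and>
                      v \<in> Omega_sig \<sigma> Fin_Sgrp (vars \<Sigma> \<union> params \<Sigma>)) \<and>
     (\<forall>x\<in>vars \<Sigma>. rational (alphabet \<Sigma>) (constraint \<Sigma> x)) \<and>
     (\<forall>p\<in>params \<Sigma>. param_val \<Sigma> p \<in> Omega_sig \<sigma> Fin_Sgrp (alphabet \<Sigma>))"

definition solution_mod :: "nat sgrp set \<Rightarrow> system \<Rightarrow> (pro_elem \<Rightarrow> pro_elem) \<Rightarrow> bool" where
  "solution_mod V \<Sigma> \<delta> \<longleftrightarrow>
     (let Y = vars \<Sigma> \<union> params \<Sigma>; A = alphabet \<Sigma> in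
        \<delta> \<in> cont_hom (Free_Pro Fin_Sgrp Y) (Free_Pro Fin_Sgrp A) \<and>
        (\<forall>x\<in>vars \<Sigma>. Some (\<delta> (gen Fin_Sgrp Y x)) \<in> Cl A (constraint \<Sigma> x)) \<and>
        (\<forall>p\<in>params \<Sigma>. \<delta> (gen Fin_Sgrp Y p) = param_val \<Sigma> p) \<and>
        (\<forall>(u, v)\<in>eqs \<Sigma>. satisfies V A (\<delta> u) (\<delta> v)))"

definition reducible :: "signature \<Rightarrow> nat sgrp set \<Rightarrow> system \<Rightarrow> bool" where
  "reducible \<sigma> V \<Sigma> \<longleftrightarrow> (\<exists>\<delta>. solution_mod V \<Sigma> \<delta>) \<longrightarrow>
     (\<exists>\<delta>. solution_mod V \<Sigma> \<delta> \<and>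
        (\<forall>x\<in>vars \<Sigma>. \<delta> (gen Fin_Sgrp (vars \<Sigma> \<union> params \<Sigma>) x) \<in> Omega_sig \<sigma> Fin_Sgrp (alphabet \<Sigma>)))"


section \<open>Tameness\<close>

datatype sterm = Var nat | App nat "sterm list"

inductive sterm_over :: "signature \<Rightarrow> nat set \<Rightarrow> sterm \<Rightarrow> bool"
  for \<sigma> :: signature and A :: "nat set" where
  "a \<in> A \<Longrightarrow> sterm_over \<sigma> A (Var a)"
| "f \<in> symbols \<sigma> \<Longrightarrow> length ts = arity \<sigma> f \<Longrightarrow> (\<And>t. t \<in> set ts \<Longrightarrow> sterm_over \<sigma> A t) \<Longrightarrow>
     sterm_over \<sigma> A (App f ts)"

primrec sterm_eval :: "signature \<Rightarrow> nat sgrp set \<Rightarrow> nat set \<Rightarrow> sterm \<Rightarrow> pro_elem" where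
  "sterm_eval \<sigma> V A (Var a) = gen V A a"
| "sterm_eval \<sigma> V A (App f ts) =
     apply_op (arity \<sigma> f) (interp \<sigma> f) (Free_Pro V A) (\<lambda>i. map (sterm_eval \<sigma> V A) ts ! i)"

primrec sterm_encode :: "sterm \<Rightarrow> nat" where
  "sterm_encode (Var a) = prod_encode (0, a)"
| "sterm_encode (App f ts) = prod_encode (Suc f, list_encode (map sterm_encode ts))"

text \<open>The algorithm may behave arbitrarily on inputs that do not code a pair of terms over the
  signature.\<close>

definition decidable_word_problem :: "signature \<Rightarrow> nat sgrp set \<Rightarrow> nat set \<Rightarrow> bool" where
  "decidable_word_problem \<sigma> V A \<longleftrightarrow>
     (\<exists>f. partrec f \<and> (\<forall>s t. sterm_over \<sigma> A s \<longrightarrow> sterm_over \<sigma> A t \<longrightarrow>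
        f (prod_encode (sterm_encode s, sterm_encode t)) =
          Some (if sterm_eval \<sigma> V A s = sterm_eval \<sigma> V A t then 1 else 0)))"

text \<open>The code of a semigroup with carrier \<open>{..<n}\<close> is that of its multiplication table.\<close>

definition sgrp_encode :: "nat sgrp \<Rightarrow> nat" where
  "sgrp_encode S = (let n = card (carrier S) in
     list_encode (map (\<lambda>i. list_encode (map (\<lambda>j. smult S i j) [0..<n])) [0..<n]))"

definition re_class :: "nat sgrp set \<Rightarrow> bool" where
  "re_class V \<longleftrightarrow> (\<exists>W\<subseteq>V. (\<forall>S\<in>W. carrier S = {..<card (carrier S)}) \<and>
     (\<forall>S\<in>V. \<exists>T\<in>W. sgrp_iso S T) \<and> recursively_enumerable (sgrp_encode ` W))"

definition tame :: "signature \<Rightarrow> nat sgrp set \<Rightarrow> system set \<Rightarrow> bool" where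
  "tame \<sigma> V \<CC> \<longleftrightarrow> (\<forall>\<Sigma>\<in>\<CC>. reducible \<sigma> V \<Sigma>) \<and>
     (\<forall>A. finite A \<longrightarrow> decidable_word_problem \<sigma> V A) \<and> re_class V"

definition completely_tame :: "signature \<Rightarrow> nat sgrp set \<Rightarrow> bool" where
  "completely_tame \<sigma> V \<longleftrightarrow> (\<forall>\<CC>. \<CC> \<subseteq> {\<Sigma>. is_system \<sigma> \<Sigma>} \<longrightarrow> tame \<sigma> V \<CC>)"

end

theory Submission
  imports Defs "HOL-Number_Theory.Cong" "HOL-Algebra.FiniteProduct"
begin

text \<open>Modulo a natural divisor \<open>N\<close> of \<open>\<pi>\<close>, an element of the free profinite semigroup is determined
  by its coefficients, its values in \<open>\<int>/N\<close> when one generator is sent to 1 and the others to 0, and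
  two elements agree over \<open>Ab \<pi>\<close> iff all coefficients agree for all \<open>N\<close>. The operation indexed by a
  prime \<open>q\<close> with \<open>\<pi> q\<close> finite multiplies the \<open>p\<close>-components by \<open>1/q\<close> for \<open>p \<noteq> q\<close> and annihilates the
  \<open>q\<close>-component. Hence, outside finitely many finite primes, the coefficients of a term are rational
  numbers whose size is bounded in terms of the term, so that one sufficiently large \<open>N\<close>
  decides equality.

  For reducibility, the commutative image of the closure of a rational language is a finite union of
  translates of subgroups, and powers with \<open>\<sigma>\<close>-exponents realize these translates by \<open>\<sigma>\<close>-elements
  of the closure. A system of equations thus becomes an integer linear system that is solvable modulo
  all \<open>N\<close>. Elimination gives a solution up to a denominator composed of finitely many
  finite primes; away from these primes it is used after inverting the denominator, and at these primes
  the given solution is copied. The two are combined by the idempotent \<open>\<Prod>q * q\<^sup>\<omega>\<^sup>-\<^sup>1\<close>, which is 0 at the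
  exceptional primes and 1 elsewhere.\<close>

subsection \<open>Computable functions\<close>

text \<open>The two kinds of primes need opposite treatment. If \<open>\<pi> q\<close> is finite,
  the signature can invert q, at the price of losing everything at q. The loss can be repaired,
  because the q-part of a coefficient lives modulo the \<open>\<pi> q\<close>-th power of q, so that
  one modulus R settles finitely many such primes. If \<open>\<pi> p = \<infinity>\<close>, there is
  no such modulus and no division by p; but a linear system that is solvable modulo all powers of p
  never forces a division by p. Hence denominators are split into a finite and an infinite part. The
  given solution may approach a constraint language through different pieces of it for different N.
  There are finitely many pieces, and finitely many moduli have a common multiple that still divides
  \<open>\<pi>\<close>, so one piece serves all N. Values of terms are computable because limits
  along k! are already attained modulo N at k = N. The choice of a large N rests on a case
  distinction about \<open>\<pi>\<close> that is not itself computed; this is harmless, since only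
  the existence of an algorithm is claimed.\<close>

abbreviation pfst :: "nat \<Rightarrow> nat" where "pfst n \<equiv> fst (prod_decode n)"
abbreviation psnd :: "nat \<Rightarrow> nat" where "psnd n \<equiv> snd (prod_decode n)"

text \<open>Total functions keep \<open>option\<close> out of the closure rules. Partiality enters
  only through unbounded search and through the program for \<open>\<pi>\<close>, whose behaviour
  off the primes is unspecified.\<close>

definition computable :: "(nat \<Rightarrow> nat) \<Rightarrow> bool" where
  "computable f \<longleftrightarrow> partrec (\<lambda>n. Some (f n))"

definition decidable :: "(nat \<Rightarrow> bool) \<Rightarrow> bool" where
  "decidable P \<longleftrightarrow> computable (\<lambda>n. of_bool (P n))"

named_theorems computable_intros

lemma computable_comp: "computable f \<Longrightarrow> computable g \<Longrightarrow> computable (\<lambda>n. f (g n))"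
  unfolding computable_def by (drule (1) partrec.comp) simp

lemma computable_pair [computable_intros]: "computable f \<Longrightarrow> computable g \<Longrightarrow> computable (\<lambda>n. prod_encode (f n, g n))"
  unfolding computable_def by (drule (1) partrec.pair) simp

lemma computable_pfst [computable_intros]: "computable f \<Longrightarrow> computable (\<lambda>n. pfst (f n))"
  by (rule computable_comp[of pfst]) (simp_all add: computable_def partrec.left)

lemma computable_psnd [computable_intros]: "computable f \<Longrightarrow> computable (\<lambda>n. psnd (f n))"
  by (rule computable_comp[of psnd]) (simp_all add: computable_def partrec.right)

text \<open>The identity is not a basic function of \<open>partrec\<close>; it is the pairing of the
  two projections.\<close>

lemma computable_id [computable_intros]: "computable (\<lambda>n. n)"
proof -
  have "computable pfst" "computable psnd" by (simp_all add: computable_def partrec.left partrec.right)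
  from computable_pair[OF this] show ?thesis by simp
qed

lemma computable_Suc [computable_intros]: "computable f \<Longrightarrow> computable (\<lambda>n. Suc (f n))"
  by (rule computable_comp[of Suc]) (simp_all add: computable_def partrec.succ)

lemma computable_const [computable_intros]: "computable (\<lambda>n. c)"
proof (induction c)
  case 0 show ?case by (simp add: computable_def partrec.zero)
qed (rule computable_Suc)

text \<open>For total functions the option-valued recursion of \<open>prec\<close> never fails. Its
  step receives parameter, counter and previous value as one coded triple, which is why the premise
  on \<open>g\<close> decodes a single number.\<close>

lemma computable_rec [computable_intros]:
  assumes f: "computable f" and g: "computable (\<lambda>m. g (pfst m) (pfst (psnd m)) (psnd (psnd m)))" and k: "computable k"
  shows "computable (\<lambda>n. rec_nat (f n) (g n) (k n))"
proof -
  have aux: "rec_nat (Some (f a)) (\<lambda>y r. Option.bind r (\<lambda>i. Some (g a y i))) j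
      = Some (rec_nat (f a) (g a) j)" for a j
    by (induction j) auto
  have "computable (\<lambda>n. rec_nat (f (pfst n)) (g (pfst n)) (psnd n))"
    using partrec.prec[OF f[unfolded computable_def] g[unfolded computable_def]]
    by (simp add: computable_def aux case_prod_beta)
  from computable_comp[OF this computable_pair[OF computable_id k]] show ?thesis by simp
qed

lemma computable_binary:
  assumes "computable (\<lambda>m. F (pfst m) (psnd m))" "computable f" "computable g"
  shows "computable (\<lambda>n. F (f n) (g n))"
  using computable_comp[OF assms(1) computable_pair[OF assms(2,3)]] by simp

section \<open>Arithmetic and decidable predicates\<close>

lemma computable_pred: "computable f \<Longrightarrow> computable (\<lambda>n. f n - 1)"
proof -
  assume f: "computable f"
  have "(\<lambda>n. f n - 1) = (\<lambda>n. rec_nat 0 (\<lambda>y r. y) (f n))"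
  proof
    show "f n - 1 = rec_nat 0 (\<lambda>y r. y) (f n)" for n by (cases "f n") auto
  qed
  then show ?thesis by (simp only:) (intro computable_intros f)
qed

lemma computable_add [computable_intros]: "computable f \<Longrightarrow> computable g \<Longrightarrow> computable (\<lambda>n. f n + g n)"
proof -
  assume f: "computable f" "computable g"
  have "x + y = rec_nat x (\<lambda>y r. Suc r) y" for x y :: nat by (induction y) auto
  then show ?thesis by (simp only:) (intro computable_intros f)
qed

lemma computable_diff [computable_intros]: "computable f \<Longrightarrow> computable g \<Longrightarrow> computable (\<lambda>n. f n - g n)"
proof -
  assume f: "computable f" "computable g"
  have "rec_nat x (\<lambda>y r. r - 1) y = x - y" for x y :: nat by (induction y) auto
  moreover have "computable (\<lambda>n. rec_nat (f n) (\<lambda>y r. r - 1) (g n))" by (intro computable_intros f computable_pred)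
  ultimately show ?thesis by simp
qed

lemma computable_mult [computable_intros]: "computable f \<Longrightarrow> computable g \<Longrightarrow> computable (\<lambda>n. f n * g n)"
proof -
  assume f: "computable f" "computable g"
  have "x * y = rec_nat 0 (\<lambda>y r. r + x) y" for x y :: nat by (induction y) auto
  then show ?thesis by (simp only:) (intro computable_intros f computable_comp[OF f(1)])
qed

lemma computable_power [computable_intros]: "computable f \<Longrightarrow> computable g \<Longrightarrow> computable (\<lambda>n. f n ^ g n)"
proof -
  assume f: "computable f" "computable g"
  have "x ^ y = rec_nat 1 (\<lambda>y r. r * x) y" for x y :: nat by (induction y) auto
  then show ?thesis by (simp only:) (intro computable_intros f computable_comp[OF f(1)])
qed

lemma computable_fact [computable_intros]: "computable f \<Longrightarrow> computable (\<lambda>n. fact (f n))"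
proof -
  assume f: "computable f"
  have "fact y = rec_nat 1 (\<lambda>y r. r * Suc y) y" for y :: nat
    by (induction y) (auto simp: algebra_simps)
  then show ?thesis by (simp only:) (intro computable_intros f)
qed

lemma computable_of_bool [computable_intros]: "decidable P \<Longrightarrow> computable (\<lambda>n. of_bool (P n))"
  by (simp add: decidable_def)

lemma decidable_less [computable_intros]: "computable f \<Longrightarrow> computable g \<Longrightarrow> decidable (\<lambda>n. f n < g n)"
proof -
  assume f: "computable f" "computable g"
  have "of_bool (x < y) = 1 - (1 - (y - x))" for x y :: nat by auto
  then show ?thesis unfolding decidable_def by (simp only:) (intro computable_intros f)
qed

lemma decidable_not [computable_intros]: "decidable P \<Longrightarrow> decidable (\<lambda>n. \<not> P n)"
proof -
  assume f: "decidable P"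
  have "of_bool (\<not> P n) = 1 - (of_bool (P n) :: nat)" for n by auto
  then show ?thesis unfolding decidable_def by (simp only:) (intro computable_intros f)
qed

lemma decidable_conj [computable_intros]: "decidable P \<Longrightarrow> decidable Q \<Longrightarrow> decidable (\<lambda>n. P n \<and> Q n)"
proof -
  assume f: "decidable P" "decidable Q"
  have "of_bool (P n \<and> Q n) = (of_bool (P n) * of_bool (Q n) :: nat)" for n by auto
  then show ?thesis unfolding decidable_def by (simp only:) (intro computable_intros f)
qed

lemma decidable_disj [computable_intros]: "decidable P \<Longrightarrow> decidable Q \<Longrightarrow> decidable (\<lambda>n. P n \<or> Q n)"
  using decidable_not[OF decidable_conj[OF decidable_not[of P] decidable_not[of Q]]] by simp

lemma decidable_imp [computable_intros]: "decidable P \<Longrightarrow> decidable Q \<Longrightarrow> decidable (\<lambda>n. P n \<longrightarrow> Q n)"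
  using decidable_disj[OF decidable_not[of P], of Q] by simp

lemma decidable_le [computable_intros]: "computable f \<Longrightarrow> computable g \<Longrightarrow> decidable (\<lambda>n. f n \<le> g n)"
  using decidable_not[OF decidable_less[of g f]] by (simp add: not_less)

lemma decidable_eq [computable_intros]: "computable f \<Longrightarrow> computable g \<Longrightarrow> decidable (\<lambda>n. f n = g n)"
  using decidable_conj[OF decidable_le[of f g] decidable_le[of g f]] by (simp add: eq_iff)

text \<open>A conditional between total functions is a recursion of length 0 or 1 whose step forgets
  the previous value.\<close>

lemma computable_if [computable_intros]:
  "decidable P \<Longrightarrow> computable f \<Longrightarrow> computable g \<Longrightarrow> computable (\<lambda>n. if P n then f n else g n)"
proof -
  assume f: "decidable P" "computable f" "computable g"
  have "(if P n then f n else g n) = rec_nat (g n) (\<lambda>y r. f n) (of_bool (P n))" for n by auto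
  then show ?thesis by (simp only:) (intro computable_intros f computable_comp[OF f(2)])
qed

lemma decidable_ball:
  assumes P: "decidable (\<lambda>m. P (pfst m) (psnd m))" and k: "computable k"
  shows "decidable (\<lambda>n. \<forall>i<k n. P n i)"
proof -
  have "of_bool (\<forall>i<j. Q i) = rec_nat (1::nat) (\<lambda>y r. r * of_bool (Q y)) j" for j :: nat and Q
  proof (induction j)
    case (Suc j)
    have "(\<forall>i<Suc j. Q i) \<longleftrightarrow> (\<forall>i<j. Q i) \<and> Q j" by (auto simp: less_Suc_eq)
    then show ?case using Suc[symmetric] by (simp only: of_bool_conj nat.rec)
  qed simp
  moreover have "decidable (\<lambda>m. P (pfst m) (pfst (psnd m)))"
    unfolding decidable_def
    using computable_comp[OF computable_of_bool[OF P] computable_pair[OF computable_pfst[OF computable_id] computable_pfst[OF computable_psnd[OF computable_id]]]]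
    by simp
  ultimately have "computable (\<lambda>n. of_bool (\<forall>i<k n. P n i))"
    by (simp only:) (intro computable_intros k)
  then show ?thesis by (simp only: decidable_def)
qed

lemma decidable_bex:
  assumes P: "decidable (\<lambda>m. P (pfst m) (psnd m))" and k: "computable k"
  shows "decidable (\<lambda>n. \<exists>i<k n. P n i)"
  using decidable_not[OF decidable_ball[OF decidable_not[OF P] k]] by simp

declare decidable_ball [computable_intros] decidable_bex [computable_intros]

text \<open>\<open>mu\<close> searches for a zero, so it is applied to the indicator of the negation
  of P; \<open>ex\<close> makes every search succeed.\<close>

lemma computable_Least:
  assumes P: "decidable (\<lambda>m. P (pfst m) (psnd m))" and ex: "\<And>n. \<exists>y. P n y"
  shows "computable (\<lambda>n. LEAST y. P n y)"
proof -
  have "computable (\<lambda>m. of_bool (\<not> P (pfst m) (psnd m)))"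
    by (intro computable_intros P)
  then have "partrec (\<lambda>m. Some (of_bool (\<not> P (pfst m) (psnd m))))" by (simp add: computable_def)
  from partrec.mu[OF this] have "partrec (\<lambda>a. if \<exists>n. P a n then Some (LEAST n. P a n) else None)"
    by (simp cong: if_cong)
  then show ?thesis using ex by (simp add: computable_def)
qed

lemma decidable_dvd [computable_intros]: "computable f \<Longrightarrow> computable g \<Longrightarrow> decidable (\<lambda>n. f n dvd g n)"
proof -
  assume f: "computable f" "computable g"
  have "a dvd b \<longleftrightarrow> (\<exists>k<Suc b. b = a * k)" for a b :: nat
  proof
    assume "a dvd b"
    then obtain k where k: "b = a * k" ..
    show "\<exists>k<Suc b. b = a * k"
    proof (cases "a = 0")
      case True then show ?thesis using k by auto
    next
      case False then show ?thesis using k by (intro exI[of _ k]) (simp add: less_Suc_eq_le)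
    qed
  qed auto
  then show ?thesis by (simp only:) (intro computable_intros f computable_comp[OF f(1)] computable_comp[OF f(2)])
qed

lemma computable_mod [computable_intros]: "computable f \<Longrightarrow> computable g \<Longrightarrow> computable (\<lambda>n. f n mod g n)"
proof -
  assume f: "computable f" "computable g"
  have "x mod y = rec_nat 0 (\<lambda>z r. if Suc r = y then 0 else Suc r) x" for x y :: nat
    by (induction x) (auto simp: mod_Suc)
  then show ?thesis by (simp only:) (intro computable_intros f computable_comp[OF f(2)])
qed

lemma decidable_prime [computable_intros]: "computable f \<Longrightarrow> decidable (\<lambda>n. prime (f n))"
proof -
  assume f: "computable f"
  have "prime p \<longleftrightarrow> 1 < p \<and> (\<forall>d<p. d dvd p \<longrightarrow> d = 1)" for p :: nat
  proof
    assume "1 < p \<and> (\<forall>d<p. d dvd p \<longrightarrow> d = 1)"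
    then show "prime p"
      by (metis dvd_imp_le le_neq_implies_less less_trans prime_nat_iff zero_less_one)
  qed (auto simp: prime_nat_iff)
  then show ?thesis by (simp only:) (intro computable_intros f computable_comp[OF f])
qed

lemma computable_prod_lessThan:
  assumes "computable (\<lambda>m. F (pfst m) (psnd m))" "computable k"
  shows "computable (\<lambda>n. \<Prod>i<k n. F n i)"
proof -
  have "(\<Prod>i<j. F n i) = rec_nat 1 (\<lambda>y r. r * F n y) j" for n j
    by (induction j) (auto simp: algebra_simps)
  moreover have "computable (\<lambda>m. F (pfst m) (pfst (psnd m)))"
    using computable_comp[OF assms(1) computable_pair[OF computable_pfst[OF computable_id] computable_pfst[OF computable_psnd[OF computable_id]]]]
    by simp
  ultimately show ?thesis by (simp only:) (intro computable_intros assms)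
qed

text \<open>\<open>list_encode\<close> codes a nonempty list as the successor of the pair of its
  head and the code of its tail. After subtracting 1, \<open>psnd\<close> therefore drops the head
  and \<open>pfst\<close> reads it.\<close>

definition nth_code :: "nat \<Rightarrow> nat \<Rightarrow> nat" where
  "nth_code l k = pfst (((\<lambda>l. psnd (l - 1)) ^^ k) l - 1)"

lemma nth_code_encode [simp]: "k < length xs \<Longrightarrow> nth_code (list_encode xs) k = xs ! k"
proof (induction xs arbitrary: k)
  case (Cons x xs)
  then show ?case by (cases k) (auto simp: nth_code_def funpow_Suc_right simp del: funpow.simps)
qed simp

lemma computable_nth_code [computable_intros]: "computable f \<Longrightarrow> computable g \<Longrightarrow> computable (\<lambda>n. nth_code (f n) (g n))"
proof -
  assume f: "computable f" "computable g"
  have "(h ^^ k) l = rec_nat l (\<lambda>y r. h r) k" for h :: "nat \<Rightarrow> nat" and l k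
    by (induction k) auto
  then show ?thesis unfolding nth_code_def by (simp only:) (intro computable_intros f)
qed

lemma computable_list_encode_map:
  assumes "computable (\<lambda>m. F (pfst m) (psnd m))" "computable k"
  shows "computable (\<lambda>n. list_encode (map (F n) [0..<k n]))"
proof -
  \<comment> \<open>The recursion adds elements at the front, so after j steps it has built the last
    j elements of the list.\<close>
  have aux: "j \<le> l \<Longrightarrow> list_encode (map (F n) [l-j..<l])
      = rec_nat 0 (\<lambda>y r. Suc (prod_encode (F n (l - Suc y), r))) j" for n j l
  proof (induction j)
    case (Suc j)
    then have "[l - Suc j..<l] = (l - Suc j) # [l - j..<l]"
      by (subst upt_conv_Cons) (auto simp: Suc_diff_Suc)
    then show ?case using Suc by simp
  qed simp
  have eq: "list_encode (map (F n) [0..<k n])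
      = rec_nat 0 (\<lambda>y r. Suc (prod_encode (F n (k n - Suc y), r))) (k n)" for n
    using aux[of "k n" "k n" n] by simp
  have "computable (\<lambda>m. F (pfst m) (k (pfst m) - Suc (pfst (psnd m))))"
    by (rule computable_binary[OF assms(1)]) (intro computable_intros computable_comp[OF assms(2)])+
  then show ?thesis unfolding eq by (intro computable_intros assms)
qed

text \<open>\<open>history\<close> codes the list of the previous values, the most recent one first.\<close>

definition history :: "(nat \<Rightarrow> nat \<Rightarrow> nat \<Rightarrow> nat) \<Rightarrow> nat \<Rightarrow> nat \<Rightarrow> nat" where
  "history G e n = rec_nat 0 (\<lambda>y r. Suc (prod_encode (G e y r, r))) n"

definition course_of_values :: "(nat \<Rightarrow> nat \<Rightarrow> nat \<Rightarrow> nat) \<Rightarrow> nat \<Rightarrow> nat \<Rightarrow> nat" where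
  "course_of_values G e n = G e n (history G e n)"

text \<open>The newest value, the one at n - 1, has position 0 in the list. The step function thus
  finds the value at any smaller argument m, which is how codes of subterms are handled
  later.\<close>

lemma history_lookup:
  "m < n \<Longrightarrow> nth_code (history G e n) (n - Suc m) = course_of_values G e m"
proof (induction n)
  case (Suc n)
  have h: "history G e (Suc n) = Suc (prod_encode (course_of_values G e n, history G e n))"
    by (simp add: history_def course_of_values_def)
  show ?case
  proof (cases "m = n")
    case True then show ?thesis by (simp add: h nth_code_def)
  next
    case False
    then have mn: "m < n" using Suc.prems by simp
    then have "Suc n - Suc m = Suc (n - Suc m)" by simp
    then show ?thesis using Suc.IH[OF mn]
      by (simp add: h nth_code_def funpow_Suc_right del: funpow.simps)
  qed
qed simp

lemma computable_course_of_values: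
  assumes "computable (\<lambda>m. G (pfst m) (pfst (psnd m)) (psnd (psnd m)))" "computable f" "computable g"
  shows "computable (\<lambda>n. course_of_values G (f n) (g n))"
proof -
  have G: "computable (\<lambda>n. G (a n) (b n) (c n))" if "computable a" "computable b" "computable c" for a b c
    using computable_comp[OF assms(1) computable_pair[OF that(1) computable_pair[OF that(2,3)]]] by simp
  show ?thesis unfolding course_of_values_def history_def
    by (intro G assms computable_intros computable_comp[OF assms(2)])
qed

text \<open>\<open>f\<close> must not be run where P fails, since it may be undefined there. Placing
  it in the step of a recursion of length \<open>of_bool (P n)\<close> runs it exactly when P
  holds.\<close>

lemma computable_partial_guard:
  assumes f: "partrec f" and P: "decidable P" and def: "\<And>n. P n \<Longrightarrow> f n = Some (g n)"
  shows "computable (\<lambda>n. if P n then g n else 0)"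
proof -
  have "partrec (\<lambda>m. Option.bind (Some (pfst m)) f)"
    by (rule partrec.comp[OF f partrec.left])
  then have "partrec (\<lambda>m. f (pfst m))" by simp
  from partrec.prec[OF partrec.zero this]
  have 1: "partrec (\<lambda>n. rec_nat (Some 0) (\<lambda>y r. Option.bind r (\<lambda>i. f (pfst n))) (psnd n))"
    by (simp add: case_prod_beta)
  have "partrec (\<lambda>n. Some (prod_encode (n, of_bool (P n))))"
    using computable_pair[OF computable_id computable_of_bool[OF P]] by (simp add: computable_def)
  from partrec.comp[OF 1 this] have "partrec (\<lambda>n. rec_nat (Some 0) (\<lambda>y r. Option.bind r (\<lambda>i. f n)) (of_bool (P n)))"
    by simp
  moreover have "rec_nat (Some 0) (\<lambda>y r. Option.bind r (\<lambda>i. f n)) (of_bool (P n))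
      = Some (if P n then g n else 0)" for n
    using def[of n] by auto
  ultimately show ?thesis by (simp add: computable_def)
qed

lemma recursively_enumerableI:
  assumes "computable f" "R = range f"
  shows "recursively_enumerable R"
  unfolding recursively_enumerable_def
  using assms by (intro exI[of _ "\<lambda>n. Some (f n)"]) (auto simp: computable_def)

subsection \<open>Words in finite semigroups\<close>

text \<open>Starting from the head avoids an identity element. The empty word has no meaningful
  value and is excluded wherever the value matters.\<close>

definition word_value :: "('a, 'm) sgrp_scheme \<Rightarrow> (nat \<Rightarrow> 'a) \<Rightarrow> nat list \<Rightarrow> 'a" where
  "word_value S \<phi> u = foldl (smult S) (\<phi> (hd u)) (map \<phi> (tl u))"

lemma word_value_single [simp]: "word_value S \<phi> [a] = \<phi> a"
  by (simp add: word_value_def)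

lemma word_value_snoc: "u \<noteq> [] \<Longrightarrow> word_value S \<phi> (u @ [a]) = smult S (word_value S \<phi> u) (\<phi> a)"
  by (cases u) (auto simp: word_value_def)

lemma word_value_cong: "u \<noteq> [] \<Longrightarrow> (\<And>a. a \<in> set u \<Longrightarrow> \<phi> a = \<psi> a) \<Longrightarrow> word_value S \<phi> u = word_value S \<psi> u"
  by (cases u) (auto simp: word_value_def cong: map_cong)

lemma semigroup_onD:
  assumes "semigroup_on S"
  shows "carrier S \<noteq> {}" "x \<in> carrier S \<Longrightarrow> y \<in> carrier S \<Longrightarrow> smult S x y \<in> carrier S"
    "x \<in> carrier S \<Longrightarrow> y \<in> carrier S \<Longrightarrow> z \<in> carrier S \<Longrightarrow>
      smult S (smult S x y) z = smult S x (smult S y z)"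
  using assms by (auto simp: semigroup_on_def)

lemma word_value_closed:
  assumes S: "semigroup_on S" and "u \<noteq> []" "\<phi> \<in> set u \<rightarrow> carrier S"
  shows "word_value S \<phi> u \<in> carrier S"
  using assms(2,3)
proof (induction u rule: rev_nonempty_induct)
  case (snoc a u)
  then show ?case by (auto simp: word_value_snoc intro!: semigroup_onD(2)[OF S])
qed auto

lemma word_value_append:
  assumes S: "semigroup_on S" and u: "u \<noteq> []" "\<phi> \<in> set u \<rightarrow> carrier S"
    and v: "v \<noteq> []" "\<phi> \<in> set v \<rightarrow> carrier S"
  shows "word_value S \<phi> (u @ v) = smult S (word_value S \<phi> u) (word_value S \<phi> v)"
  using v
proof (induction v rule: rev_nonempty_induct)
  case (single a)
  then show ?case using u by (simp add: word_value_snoc)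
next
  case (snoc a v)
  have cl: "word_value S \<phi> u \<in> carrier S" "word_value S \<phi> v \<in> carrier S" "\<phi> a \<in> carrier S"
    using snoc u by (auto intro!: word_value_closed[OF S])
  have "word_value S \<phi> ((u @ v) @ [a]) = smult S (word_value S \<phi> (u @ v)) (\<phi> a)"
    using u by (subst word_value_snoc) auto
  also have "\<dots> = smult S (word_value S \<phi> u) (word_value S \<phi> (v @ [a]))"
    using snoc cl semigroup_onD(3)[OF S cl] by (auto simp: word_value_snoc)
  finally show ?case by simp
qed

lemma word_value_hom:
  assumes h: "h \<in> shom S T" and S: "semigroup_on S" and "u \<noteq> []" "\<phi> \<in> set u \<rightarrow> carrier S"
  shows "h (word_value S \<phi> u) = word_value T (\<lambda>a. h (\<phi> a)) u"
  using assms(3,4)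
proof (induction u rule: rev_nonempty_induct)
  case (snoc a u)
  then have "word_value S \<phi> u \<in> carrier S" "\<phi> a \<in> carrier S" by (auto intro!: word_value_closed[OF S])
  with snoc h show ?case by (auto simp: word_value_snoc shom_def)
qed auto

subsection \<open>The projective limit\<close>

lemma pro_indexD: "i \<in> pro_index V A \<Longrightarrow> fst i \<in> V" "i \<in> pro_index V A \<Longrightarrow> snd i \<in> A \<rightarrow>\<^sub>E carrier (fst i)"
  by (auto simp: pro_index_def)

lemma pro_index_mono: "V \<subseteq> W \<Longrightarrow> i \<in> pro_index V A \<Longrightarrow> i \<in> pro_index W A"
  by (auto simp: pro_index_def)

lemma pro_carrierD:
  assumes "w \<in> pro_carrier V A"
  shows "i \<in> pro_index V A \<Longrightarrow> w i \<in> carrier (fst i)"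
    "w \<in> extensional (pro_index V A)"
  using assms by (auto simp: pro_carrier_def PiE_def)

lemma pro_natural:
  assumes "w \<in> pro_carrier V A" "S \<in> V" "T \<in> V" "\<phi> \<in> A \<rightarrow>\<^sub>E carrier S" "h \<in> shom S T"
  shows "w (T, compose A h \<phi>) = h (w (S, \<phi>))"
  using assms by (auto simp: pro_carrier_def)

lemma pro_carrierI:
  assumes "w \<in> extensional (pro_index V A)" "\<And>i. i \<in> pro_index V A \<Longrightarrow> w i \<in> carrier (fst i)"
    and "\<And>S T \<phi> h. S \<in> V \<Longrightarrow> T \<in> V \<Longrightarrow> \<phi> \<in> A \<rightarrow>\<^sub>E carrier S \<Longrightarrow> h \<in> shom S T \<Longrightarrow>
      w (T, compose A h \<phi>) = h (w (S, \<phi>))"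
  shows "w \<in> pro_carrier V A"
  using assms by (auto simp: pro_carrier_def PiE_def)

lemma pro_eqI:
  assumes "v \<in> pro_carrier V A" "w \<in> pro_carrier V A" "\<And>i. i \<in> pro_index V A \<Longrightarrow> v i = w i"
  shows "v = w"
  using assms by (intro extensionalityI[where A = "pro_index V A"]) (auto dest: pro_carrierD)

lemma compose_PiE: "h \<in> shom S T \<Longrightarrow> \<phi> \<in> A \<rightarrow>\<^sub>E carrier S \<Longrightarrow> compose A h \<phi> \<in> A \<rightarrow>\<^sub>E carrier T"
  by (auto simp: shom_def compose_def)

lemma Free_Pro_simps [simp]:
  "carrier (Free_Pro V A) = pro_carrier V A"
  "smult (Free_Pro V A) u v = (\<lambda>i\<in>pro_index V A. smult (fst i) (u i) (v i))"
  by (simp_all add: Free_Pro_def)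

lemma gen_apply [simp]: "i \<in> pro_index V A \<Longrightarrow> gen V A a i = snd i a"
  by (simp add: gen_def)

lemma Fin_SgrpD: "S \<in> Fin_Sgrp \<Longrightarrow> semigroup_on S" "S \<in> Fin_Sgrp \<Longrightarrow> finite (carrier S)"
  by (auto simp: Fin_Sgrp_def)

lemma gen_in: "a \<in> A \<Longrightarrow> gen V A a \<in> pro_carrier V A"
  by (rule pro_carrierI) (auto simp: gen_def pro_index_def compose_def shom_def)

lemma smult_in:
  assumes "V \<subseteq> Fin_Sgrp" and u: "u \<in> pro_carrier V A" and v: "v \<in> pro_carrier V A"
  shows "smult (Free_Pro V A) u v \<in> pro_carrier V A"
proof (rule pro_carrierI)
  fix i assume i: "i \<in> pro_index V A"
  then have "semigroup_on (fst i)" using assms(1) Fin_SgrpD(1) pro_indexD(1) by blast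
  with i show "smult (Free_Pro V A) u v i \<in> carrier (fst i)"
    using pro_carrierD(1)[OF u i] pro_carrierD(1)[OF v i] by (auto dest: semigroup_onD)
next
  fix S T \<phi> h assume *: "S \<in> V" "T \<in> V" "\<phi> \<in> A \<rightarrow>\<^sub>E carrier S" "h \<in> shom S T"
  then have i: "(S, \<phi>) \<in> pro_index V A" "(T, compose A h \<phi>) \<in> pro_index V A"
    using compose_PiE[OF *(4,3)] by (auto simp: pro_index_def)
  show "smult (Free_Pro V A) u v (T, compose A h \<phi>) = h (smult (Free_Pro V A) u v (S, \<phi>))"
    using * i pro_natural[OF u *] pro_natural[OF v *] pro_carrierD(1)[OF u i(1)]
      pro_carrierD(1)[OF v i(1)] by (auto simp: shom_def)
qed auto

definition word :: "nat sgrp set \<Rightarrow> nat set \<Rightarrow> nat list \<Rightarrow> pro_elem" where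
  "word V A u = (\<lambda>i\<in>pro_index V A. word_value (fst i) (snd i) u)"

lemma word_apply: "i \<in> pro_index V A \<Longrightarrow> word V A u i = word_value (fst i) (snd i) u"
  by (simp add: word_def)

lemma word_value_Free_Pro:
  assumes "u \<noteq> []"
  shows "word_value (Free_Pro V A) (gen V A) u = word V A u"
  using assms
proof (induction u rule: rev_nonempty_induct)
  case (single a)
  then show ?case by (simp add: word_def gen_def)
next
  case (snoc a u)
  then show ?case by (auto simp: word_value_snoc word_def)
qed

lemma word_in:
  assumes "V \<subseteq> Fin_Sgrp" "u \<noteq> []" "set u \<subseteq> A"
  shows "word V A u \<in> pro_carrier V A"
  unfolding word_value_Free_Pro[OF assms(2), symmetric]
  using assms(2,3)
proof (induction u rule: rev_nonempty_induct)
  case (snoc a u)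
  then show ?case by (auto simp: word_value_snoc gen_in simp del: Free_Pro_simps intro!: smult_in assms(1))
qed (auto simp: gen_in)

subsection \<open>Density of words\<close>

lemma trivial_in_Fin: "\<lparr>carrier = {0}, smult = \<lambda>x y. 0\<rparr> \<in> Fin_Sgrp"
  by (simp add: Fin_Sgrp_def semigroup_on_def)

text \<open>Without generators, every homomorphism is compatible with the empty assignment. The two
  constant maps from the one-element semigroup into the two-element left zero semigroup would force
  two different values of w.\<close>

lemma pro_carrier_empty: "pro_carrier Fin_Sgrp {} = {}"
proof (rule ccontr)
  assume "pro_carrier Fin_Sgrp {} \<noteq> {}"
  then obtain w where w: "w \<in> pro_carrier Fin_Sgrp {}" by blast
  define S where "S = \<lparr>carrier = {0::nat}, smult = \<lambda>x y. 0::nat\<rparr>"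
  define T where "T = \<lparr>carrier = {0::nat, 1}, smult = \<lambda>x y. x :: nat\<rparr>"
  have ST: "S \<in> Fin_Sgrp" "T \<in> Fin_Sgrp"
    by (auto simp: S_def T_def Fin_Sgrp_def semigroup_on_def)
  define \<phi> :: "nat \<Rightarrow> nat" where "\<phi> = (\<lambda>x. undefined)"
  have "w (T, compose {} (\<lambda>x. c) \<phi>) = c" if "c \<in> {0, 1}" for c
    by (rule pro_natural[OF w ST]) (use that in \<open>auto simp: shom_def S_def T_def \<phi>_def\<close>)
  from this[of 0] this[of 1] show False by (simp add: compose_def restrict_def)
qed

text \<open>The values of words form the subsemigroup T generated by the letters. Since T is itself
  an index, naturality of w along the inclusion of T in S puts the value of w inside T.\<close>

lemma value_is_word:
  assumes w: "w \<in> pro_carrier Fin_Sgrp A" and i: "i \<in> pro_index Fin_Sgrp A"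
  shows "\<exists>u. u \<noteq> [] \<and> set u \<subseteq> A \<and> w i = word_value (fst i) (snd i) u"
proof -
  obtain S \<phi> where i_def: "i = (S, \<phi>)" by force
  have S: "S \<in> Fin_Sgrp" "semigroup_on S" and \<phi>: "\<phi> \<in> A \<rightarrow>\<^sub>E carrier S"
    using i by (auto simp: i_def pro_index_def Fin_Sgrp_def)
  \<comment> \<open>A letter is needed for T to be nonempty; it exists because there is no w over
    the empty alphabet.\<close>
  obtain a where a: "a \<in> A" using w pro_carrier_empty by fastforce
  define T where "T = \<lparr>carrier = {word_value S \<phi> u |u. u \<noteq> [] \<and> set u \<subseteq> A}, smult = smult S\<rparr>"
  have sub: "carrier T \<subseteq> carrier S"
    using \<phi> by (auto simp: T_def intro!: word_value_closed[OF S(2)])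
  have mult: "smult T x y \<in> carrier T" if "x \<in> carrier T" "y \<in> carrier T" for x y
  proof -
    obtain u v where uv: "u \<noteq> []" "v \<noteq> []" "set u \<subseteq> A" "set v \<subseteq> A" "x = word_value S \<phi> u" "y = word_value S \<phi> v"
      using \<open>x \<in> carrier T\<close> \<open>y \<in> carrier T\<close> unfolding T_def by auto
    then have "smult T x y = word_value S \<phi> (u @ v)"
      using \<phi> by (subst word_value_append[OF S(2)]) (auto simp: T_def)
    then show ?thesis using uv by (auto simp: T_def intro!: exI[of _ "u @ v"])
  qed
  have gT: "\<phi> b \<in> carrier T" if "b \<in> A" for b
    using that by (auto simp: T_def intro!: exI[of _ "[b]"])
  have "semigroup_on T"
    unfolding semigroup_on_def
  proof (intro conjI ballI)
    show "carrier T \<noteq> {}" using gT[OF a] by auto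
    fix x y z assume "x \<in> carrier T" "y \<in> carrier T" "z \<in> carrier T"
    then show "smult T (smult T x y) z = smult T x (smult T y z)"
      using semigroup_onD(3)[OF S(2), of x y z] sub by (auto simp: T_def)
  qed (rule mult)
  then have T: "T \<in> Fin_Sgrp"
    using finite_subset[OF sub] S by (auto simp: Fin_Sgrp_def)
  have \<phi>T: "\<phi> \<in> A \<rightarrow>\<^sub>E carrier T" using gT \<phi> by (auto simp: PiE_def)
  have "(\<lambda>x. x) \<in> shom T S" using sub by (auto simp: shom_def T_def)
  from pro_natural[OF w T S(1) \<phi>T this]
  have "w (S, compose A (\<lambda>x. x) \<phi>) = w (T, \<phi>)" .
  moreover have "compose A (\<lambda>x. x) \<phi> = \<phi>"
    using \<phi> by (auto simp: compose_def PiE_def extensional_def)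
  moreover have "w (T, \<phi>) \<in> carrier T"
    using pro_carrierD(1)[OF w, of "(T, \<phi>)"] T \<phi>T by (auto simp: pro_index_def)
  ultimately show ?thesis by (auto simp: T_def i_def)
qed

text \<open>The index system is directed: two indices are refined by the product of their
  semigroups, coded into the natural numbers by \<open>prod_encode\<close>, with the paired
  assignment.\<close>

lemma common_refinement:
  assumes "finite F" "F \<subseteq> pro_index Fin_Sgrp A"
  shows "\<exists>k\<in>pro_index Fin_Sgrp A. \<forall>i\<in>F. \<exists>h\<in>shom (fst k) (fst i). snd i = compose A h (snd k)"
  using assms
proof (induction F rule: finite_induct)
  case empty
  have "(\<lparr>carrier = {0}, smult = \<lambda>x y. 0\<rparr>, \<lambda>a\<in>A. 0) \<in> pro_index Fin_Sgrp A"
    using trivial_in_Fin by (auto simp: pro_index_def)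
  then show ?case by blast
next
  case (insert j F)
  then obtain k where k: "k \<in> pro_index Fin_Sgrp A"
    and kF: "\<And>i. i \<in> F \<Longrightarrow> \<exists>h\<in>shom (fst k) (fst i). snd i = compose A h (snd k)" by auto
  obtain S \<phi> where kd: "k = (S, \<phi>)" by force
  obtain T \<psi> where jd: "j = (T, \<psi>)" by force
  have S: "semigroup_on S" "finite (carrier S)" "\<phi> \<in> A \<rightarrow>\<^sub>E carrier S"
    and T: "semigroup_on T" "finite (carrier T)" "\<psi> \<in> A \<rightarrow>\<^sub>E carrier T"
    using k insert.prems by (auto simp: kd jd pro_index_def Fin_Sgrp_def)
  define U where "U = \<lparr>carrier = prod_encode ` (carrier S \<times> carrier T),
    smult = \<lambda>x y. prod_encode (smult S (pfst x) (pfst y), smult T (psnd x) (psnd y))\<rparr>"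
  have U: "U \<in> Fin_Sgrp"
    using S T by (auto simp: U_def Fin_Sgrp_def semigroup_on_def)
  define \<theta> where "\<theta> = (\<lambda>a\<in>A. prod_encode (\<phi> a, \<psi> a))"
  have \<theta>: "\<theta> \<in> A \<rightarrow>\<^sub>E carrier U" using S T by (auto simp: \<theta>_def U_def)
  have h1: "pfst \<in> shom U S" and h2: "psnd \<in> shom U T"
    by (auto simp: shom_def U_def)
  have c1: "compose A pfst \<theta> = \<phi>" and c2: "compose A psnd \<theta> = \<psi>"
    using S T by (auto simp: compose_def \<theta>_def PiE_def extensional_def)
  have "\<exists>h\<in>shom U (fst i). snd i = compose A h \<theta>" if "i \<in> insert j F" for i
  proof (cases "i = j")
    case True
    then show ?thesis using h2 c2 by (auto simp: jd)
  next
    case False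
    then have "i \<in> F" using that by simp
    from kF[OF this] obtain h where h: "h \<in> shom S (fst i)" "snd i = compose A h \<phi>"
      by (auto simp: kd)
    have "(\<lambda>x. h (pfst x)) \<in> shom U (fst i)"
      using h1 h(1) unfolding shom_def by (simp add: Pi_iff)
    moreover have "snd i = compose A (\<lambda>x. h (pfst x)) \<theta>"
      unfolding h(2) c1[symmetric] by (auto simp: compose_def)
    ultimately show ?thesis by blast
  qed
  then show ?case using U \<theta> by (intro bexI[of _ "(U, \<theta>)"]) (auto simp: pro_index_def)
qed

lemma refine_value:
  assumes "w \<in> pro_carrier V A" "i \<in> pro_index V A" "k \<in> pro_index V A"
    "h \<in> shom (fst k) (fst i)" "snd i = compose A h (snd k)"
  shows "w i = h (w k)"
  using pro_natural[OF assms(1), of "fst k" "fst i" "snd k" h] assms by (auto simp: pro_index_def)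

text \<open>Density of the words. At a common refinement w has the value of some word, and the
  connecting homomorphisms carry this agreement to all of F.\<close>

lemma approx_by_word:
  assumes w: "w \<in> pro_carrier Fin_Sgrp A" and F: "finite F" "F \<subseteq> pro_index Fin_Sgrp A"
  shows "\<exists>u. u \<noteq> [] \<and> set u \<subseteq> A \<and> (\<forall>i\<in>F. w i = word_value (fst i) (snd i) u)"
proof -
  obtain k where k: "k \<in> pro_index Fin_Sgrp A"
    and kF: "\<And>i. i \<in> F \<Longrightarrow> \<exists>h\<in>shom (fst k) (fst i). snd i = compose A h (snd k)"
    using common_refinement[OF F] by blast
  obtain u where u: "u \<noteq> []" "set u \<subseteq> A" "w k = word_value (fst k) (snd k) u"
    using value_is_word[OF w k] by blast
  have "w i = word_value (fst i) (snd i) u" if "i \<in> F" for i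
  proof -
    obtain h where h: "h \<in> shom (fst k) (fst i)" "snd i = compose A h (snd k)" using kF \<open>i \<in> F\<close> by blast
    have i: "i \<in> pro_index Fin_Sgrp A" using that F by blast
    have "w i = word Fin_Sgrp A u i"
      unfolding refine_value[OF w i k h] refine_value[OF word_in[OF order_refl u(1,2)] i k h]
      using u k by (simp add: word_apply)
    then show ?thesis using i by (simp add: word_apply)
  qed
  with u show ?thesis by blast
qed

subsection \<open>Topology\<close>

lemma topspace_Free_Pro [simp]: "topspace (topo (Free_Pro V A)) = pro_carrier V A"
  by (auto simp: Free_Pro_def topspace_subtopology pro_carrier_def)

lemma continuous_eval:
  "i \<in> pro_index V A \<Longrightarrow>
    continuous_map (topo (Free_Pro V A)) (discrete_topology (carrier (fst i))) (\<lambda>w. w i)"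
  unfolding Free_Pro_def
  by (auto intro!: continuous_map_from_subtopology continuous_map_product_projection)

lemma openin_eval:
  assumes "i \<in> pro_index V A"
  shows "openin (topo (Free_Pro V A)) {w \<in> pro_carrier V A. w i = c}"
proof -
  have "openin (topo (Free_Pro V A)) {w \<in> topspace (topo (Free_Pro V A)). w i \<in> {c} \<inter> carrier (fst i)}"
    using continuous_eval[OF assms] by (rule openin_continuous_map_preimage) simp
  moreover have "{w \<in> topspace (topo (Free_Pro V A)). w i \<in> {c} \<inter> carrier (fst i)}
      = {w \<in> pro_carrier V A. w i = c}"
    using pro_carrierD(1)[OF _ assms] by auto
  ultimately show ?thesis by simp
qed

text \<open>A basic box of the product topology restricts only finitely many coordinates, and these
  form F.\<close>

lemma openin_Free_Pro_cylinder:
  assumes "openin (topo (Free_Pro V A)) U" "w \<in> U"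
  shows "\<exists>F. finite F \<and> F \<subseteq> pro_index V A \<and>
    (\<forall>v\<in>pro_carrier V A. (\<forall>i\<in>F. v i = w i) \<longrightarrow> v \<in> U)"
proof -
  let ?Y = "\<lambda>i. discrete_topology (carrier (fst i)) :: nat topology"
  obtain T where T: "openin (product_topology ?Y (pro_index V A)) T" "U = T \<inter> pro_carrier V A"
    using assms(1) by (auto simp: Free_Pro_def openin_subtopology)
  then obtain X where X: "finite {i \<in> pro_index V A. X i \<noteq> topspace (?Y i)}"
    "w \<in> Pi\<^sub>E (pro_index V A) X" "Pi\<^sub>E (pro_index V A) X \<subseteq> T"
    using assms(2) unfolding openin_product_topology_alt by blast
  let ?F = "{i \<in> pro_index V A. X i \<noteq> topspace (?Y i)}"
  have "v \<in> U" if v: "v \<in> pro_carrier V A" and "\<forall>i\<in>?F. v i = w i" for v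
  proof -
    have "v i \<in> X i" if "i \<in> pro_index V A" for i
    proof (cases "X i = carrier (fst i)")
      case True
      then show ?thesis using pro_carrierD(1)[OF v that] by simp
    next
      case False
      then have "i \<in> ?F" using that by simp
      then have "v i = w i" using \<open>\<forall>i\<in>?F. v i = w i\<close> by blast
      then show ?thesis using X(2) that by auto
    qed
    then have "v \<in> Pi\<^sub>E (pro_index V A) X" using pro_carrierD(2)[OF v] by (auto simp: PiE_def)
    then show ?thesis using X T v by blast
  qed
  then show ?thesis using X(1) by (intro exI[of _ ?F]) auto
qed

subsection \<open>Continuous extensions\<close>

text \<open>Substitution of s into the implicit operation w, coordinate by coordinate: at i the
  operation is evaluated in the finite semigroup \<open>fst i\<close> at the arguments
  \<open>s b i\<close>. This is the explicit form of the continuous extension in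
  \<open>lift\<close>.\<close>

definition extend :: "nat sgrp set \<Rightarrow> nat set \<Rightarrow> nat set \<Rightarrow> (nat \<Rightarrow> pro_elem) \<Rightarrow> pro_elem \<Rightarrow> pro_elem" where
  "extend V A B s w = (\<lambda>i\<in>pro_index V A. w (fst i, \<lambda>b\<in>B. s b i))"

lemma extend_index:
  assumes "V \<subseteq> Fin_Sgrp" "\<And>b. b \<in> B \<Longrightarrow> s b \<in> pro_carrier V A" "i \<in> pro_index V A"
  shows "(fst i, \<lambda>b\<in>B. s b i) \<in> pro_index Fin_Sgrp B"
  using assms pro_carrierD(1)[OF assms(2) assms(3)] by (auto simp: pro_index_def)

lemma extend_in:
  assumes V: "V \<subseteq> Fin_Sgrp" and s: "\<And>b. b \<in> B \<Longrightarrow> s b \<in> pro_carrier V A"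
    and w: "w \<in> pro_carrier Fin_Sgrp B"
  shows "extend V A B s w \<in> pro_carrier V A"
proof (rule pro_carrierI)
  fix i assume i: "i \<in> pro_index V A"
  show "extend V A B s w i \<in> carrier (fst i)"
    using pro_carrierD(1)[OF w extend_index[OF V s i]] i by (simp add: extend_def)
next
  fix S T \<phi> h assume *: "S \<in> V" "T \<in> V" "\<phi> \<in> A \<rightarrow>\<^sub>E carrier S" "h \<in> shom S T"
  then have i: "(S, \<phi>) \<in> pro_index V A" "(T, compose A h \<phi>) \<in> pro_index V A"
    using compose_PiE[OF *(4,3)] by (auto simp: pro_index_def)
  let ?\<psi> = "\<lambda>b\<in>B. s b (S, \<phi>)"
  have \<psi>: "?\<psi> \<in> B \<rightarrow>\<^sub>E carrier S" using pro_carrierD(1)[OF s i(1)] by auto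
  have "(\<lambda>b\<in>B. s b (T, compose A h \<phi>)) = compose B h ?\<psi>"
    using pro_natural[OF s *] by (auto simp: compose_def restrict_def)
  then show "extend V A B s w (T, compose A h \<phi>) = h (extend V A B s w (S, \<phi>))"
    using pro_natural[OF w, of S T ?\<psi> h] * \<psi> V i by (auto simp: extend_def)
qed (auto simp: extend_def)

lemma extend_cont_hom:
  assumes V: "V \<subseteq> Fin_Sgrp" and s: "\<And>b. b \<in> B \<Longrightarrow> s b \<in> pro_carrier V A"
  shows "restrict (extend V A B s) (pro_carrier Fin_Sgrp B) \<in> cont_hom (Free_Pro Fin_Sgrp B) (Free_Pro V A)"
proof -
  let ?P = "pro_carrier Fin_Sgrp B" and ?h = "restrict (extend V A B s) (pro_carrier Fin_Sgrp B)"
  have "?h \<in> shom (Free_Pro Fin_Sgrp B) (Free_Pro V A)"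
    unfolding shom_def
  proof (intro CollectI conjI ballI)
    show "?h \<in> carrier (Free_Pro Fin_Sgrp B) \<rightarrow> carrier (Free_Pro V A)"
      using extend_in[OF V s] by auto
    fix x y assume xy: "x \<in> carrier (Free_Pro Fin_Sgrp B)" "y \<in> carrier (Free_Pro Fin_Sgrp B)"
    then have m: "smult (Free_Pro Fin_Sgrp B) x y \<in> ?P" using smult_in by simp
    show "?h (smult (Free_Pro Fin_Sgrp B) x y) = smult (Free_Pro V A) (?h x) (?h y)"
      using xy m extend_index[OF V s] by (auto simp: extend_def)
  qed
  moreover have "continuous_map (topo (Free_Pro Fin_Sgrp B)) (topo (Free_Pro V A)) ?h"
  proof -
    have "continuous_map (topo (Free_Pro Fin_Sgrp B)) (discrete_topology (carrier (fst i))) (\<lambda>w. ?h w i)"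
      if i: "i \<in> pro_index V A" for i
    proof (rule continuous_map_eq)
      show "continuous_map (topo (Free_Pro Fin_Sgrp B)) (discrete_topology (carrier (fst i)))
          (\<lambda>w. w (fst i, \<lambda>b\<in>B. s b i))"
        using continuous_eval[OF extend_index[OF V s i]] by simp
    qed (use i in \<open>auto simp: extend_def\<close>)
    moreover have "?h w \<in> pro_carrier V A" if "w \<in> ?P" for w
      using extend_in[OF V s that] that by simp
    ultimately have "continuous_map (topo (Free_Pro Fin_Sgrp B))
      (subtopology (product_topology (\<lambda>i. discrete_topology (carrier (fst i))) (pro_index V A))
              (pro_carrier V A)) ?h"
      by (subst continuous_map_in_subtopology, subst continuous_map_componentwise)
         (auto dest: pro_carrierD)
    then show ?thesis by (simp add: Free_Pro_def)
  qed
  ultimately show ?thesis by (simp add: cont_hom_def)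
qed

lemma extend_gen:
  assumes "V \<subseteq> Fin_Sgrp" "\<And>b. b \<in> B \<Longrightarrow> s b \<in> pro_carrier V A" "a \<in> B"
  shows "extend V A B s (gen Fin_Sgrp B a) = s a"
proof (rule pro_eqI)
  show "extend V A B s (gen Fin_Sgrp B a) \<in> pro_carrier V A"
    by (intro extend_in assms gen_in)
  show "s a \<in> pro_carrier V A" by (intro assms)
  fix i assume i: "i \<in> pro_index V A"
  then show "extend V A B s (gen Fin_Sgrp B a) i = s a i"
    using assms(3) extend_index[where s = s, OF assms(1,2) i] by (simp add: extend_def)
qed

lemma cont_hom_word:
  assumes h: "h \<in> cont_hom (Free_Pro Fin_Sgrp B) (Free_Pro V A)" and "u \<noteq> []" "set u \<subseteq> B"
  shows "h (word Fin_Sgrp B u) = word_value (Free_Pro V A) (\<lambda>b. h (gen Fin_Sgrp B b)) u"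
  unfolding word_value_Free_Pro[OF assms(2), symmetric]
  using assms(2,3)
proof (induction u rule: rev_nonempty_induct)
  case (snoc a u)
  have "word_value (Free_Pro Fin_Sgrp B) (gen Fin_Sgrp B) u \<in> pro_carrier Fin_Sgrp B"
    using snoc by (auto simp: word_value_Free_Pro intro!: word_in)
  moreover have "gen Fin_Sgrp B a \<in> pro_carrier Fin_Sgrp B" using snoc by (auto intro: gen_in)
  ultimately have "h (smult (Free_Pro Fin_Sgrp B) (word_value (Free_Pro Fin_Sgrp B) (gen Fin_Sgrp B) u)
      (gen Fin_Sgrp B a)) = smult (Free_Pro V A) (h (word_value (Free_Pro Fin_Sgrp B) (gen Fin_Sgrp B) u))
      (h (gen Fin_Sgrp B a))"
    using h unfolding cont_hom_def shom_def by (simp del: Free_Pro_simps(2))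
  then show ?case using snoc by (simp add: word_value_snoc del: Free_Pro_simps(2))
qed auto

text \<open>Agreement on generators gives agreement on words. Every coordinate of a continuous map
  is locally constant, so density of the words does the rest.\<close>

lemma cont_hom_eq:
  assumes h: "h \<in> cont_hom (Free_Pro Fin_Sgrp B) (Free_Pro V A)"
    and g: "g \<in> cont_hom (Free_Pro Fin_Sgrp B) (Free_Pro V A)"
    and eq: "\<And>b. b \<in> B \<Longrightarrow> h (gen Fin_Sgrp B b) = g (gen Fin_Sgrp B b)"
  shows "h = g"
proof (rule extensionalityI[where A = "pro_carrier Fin_Sgrp B"])
  fix w assume w: "w \<in> pro_carrier Fin_Sgrp B"
  have in_carrier: "k v \<in> pro_carrier V A"
    if "k \<in> cont_hom (Free_Pro Fin_Sgrp B) (Free_Pro V A)" "v \<in> pro_carrier Fin_Sgrp B" for k v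
    using that by (auto simp: cont_hom_def shom_def)
  show "h w = g w"
  proof (rule pro_eqI)
    fix i assume i: "i \<in> pro_index V A"
    have op: "openin (topo (Free_Pro Fin_Sgrp B)) {v \<in> pro_carrier Fin_Sgrp B. k v i = k w i}"
      if k: "k \<in> cont_hom (Free_Pro Fin_Sgrp B) (Free_Pro V A)" for k
    proof -
      have "continuous_map (topo (Free_Pro Fin_Sgrp B)) (topo (Free_Pro V A)) k"
        using k by (simp add: cont_hom_def)
      from openin_continuous_map_preimage[OF this openin_eval[OF i, of "k w i"]]
      have "openin (topo (Free_Pro Fin_Sgrp B))
         {v \<in> pro_carrier Fin_Sgrp B. k v \<in> pro_carrier V A \<and> k v i = k w i}" by simp
      moreover have "{v \<in> pro_carrier Fin_Sgrp B. k v \<in> pro_carrier V A \<and> k v i = k w i}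
         = {v \<in> pro_carrier Fin_Sgrp B. k v i = k w i}" using in_carrier[OF k] by auto
      ultimately show ?thesis by simp
    qed
    obtain F where F: "finite F" "F \<subseteq> pro_index Fin_Sgrp B" and
      FU: "\<And>v. v \<in> pro_carrier Fin_Sgrp B \<Longrightarrow> \<forall>i\<in>F. v i = w i \<Longrightarrow> h v i = h w i \<and> g v i = g w i"
      using openin_Free_Pro_cylinder[OF openin_Int[OF op[OF h] op[OF g]], of w] w by auto
    obtain u where u: "u \<noteq> []" "set u \<subseteq> B" "\<forall>i\<in>F. w i = word_value (fst i) (snd i) u"
      using approx_by_word[OF w F] by blast
    let ?v = "word Fin_Sgrp B u"
    have "h ?v i = h w i \<and> g ?v i = g w i"
      using u F by (intro FU word_in) (auto simp: word_apply)
    moreover have "h ?v = g ?v"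
      unfolding cont_hom_word[OF h u(1,2)] cont_hom_word[OF g u(1,2)]
      using u eq by (intro word_value_cong) auto
    ultimately show "h w i = g w i" by simp
  qed (use in_carrier h g w in auto)
qed (use h g in \<open>auto simp: cont_hom_def\<close>)

text \<open>Existence is \<open>extend_cont_hom\<close> and uniqueness is
  \<open>cont_hom_eq\<close>. From here on the description by \<open>THE\<close> can be replaced by
  an explicit formula.\<close>

lemma lift_eq:
  assumes V: "V \<subseteq> Fin_Sgrp" and s: "\<And>b. b \<in> B \<Longrightarrow> s b \<in> pro_carrier V A"
  shows "lift B (Free_Pro V A) s = restrict (extend V A B s) (pro_carrier Fin_Sgrp B)"
  unfolding lift_def
proof (rule the_equality)
  show *: "restrict (extend V A B s) (pro_carrier Fin_Sgrp B)
      \<in> cont_hom (Free_Pro Fin_Sgrp B) (Free_Pro V A) \<and>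
      (\<forall>a\<in>B. restrict (extend V A B s) (pro_carrier Fin_Sgrp B) (gen Fin_Sgrp B a) = s a)"
    using extend_cont_hom[OF V s] extend_gen[OF V s] by (auto simp: gen_in)
  show "h = restrict (extend V A B s) (pro_carrier Fin_Sgrp B)"
    if "h \<in> cont_hom (Free_Pro Fin_Sgrp B) (Free_Pro V A) \<and> (\<forall>a\<in>B. h (gen Fin_Sgrp B a) = s a)" for h
    using that * by (intro cont_hom_eq) auto
qed

lemma cont_hom_eq_extend:
  assumes h: "h \<in> cont_hom (Free_Pro Fin_Sgrp B) (Free_Pro V A)" and V: "V \<subseteq> Fin_Sgrp"
  shows "h = restrict (extend V A B (\<lambda>b. h (gen Fin_Sgrp B b))) (pro_carrier Fin_Sgrp B)"
proof -
  have s: "h (gen Fin_Sgrp B b) \<in> pro_carrier V A" if "b \<in> B" for b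
    using h gen_in[OF that] by (auto simp: cont_hom_def shom_def)
  show ?thesis
    by (rule cont_hom_eq[OF h extend_cont_hom[OF V s]])
       (use extend_gen[OF V s] in \<open>auto simp: gen_in\<close>)
qed

text \<open>Evaluating the generators at i gives back the assignment \<open>snd i\<close>. Hence
  \<open>psi\<close> merely forgets the coordinates outside V.\<close>

lemma psi_apply:
  assumes V: "V \<subseteq> Fin_Sgrp" and w: "w \<in> pro_carrier Fin_Sgrp A" and i: "i \<in> pro_index V A"
  shows "psi V A w i = w i"
proof -
  have "(\<lambda>b\<in>A. gen V A b i) = snd i"
    using i by (auto simp: pro_index_def PiE_def extensional_def gen_def restrict_def)
  then show ?thesis using w i
    unfolding psi_def by (subst lift_eq[OF V gen_in]) (auto simp: extend_def)
qed

lemma psi_in: "V \<subseteq> Fin_Sgrp \<Longrightarrow> w \<in> pro_carrier Fin_Sgrp A \<Longrightarrow> psi V A w \<in> pro_carrier V A"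
  unfolding psi_def by (subst lift_eq[OF _ gen_in]) (auto intro!: extend_in gen_in)

lemma satisfies_iff:
  assumes V: "V \<subseteq> Fin_Sgrp" and "u \<in> pro_carrier Fin_Sgrp A" "v \<in> pro_carrier Fin_Sgrp A"
  shows "satisfies V A u v \<longleftrightarrow> (\<forall>i\<in>pro_index V A. u i = v i)"
  unfolding satisfies_def
  using psi_apply[OF V assms(2)] psi_apply[OF V assms(3)]
    pro_eqI[OF psi_in[OF V assms(2)] psi_in[OF V assms(3)]] by metis

subsection \<open>Closures of languages\<close>

text \<open>The closure of the nonempty words of L, tested at one coordinate at a time. Directedness
  of the index system makes this equivalent to testing finitely many coordinates at once.\<close>

definition word_limits :: "nat set \<Rightarrow> nat list set \<Rightarrow> pro_elem set" where
  "word_limits A L = {w \<in> pro_carrier Fin_Sgrp A.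
     \<forall>i\<in>pro_index Fin_Sgrp A. \<exists>u\<in>L. u \<noteq> [] \<and> w i = word_value (fst i) (snd i) u}"

lemma word_elem_eq: "u \<noteq> [] \<Longrightarrow> word_elem A u = Some (word Fin_Sgrp A u)"
  by (subst word_value_Free_Pro[symmetric]) (auto simp: neq_Nil_conv word_value_def)

lemma openin_adjoin_one:
  assumes "openin (adjoin_one_topo T) W" "Some w \<in> W"
  shows "\<exists>U. openin T U \<and> w \<in> U \<and> Some ` U \<subseteq> W"
proof -
  have "generate_topology_on (insert {None} {Some ` U | U. openin T U}) W"
    using assms(1) unfolding adjoin_one_topo_def by (rule openin_topology_generated_by)
  then show ?thesis using assms(2)
  proof (induction rule: generate_topology_on.induct)
    case (Int a b)
    then obtain U V where "openin T U" "w \<in> U" "Some ` U \<subseteq> a" "openin T V" "w \<in> V" "Some ` V \<subseteq> b"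
      by auto
    then show ?case by (intro exI[of _ "U \<inter> V"]) auto
  next
    case (UN K)
    then obtain k where k: "k \<in> K" "Some w \<in> k" by blast
    with UN.IH[OF k] show ?case by (meson Sup_upper subset_trans)
  next
    case (Basis s)
    then show ?case by auto
  qed auto
qed

lemma openin_adjoin_one_Some: "openin T U \<Longrightarrow> openin (adjoin_one_topo T) (Some ` U)"
  unfolding adjoin_one_topo_def by (intro topology_generated_by_Basis) auto

lemma word_limits_finite:
  assumes w: "w \<in> word_limits A L" and F: "finite F" "F \<subseteq> pro_index Fin_Sgrp A"
    and L: "\<And>u. u \<in> L \<Longrightarrow> set u \<subseteq> A"
  shows "\<exists>u\<in>L. u \<noteq> [] \<and> (\<forall>i\<in>F. w i = word_value (fst i) (snd i) u)"
proof -
  have wP: "w \<in> pro_carrier Fin_Sgrp A" using w by (simp add: word_limits_def)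
  obtain k where k: "k \<in> pro_index Fin_Sgrp A"
    and kF: "\<And>i. i \<in> F \<Longrightarrow> \<exists>h\<in>shom (fst k) (fst i). snd i = compose A h (snd k)"
    using common_refinement[OF F] by blast
  obtain u where u: "u \<in> L" "u \<noteq> []" "w k = word_value (fst k) (snd k) u"
    using w k by (auto simp: word_limits_def)
  have uP: "word Fin_Sgrp A u \<in> pro_carrier Fin_Sgrp A" using u L by (intro word_in) auto
  have "w i = word_value (fst i) (snd i) u" if "i \<in> F" for i
  proof -
    have i: "i \<in> pro_index Fin_Sgrp A" using that F by blast
    obtain h where h: "h \<in> shom (fst k) (fst i)" "snd i = compose A h (snd k)"
      using kF \<open>i \<in> F\<close> by blast
    have "w i = word Fin_Sgrp A u i"
      unfolding refine_value[OF wP i k h] refine_value[OF uP i k h]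
      using u k by (simp add: word_apply)
    then show ?thesis using i by (simp add: word_apply)
  qed
  with u show ?thesis by blast
qed

text \<open>The empty word is sent to the isolated point \<open>None\<close>, so it never helps to
  approximate \<open>Some w\<close>; the remaining words approximate w exactly in the sense of
  \<open>word_limits\<close>.\<close>

lemma Some_in_Cl_iff:
  assumes L: "\<And>u. u \<in> L \<Longrightarrow> set u \<subseteq> A"
  shows "Some w \<in> Cl A L \<longleftrightarrow> w \<in> word_limits A L"
proof
  assume "Some w \<in> Cl A L"
  then have w: "Some w \<in> topspace (adjoin_one_topo (topo (Free_Pro Fin_Sgrp A)))"
    and cl: "\<And>W. Some w \<in> W \<Longrightarrow> openin (adjoin_one_topo (topo (Free_Pro Fin_Sgrp A))) W \<Longrightarrow>
      \<exists>y\<in>word_elem A ` L. y \<in> W"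
    by (auto simp: Cl_def in_closure_of)
  from w have wP: "w \<in> pro_carrier Fin_Sgrp A"
    using openin_subset[of "topo (Free_Pro Fin_Sgrp A)"] by (auto simp: adjoin_one_topo_def)
  have "\<exists>u\<in>L. u \<noteq> [] \<and> w i = word_value (fst i) (snd i) u" if i: "i \<in> pro_index Fin_Sgrp A" for i
  proof -
    obtain u where u: "u \<in> L" "word_elem A u \<in> Some ` {v \<in> pro_carrier Fin_Sgrp A. v i = w i}"
      using cl[OF _ openin_adjoin_one_Some[OF openin_eval[OF i]], of "w i"] wP by blast
    then have "u \<noteq> []" by auto
    then show ?thesis using u i by (auto simp: word_elem_eq word_apply intro!: bexI[of _ u])
  qed
  with wP show "w \<in> word_limits A L" by (simp add: word_limits_def)
next
  assume w: "w \<in> word_limits A L"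
  then have wP: "w \<in> pro_carrier Fin_Sgrp A" by (simp add: word_limits_def)
  show "Some w \<in> Cl A L"
    unfolding Cl_def in_closure_of
  proof (intro conjI allI impI)
    have "Some ` pro_carrier Fin_Sgrp A \<subseteq> topspace (adjoin_one_topo (topo (Free_Pro Fin_Sgrp A)))"
      using openin_subset[OF openin_adjoin_one_Some[OF openin_topspace[of "topo (Free_Pro Fin_Sgrp A)"]]]
      unfolding topspace_Free_Pro .
    then show "Some w \<in> topspace (adjoin_one_topo (topo (Free_Pro Fin_Sgrp A)))"
      using wP by blast
    fix W assume "Some w \<in> W \<and> openin (adjoin_one_topo (topo (Free_Pro Fin_Sgrp A))) W"
    then obtain U where U: "openin (topo (Free_Pro Fin_Sgrp A)) U" "w \<in> U" "Some ` U \<subseteq> W"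
      using openin_adjoin_one[of "topo (Free_Pro Fin_Sgrp A)" W w] by metis
    obtain F where F: "finite F" "F \<subseteq> pro_index Fin_Sgrp A"
      "\<And>v. v \<in> pro_carrier Fin_Sgrp A \<Longrightarrow> \<forall>i\<in>F. v i = w i \<Longrightarrow> v \<in> U"
      using openin_Free_Pro_cylinder[OF U(1,2)] by blast
    obtain u where u: "u \<in> L" "u \<noteq> []" "\<forall>i\<in>F. w i = word_value (fst i) (snd i) u"
      using word_limits_finite[OF w F(1,2) L] by blast
    have uP: "word Fin_Sgrp A u \<in> pro_carrier Fin_Sgrp A" using u L by (intro word_in) auto
    have "word Fin_Sgrp A u i = w i" if "i \<in> F" for i
      using that u(3) F(2) by (auto simp: word_apply)
    then have "word Fin_Sgrp A u \<in> U" using F(3)[OF uP] by blast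
    then show "\<exists>y. y \<in> word_elem A ` L \<and> y \<in> W" using u U(3) word_elem_eq[OF u(2)]
      by (metis image_eqI image_subset_iff)
  qed
qed

lemma rational_lists: "rational A L \<Longrightarrow> u \<in> L \<Longrightarrow> set u \<subseteq> A"
proof (induction arbitrary: u rule: rational.induct)
  case (5 K L)
  then show ?case by fastforce
next
  case (6 L)
  then show ?case by fastforce
qed auto

subsection \<open>Powers\<close>

lemma spow_1 [simp]: "spow S x (Suc 0) = x"
  by (simp add: spow_def)

lemma spow_Suc: "0 < n \<Longrightarrow> spow S x (Suc n) = smult S (spow S x n) x"
  by (cases n) (auto simp: spow_def)

text \<open>Powers are values of words in one letter, so their laws follow from those of
  words.\<close>

lemma spow_eq_word_value: "0 < n \<Longrightarrow> spow S x n = word_value S (\<lambda>_. x) (replicate n 0)"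
proof (induction n)
  case (Suc n)
  show ?case
  proof (cases "n = 0")
    case False
    then show ?thesis using Suc word_value_snoc[of "replicate n 0" S "\<lambda>_. x" 0]
      by (simp add: spow_Suc replicate_append_same)
  qed simp
qed simp

lemma spow_closed: "semigroup_on S \<Longrightarrow> x \<in> carrier S \<Longrightarrow> spow S x n \<in> carrier S"
proof (cases "0 < n")
  case False
  then show "x \<in> carrier S \<Longrightarrow> spow S x n \<in> carrier S" by (simp add: spow_def)
qed (auto simp: spow_eq_word_value intro!: word_value_closed)

lemma spow_add:
  "semigroup_on S \<Longrightarrow> x \<in> carrier S \<Longrightarrow> 0 < m \<Longrightarrow> 0 < n \<Longrightarrow>
    spow S x (m + n) = smult S (spow S x m) (spow S x n)"
  using word_value_append[of S "replicate m 0" "\<lambda>_. x" "replicate n 0"]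
  by (auto simp: spow_eq_word_value replicate_add)

lemma spow_mult:
  assumes S: "semigroup_on S" "x \<in> carrier S" and m: "0 < m" "0 < n"
  shows "spow S (spow S x m) n = spow S x (m * n)"
  using m(2)
proof (induction n)
  case (Suc n)
  show ?case
  proof (cases "n = 0")
    case False
    then have "spow S x (m * n + m) = smult S (spow S x (m * n)) (spow S x m)"
      using m by (intro spow_add S) auto
    then show ?thesis using Suc False by (simp add: spow_Suc add.commute)
  qed simp
qed simp

lemma spow_hom:
  assumes "h \<in> shom S T" "semigroup_on S" "x \<in> carrier S"
  shows "h (spow S x n) = spow T (h x) n"
proof (cases "0 < n")
  case True
  then show ?thesis using word_value_hom[OF assms(1,2), of "replicate n 0" "\<lambda>_. x"] assms(3)
    by (auto simp: spow_eq_word_value)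
qed (simp add: spow_def)

lemma spow_Free_Pro:
  "x \<in> pro_carrier V A \<Longrightarrow> i \<in> pro_index V A \<Longrightarrow> spow (Free_Pro V A) x n i = spow (fst i) (x i) n"
proof (induction n)
  case (Suc n)
  then show ?case by (cases "n = 0") (auto simp: spow_Suc)
qed (simp add: spow_def)

lemma spow_Free_Pro_in:
  "V \<subseteq> Fin_Sgrp \<Longrightarrow> x \<in> pro_carrier V A \<Longrightarrow> spow (Free_Pro V A) x n \<in> pro_carrier V A"
proof (induction n)
  case (Suc n)
  then show ?case
    by (cases "n = 0") (auto simp: spow_Suc simp del: Free_Pro_simps intro!: smult_in)
qed (simp add: spow_def)

text \<open>Pigeonhole among the first \<open>card S + 1\<close> iterates. The bound on i + d
  matters later: for k at least \<open>card S\<close> it makes the period d divide k!.\<close>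

lemma funpow_periodic:
  fixes g :: "'a \<Rightarrow> 'a"
  assumes S: "finite S" "\<And>m. (g ^^ m) x \<in> S"
  shows "\<exists>i d. 0 < d \<and> i + d \<le> card S \<and> (\<forall>m\<ge>i. \<forall>k. (g ^^ (m + d * k)) x = (g ^^ m) x)"
proof -
  have "card ((\<lambda>m. (g ^^ m) x) ` {..card S}) \<le> card S" using S by (intro card_mono) auto
  then have "\<not> inj_on (\<lambda>m. (g ^^ m) x) {..card S}" by (intro pigeonhole) simp
  then obtain i j where ij: "i < j" "j \<le> card S" "(g ^^ i) x = (g ^^ j) x"
    unfolding inj_on_def by (metis atMost_iff linorder_neqE_nat)
  define d where "d = j - i"
  have step: "(g ^^ (m + d)) x = (g ^^ m) x" if "i \<le> m" for m
  proof -
    have "(g ^^ (m + d)) x = (g ^^ (m - i)) ((g ^^ j) x)"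
      using that ij(1) by (simp add: d_def funpow_add[symmetric, THEN fun_cong, unfolded comp_def])
    also have "\<dots> = (g ^^ m) x"
      unfolding ij(3)[symmetric] using that
      by (simp add: funpow_add[symmetric, THEN fun_cong, unfolded comp_def])
    finally show ?thesis .
  qed
  have "(g ^^ (m + d * k)) x = (g ^^ m) x" if "i \<le> m" for m k
  proof (induction k)
    case (Suc k)
    then show ?case using step[of "m + d * k"] that by (simp add: algebra_simps)
  qed simp
  moreover have "0 < d" "i + d \<le> card S" using ij by (simp_all add: d_def)
  ultimately show ?thesis by blast
qed

lemma funpow_eventually_periodic:
  fixes g :: "'a \<Rightarrow> 'a"
  assumes "finite (range (\<lambda>m. (g ^^ m) x))"
  shows "\<exists>c>0. \<forall>m n. c \<le> m \<longrightarrow> c \<le> n \<longrightarrow> m mod c = n mod c \<longrightarrow> (g ^^ m) x = (g ^^ n) x"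
proof -
  obtain i d where d: "0 < d" and
    steps: "\<And>m k. i \<le> m \<Longrightarrow> (g ^^ (m + d * k)) x = (g ^^ m) x"
    using funpow_periodic[OF assms, of g x] by (metis rangeI)
  \<comment> \<open>A multiple of the period that is at least the preperiod, so that one number
    serves as both threshold and modulus.\<close>
  define c where "c = d * Suc i"
  have c: "c > 0" "i \<le> c" using d by (cases d; simp add: c_def)+
  have le: "(g ^^ m) x = (g ^^ n) x" if le: "c \<le> m" "m \<le> n" "m mod c = n mod c" for m n
  proof -
    obtain q where q: "n = m + c * q"
      using le(2,3) mod_eq_dvd_iff_nat[of m n c] by (metis dvdE le_add_diff_inverse)
    have "i \<le> m" using le(1) c(2) by simp
    from steps[OF this, of "Suc i * q"] q show ?thesis by (simp only: c_def mult.assoc)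
  qed
  have "(g ^^ m) x = (g ^^ n) x" if "c \<le> m" "c \<le> n" "m mod c = n mod c" for m n
    using le[of m n] le[of n m] that by (metis nat_le_linear)
  then show ?thesis using c by blast
qed

lemma power_mod_periodic:
  fixes n c :: nat
  assumes c: "0 < c"
  shows "\<exists>i d. 0 < d \<and> i + d \<le> c \<and> (\<forall>m\<ge>i. \<forall>k. n ^ (m + d * k) mod c = n ^ m mod c)"
proof -
  have iter: "((\<lambda>y. y * n mod c) ^^ m) (1 mod c) = n ^ m mod c" for m
  proof (induction m)
    case (Suc m)
    then show ?case by (simp add: mod_mult_right_eq mult.commute)
  qed simp
  show ?thesis
    using funpow_periodic[of "{..<c}" "\<lambda>y. y * n mod c" "1 mod c"] c unfolding iter by simp
qed

text \<open>For k at least c, the exponent k! - 1 lies beyond the preperiod of the powers of n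
  modulo c, and two such exponents differ by a multiple of the period.\<close>

lemma power_fact_mod:
  fixes n c :: nat
  assumes c: "0 < c" "c \<le> k" "c \<le> l"
  shows "n ^ (fact k - 1) mod c = n ^ (fact l - 1) mod c"
proof -
  obtain i d where id: "0 < d" "i + d \<le> c"
    and per: "\<And>m k. i \<le> m \<Longrightarrow> n ^ (m + d * k) mod c = n ^ m mod c"
    using power_mod_periodic[OF c(1), of n] by metis
  have *: "n ^ (fact k - 1) mod c = n ^ (fact l - 1) mod c" if kl: "c \<le> k" "k \<le> l" for k l
  proof -
    have le: "fact k \<le> (fact l :: nat)" using kl by (intro fact_mono)
    have "d dvd fact k" "d dvd fact l" using id kl by (auto intro!: dvd_fact)
    then have "d dvd fact l - fact k" by (intro dvd_diff_nat)
    then obtain j where j: "fact l - fact k = d * j" ..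
    have k: "c \<le> fact k" using fact_ge_self[of k] kl by simp
    then have "fact l - 1 = fact k - 1 + d * j" using j le c(1) by linarith
    moreover have "i \<le> fact k - 1" using k id by simp
    ultimately show ?thesis using per[of "fact k - 1" j] by (simp only:)
  qed
  show ?thesis
  proof (cases "k \<le> l")
    case True
    show ?thesis by (rule *[OF c(2) True])
  next
    case False
    then have "l \<le> k" by simp
    from *[OF c(3) this] show ?thesis by (rule sym)
  qed
qed

text \<open>Convergence of exponents in every finite monogenic semigroup: the exponents must
  eventually pass each preperiod and have constant residue modulo each period, and c plays both
  parts.\<close>

definition profinitely_convergent :: "(nat \<Rightarrow> nat) \<Rightarrow> bool" where
  "profinitely_convergent e \<longleftrightarrow>
     (\<forall>c>0. \<exists>r. \<forall>\<^sub>F k in sequentially. c \<le> e k \<and> e k mod c = r)"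

lemma fact_minus_one_convergent: "profinitely_convergent (\<lambda>k. fact k - 1)"
  unfolding profinitely_convergent_def
proof (intro allI impI exI)
  fix c :: nat assume c: "0 < c"
  show "\<forall>\<^sub>F k in sequentially. c \<le> fact k - 1 \<and> (fact k - 1) mod c = c - 1"
    using eventually_ge_at_top[of "Suc c"]
  proof eventually_elim
    case (elim k)
    have "c dvd fact k" using elim c by (simp add: dvd_fact)
    then obtain q where q: "fact k = c * q" ..
    moreover have "q \<noteq> 0" using q fact_nonzero[of k, where 'a = nat] by auto
    ultimately have "(fact k - 1 :: nat) = (c - 1) + c * (q - 1)"
      using c by (cases q; cases c) auto
    then have "(fact k - 1) mod c = c - 1" using c by (simp only: mod_mult_self2) simp
    moreover have "c + 1 \<le> fact k" using fact_ge_self[of k] elim by simp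
    ultimately show ?case by linarith
  qed
qed

lemma power_fact_minus_one_convergent:
  assumes n: "2 \<le> n"
  shows "profinitely_convergent (\<lambda>k. n ^ (fact k - 1))"
  unfolding profinitely_convergent_def
proof (intro allI impI)
  fix c :: nat assume c: "0 < c"
  have "\<forall>\<^sub>F k in sequentially. c \<le> n ^ (fact k - 1) \<and> n ^ (fact k - 1) mod c = n ^ (fact c - 1) mod c"
    using eventually_ge_at_top[of "Suc c"]
  proof eventually_elim
    case (elim k)
    have "fact k - 1 < n ^ (fact k - 1)" using n by (intro power_gt_expt) auto
    moreover have "Suc c \<le> fact k" using fact_ge_self[of k] elim by simp
    ultimately have "c \<le> n ^ (fact k - 1)" by linarith
    then show ?case using power_fact_mod[of c k c n] elim c by simp
  qed
  then show "\<exists>r. \<forall>\<^sub>F k in sequentially. c \<le> n ^ (fact k - 1) \<and> n ^ (fact k - 1) mod c = r" by blast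
qed

lemma spow_convergent:
  assumes e: "profinitely_convergent e" and S: "S \<in> Fin_Sgrp" and x: "x \<in> carrier S"
  shows "\<exists>y. \<forall>\<^sub>F k in sequentially. spow S x (e k) = y"
proof -
  let ?g = "\<lambda>y. smult S y x"
  have "(?g ^^ m) x = spow S x (Suc m)" for m by (simp add: spow_def)
  then have "range (\<lambda>m. (?g ^^ m) x) \<subseteq> carrier S"
    using spow_closed[OF Fin_SgrpD(1)[OF S] x] by auto
  then obtain c where c: "c > 0"
    "\<And>m n. c \<le> m \<Longrightarrow> c \<le> n \<Longrightarrow> m mod c = n mod c \<Longrightarrow> (?g ^^ m) x = (?g ^^ n) x"
    using funpow_eventually_periodic[of ?g x] finite_subset[OF _ Fin_SgrpD(2)[OF S]] by blast
  \<comment> \<open>The power with exponent n is the iterate number n - 1; the factor 2 leaves room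
    for this shift, so that e k - 1 is still at least c.\<close>
  obtain r where r: "\<forall>\<^sub>F k in sequentially. 2 * c \<le> e k \<and> e k mod (2 * c) = r"
    using e[unfolded profinitely_convergent_def, rule_format, of "2 * c"] c(1) by auto
  obtain k0 where k0: "2 * c \<le> e k0" "e k0 mod (2 * c) = r"
    using eventually_happens[OF r] by auto
  have "\<forall>\<^sub>F k in sequentially. spow S x (e k) = spow S x (e k0)"
    using r
  proof eventually_elim
    case (elim k)
    have "e k mod c = e k0 mod c" using elim k0 mod_mod_cancel[of c "2 * c" "e k"] mod_mod_cancel[of c "2 * c" "e k0"] by simp
    then have "(e k - 1) mod c = (e k0 - 1) mod c"
    proof -
      have "e k + (c - 1) = (e k - 1) + c" "e k0 + (c - 1) = (e k0 - 1) + c"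
        using elim k0 c(1) by auto
      moreover have "(e k + (c - 1)) mod c = (e k0 + (c - 1)) mod c"
        using \<open>e k mod c = e k0 mod c\<close> by (metis mod_add_left_eq)
      ultimately show ?thesis by simp
    qed
    then show ?case unfolding spow_def using elim k0 c(1) by (intro c(2)) auto
  qed
  then show ?thesis by blast
qed

text \<open>The limit is assembled from the eventual values at the single coordinates. It is natural
  because homomorphisms preserve powers, and unique because fixing one coordinate is an open
  condition.\<close>

lemma power_limit_spec:
  assumes e: "profinitely_convergent e"
  shows "power_limit e \<in> pro_carrier Fin_Sgrp {..<1}"
    and "i \<in> pro_index Fin_Sgrp {..<1} \<Longrightarrow>
      \<forall>\<^sub>F k in sequentially. power_limit e i = spow (fst i) (snd i 0) (e k)"
proof -
  let ?I = "pro_index Fin_Sgrp {..<1}" and ?P = "pro_carrier Fin_Sgrp {..<1}"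
  let ?x = "gen Fin_Sgrp {..<1} 0"
  let ?s = "\<lambda>k. spow (Free_Pro Fin_Sgrp {..<1}) ?x (e k)"
  define Q where "Q i c \<longleftrightarrow> (\<forall>\<^sub>F k in sequentially. spow (fst i) (snd i 0) (e k) = c)"
    for i :: "nat sgrp \<times> (nat \<Rightarrow> nat)" and c
  define y where "y = (\<lambda>i\<in>?I. SOME c. Q i c)"
  have Qy: "Q i (y i)" if "i \<in> ?I" for i
  proof -
    have "snd i 0 \<in> carrier (fst i)" using PiE_mem[OF pro_indexD(2)[OF that], of 0] by simp
    then have "\<exists>c. Q i c" unfolding Q_def by (rule spow_convergent[OF e pro_indexD(1)[OF that]])
    from someI_ex[OF this] show ?thesis using that by (simp add: y_def)
  qed
  have Q_unique: "c = d" if "Q i c" "Q i d" for i c d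
    using eventually_happens[OF eventually_conj[OF that[unfolded Q_def]]] by auto
  have x: "?x \<in> ?P" by (rule gen_in) auto
  have s: "?s k \<in> ?P" for k by (rule spow_Free_Pro_in) (use x in auto)
  have s_apply: "?s k i = spow (fst i) (snd i 0) (e k)" if "i \<in> ?I" for i k
    using spow_Free_Pro[OF x that] that by (simp add: gen_def)
  have y: "y \<in> ?P"
  proof (rule pro_carrierI)
    fix i assume i: "i \<in> ?I"
    obtain k where "spow (fst i) (snd i 0) (e k) = y i"
      using eventually_happens[OF Qy[OF i, unfolded Q_def]] by auto
    then show "y i \<in> carrier (fst i)"
      using spow_closed[OF Fin_SgrpD(1)[OF pro_indexD(1)[OF i]], of "snd i 0" "e k"]
        PiE_mem[OF pro_indexD(2)[OF i], of 0] by simp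
  next
    fix S T and \<phi> h :: "nat \<Rightarrow> nat" assume *: "S \<in> Fin_Sgrp" "T \<in> Fin_Sgrp" "\<phi> \<in> {..<1} \<rightarrow>\<^sub>E carrier S" "h \<in> shom S T"
    then have i: "(S, \<phi>) \<in> ?I" "(T, compose {..<1} h \<phi>) \<in> ?I"
      using compose_PiE[OF *(4,3)] by (auto simp: pro_index_def)
    have "\<forall>\<^sub>F k in sequentially. y (T, compose {..<1} h \<phi>) = h (y (S, \<phi>))"
      using Qy[OF i(1), unfolded Q_def] Qy[OF i(2), unfolded Q_def]
    proof eventually_elim
      case (elim k)
      have "h (spow S (\<phi> 0) (e k)) = spow T (h (\<phi> 0)) (e k)"
        using * by (intro spow_hom) (auto dest: Fin_SgrpD)
      then show ?case using elim by (simp add: compose_def)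
    qed
    then show "y (T, compose {..<1} h \<phi>) = h (y (S, \<phi>))" by simp
  qed (simp add: y_def)
  have lim: "limitin (topo (Free_Pro Fin_Sgrp {..<1})) ?s y sequentially"
    unfolding limitin_def
  proof (intro conjI allI impI)
    fix U assume U: "openin (topo (Free_Pro Fin_Sgrp {..<1})) U \<and> y \<in> U"
    then obtain F where F: "finite F" "F \<subseteq> ?I"
      "\<And>v. v \<in> ?P \<Longrightarrow> \<forall>i\<in>F. v i = y i \<Longrightarrow> v \<in> U"
      using openin_Free_Pro_cylinder by meson
    have "\<forall>\<^sub>F k in sequentially. \<forall>i\<in>F. spow (fst i) (snd i 0) (e k) = y i"
      using F(1,2) Qy by (subst eventually_ball_finite_distrib) (auto simp: Q_def)
    then show "\<forall>\<^sub>F k in sequentially. ?s k \<in> U"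
    proof eventually_elim
      case (elim k)
      then show ?case using F(2) s_apply by (intro F(3) s) (auto simp: subset_iff)
    qed
  qed (use y in simp)
  have "power_limit e = y"
    unfolding power_limit_def
  proof (rule the_equality)
    fix z assume z: "limitin (topo (Free_Pro Fin_Sgrp {..<1})) ?s z sequentially"
    then have zP: "z \<in> ?P" by (auto simp: limitin_def)
    show "z = y"
    proof (rule pro_eqI[OF zP y])
      fix i assume i: "i \<in> ?I"
      have "\<forall>\<^sub>F k in sequentially. ?s k \<in> {v \<in> ?P. v i = z i}"
        using z openin_eval[OF i, of "z i"] zP unfolding limitin_def by auto
      then have "Q i (z i)" unfolding Q_def by eventually_elim (use s_apply[OF i] in auto)
      then show "z i = y i" using Q_unique Qy[OF i] by blast
    qed
  qed (rule lim)
  then show "power_limit e \<in> ?P" "i \<in> ?I \<Longrightarrow>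
      \<forall>\<^sub>F k in sequentially. power_limit e i = spow (fst i) (snd i 0) (e k)"
    using y Qy unfolding Q_def by (auto simp: eq_commute)
qed

subsection \<open>The signature\<close>

lemma apply_op_eq:
  assumes "V \<subseteq> Fin_Sgrp" "\<And>b. b < n \<Longrightarrow> s b \<in> pro_carrier V A" "w \<in> pro_carrier Fin_Sgrp {..<n}"
  shows "apply_op n w (Free_Pro V A) s = extend V A {..<n} s w"
  unfolding apply_op_def using assms by (subst lift_eq) auto

lemma apply_op_cong:
  "(\<And>b. b < n \<Longrightarrow> s b = t b) \<Longrightarrow> apply_op n w S s = apply_op n w S t"
  unfolding apply_op_def lift_def by (simp cong: conj_cong)

lemma mult_op_in: "mult_op \<in> pro_carrier Fin_Sgrp {..<2}"
  unfolding mult_op_def by (intro smult_in gen_in) auto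

lemma apply_mult_op:
  assumes "V \<subseteq> Fin_Sgrp" "s 0 \<in> pro_carrier V A" "s 1 \<in> pro_carrier V A"
  shows "apply_op 2 mult_op (Free_Pro V A) s = smult (Free_Pro V A) (s 0) (s 1)"
proof -
  have s: "s b \<in> pro_carrier V A" if "b < 2" for b using assms that by (auto simp: less_2_cases_iff)
  have "extend V A {..<2} s mult_op = smult (Free_Pro V A) (s 0) (s 1)"
  proof
    fix i
    show "extend V A {..<2} s mult_op i = smult (Free_Pro V A) (s 0) (s 1) i"
      using extend_index[where s = s and B = "{..<2}" and i = i, OF assms(1)] s
      by (cases "i \<in> pro_index V A") (auto simp: extend_def mult_op_def)
  qed
  then show ?thesis using apply_op_eq[where s = s, OF assms(1) s mult_op_in] by simp
qed

lemma apply_power_limit: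
  assumes V: "V \<subseteq> Fin_Sgrp" and e: "profinitely_convergent e" and s: "s 0 \<in> pro_carrier V A"
  shows "apply_op 1 (power_limit e) (Free_Pro V A) s \<in> pro_carrier V A"
    and "i \<in> pro_index V A \<Longrightarrow> \<forall>\<^sub>F k in sequentially.
      apply_op 1 (power_limit e) (Free_Pro V A) s i = spow (fst i) (s 0 i) (e k)"
proof -
  have s': "\<And>b. b \<in> {..<1} \<Longrightarrow> s b \<in> pro_carrier V A" "\<And>b. b < 1 \<Longrightarrow> s b \<in> pro_carrier V A"
    using s by auto
  have eq: "apply_op 1 (power_limit e) (Free_Pro V A) s = extend V A {..<1} s (power_limit e)"
    by (rule apply_op_eq[OF V s'(2) power_limit_spec(1)[OF e]])
  show "apply_op 1 (power_limit e) (Free_Pro V A) s \<in> pro_carrier V A"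
    unfolding eq by (rule extend_in[OF V s'(1) power_limit_spec(1)[OF e]])
  assume i: "i \<in> pro_index V A"
  show "\<forall>\<^sub>F k in sequentially.
      apply_op 1 (power_limit e) (Free_Pro V A) s i = spow (fst i) (s 0 i) (e k)"
    using power_limit_spec(2)[OF e extend_index[where s = s, OF V s'(1) i]] i
    unfolding eq by (simp add: extend_def)
qed

lemma finite_primesD: "q \<in> finite_primes \<pi> \<Longrightarrow> prime q" "q \<in> finite_primes \<pi> \<Longrightarrow> 2 \<le> q"
  by (auto simp: finite_primes_def prime_ge_2_nat)

lemma sigma_pi_simps [simp]:
  "symbols (sigma_pi \<pi>) = {0, 1} \<union> finite_primes \<pi>"
  "arity (sigma_pi \<pi>) f = (if f = 0 then 2 else 1)"
  "interp (sigma_pi \<pi>) f = (if f = 0 then mult_op else if f = 1 then omega_minus_one_op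
                   else nat_omega_minus_one_op f)"
  by (simp_all add: sigma_pi_def)

lemma sigma_term_induct [consumes 1, case_names Var mult inv pow]:
  assumes "sterm_over (sigma_pi \<pi>) A t"
    and "\<And>a. a \<in> A \<Longrightarrow> P (Var a)"
    and "\<And>s t. sterm_over (sigma_pi \<pi>) A s \<Longrightarrow> P s \<Longrightarrow> sterm_over (sigma_pi \<pi>) A t \<Longrightarrow> P t \<Longrightarrow>
      P (App 0 [s, t])"
    and "\<And>t. sterm_over (sigma_pi \<pi>) A t \<Longrightarrow> P t \<Longrightarrow> P (App 1 [t])"
    and "\<And>q t. q \<in> finite_primes \<pi> \<Longrightarrow> sterm_over (sigma_pi \<pi>) A t \<Longrightarrow> P t \<Longrightarrow> P (App q [t])"
  shows "P t"
  using assms(1)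
proof (induction rule: sterm_over.induct)
  case (2 f ts)
  consider "f = 0" | "f = 1" | "f \<noteq> 0" "f \<in> finite_primes \<pi>" using 2(1) by auto
  then show ?case
  proof cases
    case 1
    then obtain s t where "ts = [s, t]" using 2(2) by (auto simp: length_Suc_conv numeral_2_eq_2)
    then show ?thesis using 1 2 assms(3) by auto
  next
    case _: 2
    then obtain t where "ts = [t]" using 2(2) by (auto simp: length_Suc_conv)
    then show ?thesis using \<open>f = 1\<close> 2 assms(4) by auto
  next
    case 3
    then obtain t where "ts = [t]" using 2(2) by (auto simp: length_Suc_conv)
    then show ?thesis using 3 2 assms(5) by auto
  qed
qed (rule assms(2))

text \<open>The exponents tending to omega - 1 for \<open>f = 1\<close> and to f^(omega-1)
  otherwise, in accordance with the symbols of \<open>sigma_pi\<close>.\<close>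

definition exponent_seq :: "nat \<Rightarrow> nat \<Rightarrow> nat" where
  "exponent_seq f = (if f = 1 then (\<lambda>k. fact k - 1) else (\<lambda>k. f ^ (fact k - 1)))"

lemma exponent_seq_convergent: "1 \<le> f \<Longrightarrow> profinitely_convergent (exponent_seq f)"
  by (simp add: exponent_seq_def fact_minus_one_convergent[simplified]
      power_fact_minus_one_convergent[simplified])

text \<open>This is an explicit rate of convergence: modulo c the limit is attained from index c on.
  It makes the coefficients of terms computable.\<close>

lemma exponent_seq_mod:
  assumes c: "0 < c" "c \<le> k" "c \<le> l"
  shows "exponent_seq f k mod c = exponent_seq f l mod c"
proof (cases "f = 1")
  case True
  have "[fact k - 1 = fact l - (1::nat)] (mod c)"
  proof -
    have "c dvd fact k" "c dvd fact l" using c by (auto intro!: dvd_fact)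
    then have "[fact k - 1 + 1 = fact l - 1 + 1] (mod c)" by (simp add: cong_def)
    then show ?thesis by (simp only: cong_add_rcancel_nat)
  qed
  then show ?thesis using True by (simp add: exponent_seq_def cong_def)
next
  case False
  then show ?thesis using power_fact_mod[OF c] by (simp add: exponent_seq_def)
qed

lemma interp_power: "f \<noteq> 0 \<Longrightarrow> interp (sigma_pi \<pi>) f = power_limit (exponent_seq f)"
  by (simp add: exponent_seq_def omega_minus_one_op_def nat_omega_minus_one_op_def)

lemma eval_mult:
  assumes "V \<subseteq> Fin_Sgrp" "sterm_eval (sigma_pi \<pi>) V A s \<in> pro_carrier V A"
    "sterm_eval (sigma_pi \<pi>) V A t \<in> pro_carrier V A"
  shows "sterm_eval (sigma_pi \<pi>) V A (App 0 [s, t])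
    = smult (Free_Pro V A) (sterm_eval (sigma_pi \<pi>) V A s) (sterm_eval (sigma_pi \<pi>) V A t)"
  using apply_mult_op[OF assms(1), of "\<lambda>i. map (sterm_eval (sigma_pi \<pi>) V A) [s, t] ! i"] assms(2,3)
  by (simp del: Free_Pro_simps)

lemma eval_power:
  assumes V: "V \<subseteq> Fin_Sgrp" and f: "1 \<le> f"
    and t: "sterm_eval (sigma_pi \<pi>) V A t \<in> pro_carrier V A"
  shows "sterm_eval (sigma_pi \<pi>) V A (App f [t]) \<in> pro_carrier V A"
    and "i \<in> pro_index V A \<Longrightarrow> \<forall>\<^sub>F k in sequentially. sterm_eval (sigma_pi \<pi>) V A (App f [t]) i
      = spow (fst i) (sterm_eval (sigma_pi \<pi>) V A t i) (exponent_seq f k)"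
  using apply_power_limit[OF V exponent_seq_convergent[OF f],
      of "\<lambda>i. map (sterm_eval (sigma_pi \<pi>) V A) [t] ! i"] f t
  by (auto simp: interp_power simp del: sigma_pi_simps(3))

lemma eval_in:
  assumes V: "V \<subseteq> Fin_Sgrp" and "sterm_over (sigma_pi \<pi>) A t"
  shows "sterm_eval (sigma_pi \<pi>) V A t \<in> pro_carrier V A"
  using assms(2)
proof (induction rule: sigma_term_induct)
  case (mult s t)
  then show ?case using eval_mult[OF V, of \<pi> A s t] smult_in[OF V]
    by (simp del: Free_Pro_simps sterm_eval.simps)
next
  case (inv t)
  then show ?case by (intro eval_power V) auto
next
  case (pow q t)
  then have "1 \<le> q" using finite_primesD(2)[of q \<pi>] by simp
  then show ?case using pow by (intro eval_power V) auto
qed (auto simp: gen_in)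

text \<open>Both values are eventually equal to the same power in the finite semigroup
  \<open>fst i\<close>. Terms over V can therefore be studied by their coefficients over all finite
  semigroups.\<close>

lemma eval_restrict:
  assumes V: "V \<subseteq> Fin_Sgrp" and i: "i \<in> pro_index V A" and "sterm_over (sigma_pi \<pi>) A t"
  shows "sterm_eval (sigma_pi \<pi>) V A t i = sterm_eval (sigma_pi \<pi>) Fin_Sgrp A t i"
  using assms(3)
proof (induction rule: sigma_term_induct)
  case (Var a)
  then show ?case using i V pro_index_mono[OF V i] by simp
next
  case (mult s t)
  then show ?case using i pro_index_mono[OF V i]
    eval_mult[OF V eval_in[OF V mult(1)] eval_in[OF V mult(2)]]
    eval_mult[OF order_refl eval_in[OF order_refl mult(1)] eval_in[OF order_refl mult(2)]]
    by (simp del: sterm_eval.simps)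
next
  case (inv t)
  have "\<forall>\<^sub>F k in sequentially. sterm_eval (sigma_pi \<pi>) V A (App 1 [t]) i
      = sterm_eval (sigma_pi \<pi>) Fin_Sgrp A (App 1 [t]) i"
    using eval_power(2)[OF V order_refl eval_in[OF V inv(1)] i]
      eval_power(2)[OF order_refl order_refl eval_in[OF order_refl inv(1)] pro_index_mono[OF V i]]
    by eventually_elim (use inv in simp)
  then show ?case by (simp del: sterm_eval.simps)
next
  case (pow q t)
  have q: "1 \<le> q" using finite_primesD(2)[OF pow(1)] by simp
  have "\<forall>\<^sub>F k in sequentially. sterm_eval (sigma_pi \<pi>) V A (App q [t]) i
      = sterm_eval (sigma_pi \<pi>) Fin_Sgrp A (App q [t]) i"
    using eval_power(2)[OF V q eval_in[OF V pow(2)] i]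
      eval_power(2)[OF order_refl q eval_in[OF order_refl pow(2)] pro_index_mono[OF V i]]
    by eventually_elim (use pow in simp)
  then show ?case by (simp del: sterm_eval.simps)
qed

lemma Omega_sig_eq:
  "Omega_sig \<sigma> V A = {sterm_eval \<sigma> V A t |t. sterm_over \<sigma> A t}"
proof (rule Set.set_eqI, rule iffI)
  fix w assume "w \<in> Omega_sig \<sigma> V A"
  then show "w \<in> {sterm_eval \<sigma> V A t |t. sterm_over \<sigma> A t}"
  proof (induction rule: Omega_sig.induct)
    case (1 a)
    then show ?case by (auto intro!: exI[of _ "Var a"] sterm_over.intros)
  next
    case (2 f s)
    then have "\<forall>i. \<exists>t. i < arity \<sigma> f \<longrightarrow> sterm_over \<sigma> A t \<and> s i = sterm_eval \<sigma> V A t" by auto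
    then obtain t where t: "\<And>i. i < arity \<sigma> f \<Longrightarrow> sterm_over \<sigma> A (t i)"
      "\<And>i. i < arity \<sigma> f \<Longrightarrow> s i = sterm_eval \<sigma> V A (t i)" by metis
    have "sterm_over \<sigma> A (App f (map t [0..<arity \<sigma> f]))"
      using 2(1) t(1) by (intro sterm_over.intros) auto
    moreover have "apply_op (arity \<sigma> f) (interp \<sigma> f) (Free_Pro V A) s
        = sterm_eval \<sigma> V A (App f (map t [0..<arity \<sigma> f]))"
      unfolding sterm_eval.simps by (rule apply_op_cong) (simp add: t(2))
    ultimately show ?case by blast
  qed
next
  fix w assume "w \<in> {sterm_eval \<sigma> V A t |t. sterm_over \<sigma> A t}"
  then obtain t where "sterm_over \<sigma> A t" "w = sterm_eval \<sigma> V A t" by auto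
  then show "w \<in> Omega_sig \<sigma> V A"
  proof (induction arbitrary: w rule: sterm_over.induct)
    case (2 f ts)
    show ?case unfolding 2(5) sterm_eval.simps using 2 by (intro Omega_sig.intros) auto
  qed (auto intro: Omega_sig.intros)
qed

lemma Omega_in: "V \<subseteq> Fin_Sgrp \<Longrightarrow> w \<in> Omega_sig (sigma_pi \<pi>) V A \<Longrightarrow> w \<in> pro_carrier V A"
  by (auto simp: Omega_sig_eq eval_in)

lemma Omega_smult:
  assumes "v \<in> Omega_sig (sigma_pi \<pi>) Fin_Sgrp A" "w \<in> Omega_sig (sigma_pi \<pi>) Fin_Sgrp A"
  shows "smult (Free_Pro Fin_Sgrp A) v w \<in> Omega_sig (sigma_pi \<pi>) Fin_Sgrp A"
proof -
  obtain s t where st: "sterm_over (sigma_pi \<pi>) A s" "v = sterm_eval (sigma_pi \<pi>) Fin_Sgrp A s"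
    "sterm_over (sigma_pi \<pi>) A t" "w = sterm_eval (sigma_pi \<pi>) Fin_Sgrp A t"
    using assms by (auto simp: Omega_sig_eq)
  have "sterm_over (sigma_pi \<pi>) A (App 0 [s, t])"
    using st by (intro sterm_over.intros) auto
  moreover have "smult (Free_Pro Fin_Sgrp A) v w = sterm_eval (sigma_pi \<pi>) Fin_Sgrp A (App 0 [s, t])"
    using st by (simp only: eval_mult eval_in order_refl)
  ultimately show ?thesis unfolding Omega_sig_eq by blast
qed

lemma Omega_power:
  assumes "w \<in> Omega_sig (sigma_pi \<pi>) Fin_Sgrp A" "f = 1 \<or> f \<in> finite_primes \<pi>"
  shows "\<exists>v\<in>Omega_sig (sigma_pi \<pi>) Fin_Sgrp A. \<forall>i\<in>pro_index Fin_Sgrp A.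
    \<forall>\<^sub>F k in sequentially. v i = spow (fst i) (w i) (exponent_seq f k)"
proof -
  obtain t where t: "sterm_over (sigma_pi \<pi>) A t" "w = sterm_eval (sigma_pi \<pi>) Fin_Sgrp A t"
    using assms by (auto simp: Omega_sig_eq)
  have f: "1 \<le> f" using assms(2) finite_primesD(2) by fastforce
  have "sterm_over (sigma_pi \<pi>) A (App f [t])"
    using t assms(2) f by (intro sterm_over.intros) auto
  then show ?thesis unfolding Omega_sig_eq
    using eval_power(2)[OF order_refl f eval_in[OF order_refl t(1)]] t(2) by blast
qed

subsection \<open>Natural divisors of a supernatural number\<close>

definition nat_dvd :: "nat \<Rightarrow> supernatural \<Rightarrow> bool" where
  "nat_dvd N \<pi> \<longleftrightarrow> 0 < N \<and> supernatural_dvd (supernatural_of N) \<pi>"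

lemma nat_dvd_iff:
  "nat_dvd N \<pi> \<longleftrightarrow> 0 < N \<and> (\<forall>p. prime p \<longrightarrow> enat (multiplicity p N) \<le> \<pi> p)"
  by (simp add: nat_dvd_def supernatural_dvd_def supernatural_of_def)

lemma nat_dvd_pos: "nat_dvd N \<pi> \<Longrightarrow> 0 < N"
  by (simp add: nat_dvd_def)

lemma nat_dvd_1 [simp]: "nat_dvd 1 \<pi>"
  by (simp add: nat_dvd_iff zero_enat_def[symmetric])

lemma nat_dvd_dvd:
  assumes "nat_dvd N \<pi>" "M dvd N"
  shows "nat_dvd M \<pi>"
  unfolding nat_dvd_iff
proof (intro conjI allI impI)
  have N: "N > 0" using assms by (auto simp: nat_dvd_iff)
  then show "M > 0" using assms(2) by (auto intro: Nat.gr0I)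
  fix p :: nat assume "prime p"
  then have "multiplicity p M \<le> multiplicity p N" "enat (multiplicity p N) \<le> \<pi> p"
    using assms N by (auto simp: nat_dvd_iff intro!: dvd_imp_multiplicity_le)
  then show "enat (multiplicity p M) \<le> \<pi> p" by (meson enat_ord_simps(1) order_trans)
qed

lemma nat_dvd_lcm:
  assumes "nat_dvd M \<pi>" "nat_dvd N \<pi>"
  shows "nat_dvd (lcm M N) \<pi>"
  using assms by (auto simp: nat_dvd_iff multiplicity_lcm lcm_pos_nat max_def)

lemma nat_dvd_mult_coprime:
  assumes "nat_dvd M \<pi>" "nat_dvd N \<pi>" "coprime M N"
  shows "nat_dvd (M * N) \<pi>"
  using nat_dvd_lcm[OF assms(1,2)] assms(3) by (simp add: lcm_coprime)

subsection \<open>Membership in \<open>Ab \<pi>\<close>\<close>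

text \<open>The law x^n = 1 phrased without an identity element. It lets closure properties be
  checked for plain semigroups.\<close>

definition sgrp_exponent :: "nat \<Rightarrow> ('a, 'm) sgrp_scheme \<Rightarrow> bool" where
  "sgrp_exponent n S \<longleftrightarrow> (\<forall>x\<in>carrier S. \<forall>y\<in>carrier S. smult S (spow S x n) y = y)"

abbreviation group_of :: "'a sgrp \<Rightarrow> 'a \<Rightarrow> 'a monoid" where
  "group_of S e \<equiv> \<lparr>carrier = carrier S, monoid.mult = smult S, one = e\<rparr>"

lemma group_of_pow:
  assumes "comm_group (group_of S e)" "x \<in> carrier S" "0 < n"
  shows "spow S x n = x [^]\<^bsub>group_of S e\<^esub> n"
  using assms(3)
proof (induction n)
  case (Suc n)
  interpret comm_group "group_of S e" by fact
  show ?case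
  proof (cases "n = 0")
    case True
    then show ?thesis using l_one[of x] assms(2) by simp
  qed (use Suc in \<open>simp add: spow_Suc\<close>)
qed simp

text \<open>Finiteness gives x^(2c) = x^c for some positive c, whence x^c = 1. The product of these
  c over all x is a common exponent, so the \<open>LEAST\<close> in \<open>group_exponent\<close> is
  attained.\<close>

lemma Ab_D:
  assumes "S \<in> Ab \<pi>"
  shows "\<exists>e n. comm_group (group_of S e) \<and> nat_dvd n \<pi> \<and>
    (\<forall>x\<in>carrier S. x [^]\<^bsub>group_of S e\<^esub> n = e)"
proof -
  obtain e where fin: "finite (carrier S)" and e: "comm_group (group_of S e)"
    "supernatural_dvd (supernatural_of (group_exponent (group_of S e))) \<pi>"
    using assms by (auto simp: Ab_def Let_def)
  let ?G = "group_of S e"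
  interpret comm_group ?G by fact
  have "\<exists>c>0. x [^]\<^bsub>?G\<^esub> (c::nat) = \<one>\<^bsub>?G\<^esub>" if x: "x \<in> carrier ?G" for x
  proof -
    have iter: "((\<lambda>y. y \<otimes>\<^bsub>?G\<^esub> x) ^^ m) \<one>\<^bsub>?G\<^esub> = x [^]\<^bsub>?G\<^esub> m" for m
      by (induction m) (simp_all only: funpow.simps comp_apply id_apply nat_pow_0 nat_pow_Suc)
    have "range (\<lambda>m::nat. x [^]\<^bsub>?G\<^esub> m) \<subseteq> carrier ?G"
      using nat_pow_closed[OF x] by auto
    from finite_subset[OF this] fin have "finite (range (\<lambda>m::nat. x [^]\<^bsub>?G\<^esub> m))" by simp
    from funpow_eventually_periodic[of "\<lambda>y. y \<otimes>\<^bsub>?G\<^esub> x" "\<one>\<^bsub>?G\<^esub>", unfolded iter, OF this]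
    obtain c :: nat where c: "c > 0"
      "\<And>m n. c \<le> m \<Longrightarrow> c \<le> n \<Longrightarrow> m mod c = n mod c \<Longrightarrow> x [^]\<^bsub>?G\<^esub> m = x [^]\<^bsub>?G\<^esub> n"
      by blast
    have "x [^]\<^bsub>?G\<^esub> (c + c) = x [^]\<^bsub>?G\<^esub> c" by (rule c(2)) auto
    then have "x [^]\<^bsub>?G\<^esub> c \<otimes>\<^bsub>?G\<^esub> x [^]\<^bsub>?G\<^esub> c = x [^]\<^bsub>?G\<^esub> c" by (simp only: nat_pow_mult[OF x, symmetric])
    then have "x [^]\<^bsub>?G\<^esub> c = \<one>\<^bsub>?G\<^esub>"
      using r_cancel_one[OF nat_pow_closed nat_pow_closed, OF x x] by simp
    with c(1) show ?thesis by blast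
  qed
  then obtain c :: "nat \<Rightarrow> nat" where c: "\<And>x. x \<in> carrier ?G \<Longrightarrow> 0 < c x \<and> x [^]\<^bsub>?G\<^esub> c x = \<one>\<^bsub>?G\<^esub>"
    by metis
  have "x [^]\<^bsub>?G\<^esub> (\<Prod>y\<in>carrier S. c y) = \<one>\<^bsub>?G\<^esub>" if x: "x \<in> carrier ?G" for x
  proof -
    obtain k where k: "(\<Prod>y\<in>carrier S. c y) = c x * k"
      using dvd_prodI[OF fin, of x c] x by auto
    show ?thesis unfolding k using c[OF x] x by (simp only: nat_pow_pow[symmetric] nat_pow_one)
  qed
  moreover have "0 < (\<Prod>y\<in>carrier S. c y)" using c by (intro prod_pos) auto
  ultimately have "\<exists>n::nat. 0 < n \<and> (\<forall>x\<in>carrier ?G. x [^]\<^bsub>?G\<^esub> n = \<one>\<^bsub>?G\<^esub>)"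
    by (intro exI[of _ "\<Prod>y\<in>carrier S. c y"] conjI ballI)
  then have "0 < group_exponent ?G \<and> (\<forall>x\<in>carrier ?G. x [^]\<^bsub>?G\<^esub> group_exponent ?G = \<one>\<^bsub>?G\<^esub>)"
    unfolding group_exponent_def by (rule LeastI_ex)
  then show ?thesis using e
    by (intro exI[of _ e] exI[of _ "group_exponent ?G"]) (simp add: nat_dvd_def)
qed

text \<open>Commutativity and the exponent law already force a group: x0^n acts as the identity, and
  every n-th power equals it.\<close>

lemma Ab_iff:
  "S \<in> Ab \<pi> \<longleftrightarrow> S \<in> Fin_Sgrp \<and> (\<forall>x\<in>carrier S. \<forall>y\<in>carrier S. smult S x y = smult S y x) \<and>
     (\<exists>n. nat_dvd n \<pi> \<and> sgrp_exponent n S)"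
proof
  assume S: "S \<in> Ab \<pi>"
  then obtain e n where e: "comm_group (group_of S e)" "nat_dvd n \<pi>"
    "\<And>x. x \<in> carrier S \<Longrightarrow> x [^]\<^bsub>group_of S e\<^esub> n = e" using Ab_D by metis
  let ?G = "group_of S e"
  interpret comm_group ?G by fact
  have "semigroup_on S"
    using m_assoc m_closed one_closed by (auto simp: semigroup_on_def)
  moreover have "sgrp_exponent n S"
    unfolding sgrp_exponent_def
  proof (intro ballI)
    fix x y assume "x \<in> carrier S" "y \<in> carrier S"
    then show "smult S (spow S x n) y = y"
      using group_of_pow[OF e(1) _ nat_dvd_pos[OF e(2)]] e(3) l_one[of y] by simp
  qed
  ultimately show "S \<in> Fin_Sgrp \<and> (\<forall>x\<in>carrier S. \<forall>y\<in>carrier S. smult S x y = smult S y x) \<and>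
     (\<exists>n. nat_dvd n \<pi> \<and> sgrp_exponent n S)"
    using S e(2) m_comm by (auto simp: Fin_Sgrp_def Ab_def)
next
  assume *: "S \<in> Fin_Sgrp \<and> (\<forall>x\<in>carrier S. \<forall>y\<in>carrier S. smult S x y = smult S y x) \<and>
     (\<exists>n. nat_dvd n \<pi> \<and> sgrp_exponent n S)"
  then obtain n where n: "nat_dvd n \<pi>" "sgrp_exponent n S" by blast
  have S: "semigroup_on S" "finite (carrier S)" using * by (auto simp: Fin_Sgrp_def)
  have comm: "\<And>x y. x \<in> carrier S \<Longrightarrow> y \<in> carrier S \<Longrightarrow> smult S x y = smult S y x" using * by blast
  have n0: "n > 0" using n by (auto simp: nat_dvd_iff)
  obtain x0 where x0: "x0 \<in> carrier S" using semigroup_onD(1)[OF S(1)] by blast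
  define e where "e = spow S x0 n"
  have e: "e \<in> carrier S" unfolding e_def by (intro spow_closed S x0)
  have l_one: "smult S e y = y" if "y \<in> carrier S" for y
    using n(2) x0 that by (simp add: e_def sgrp_exponent_def)
  have pow_e: "spow S x n = e" if "x \<in> carrier S" for x
  proof -
    have xn: "spow S x n \<in> carrier S" by (intro spow_closed S that)
    have "smult S (spow S x n) e = e" using n(2) that e by (simp add: sgrp_exponent_def)
    then show ?thesis using l_one[OF xn] comm[OF xn e] by simp
  qed
  let ?G = "group_of S e"
  have grp: "comm_group ?G"
  proof (rule comm_groupI)
    fix x assume "x \<in> carrier ?G"
    then have x: "x \<in> carrier S" by simp
    \<comment> \<open>The inverse of x is x^(2n-1). The exponent n - 1 would be 0 for n = 1, where
      \<open>spow\<close> is not a power.\<close>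
    have cl: "spow S x (2 * n - 1) \<in> carrier S" by (intro spow_closed S x)
    have "smult S (spow S x (2 * n - 1)) x = spow S x (Suc (2 * n - 1))"
      using n0 by (subst spow_Suc) auto
    also have "\<dots> = spow S x (n + n)" using n0 by (intro arg_cong[of _ _ "spow S x"]) auto
    also have "\<dots> = smult S (spow S x n) (spow S x n)" by (intro spow_add S x n0)
    also have "\<dots> = e" using l_one[OF e] pow_e[OF x] by simp
    finally show "\<exists>y\<in>carrier ?G. y \<otimes>\<^bsub>?G\<^esub> x = \<one>\<^bsub>?G\<^esub>" using cl by auto
  qed (use S e l_one comm semigroup_onD[OF S(1)] in auto)
  interpret comm_group ?G by fact
  \<comment> \<open>The least exponent divides n: the remainder of n modulo it annihilates the group
    as well and is smaller, hence 0.\<close>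
  let ?m = "group_exponent ?G"
  have pow_1: "x [^]\<^bsub>?G\<^esub> n = \<one>\<^bsub>?G\<^esub>" if "x \<in> carrier ?G" for x
    using that pow_e group_of_pow[OF grp _ n0] by simp
  have m: "0 < ?m" "\<And>x. x \<in> carrier ?G \<Longrightarrow> x [^]\<^bsub>?G\<^esub> ?m = \<one>\<^bsub>?G\<^esub>"
    using LeastI[of "\<lambda>n. 0 < n \<and> (\<forall>x\<in>carrier ?G. x [^]\<^bsub>?G\<^esub> n = \<one>\<^bsub>?G\<^esub>)" n] n0 pow_1
    unfolding group_exponent_def by blast+
  have "x [^]\<^bsub>?G\<^esub> (n mod ?m) = \<one>\<^bsub>?G\<^esub>" if x: "x \<in> carrier ?G" for x
  proof -
    have "x [^]\<^bsub>?G\<^esub> n = (x [^]\<^bsub>?G\<^esub> ?m) [^]\<^bsub>?G\<^esub> (n div ?m) \<otimes>\<^bsub>?G\<^esub> x [^]\<^bsub>?G\<^esub> (n mod ?m)"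
      using x by (simp only: nat_pow_pow nat_pow_mult mult_div_mod_eq)
    then have "\<one>\<^bsub>?G\<^esub> = x [^]\<^bsub>?G\<^esub> (n mod ?m)"
      using x by (simp only: m(2)[OF x] pow_1[OF x] nat_pow_one l_one nat_pow_closed)
    then show ?thesis by (rule sym)
  qed
  moreover have "?m \<le> k" if "0 < k" "\<And>x. x \<in> carrier ?G \<Longrightarrow> x [^]\<^bsub>?G\<^esub> k = \<one>\<^bsub>?G\<^esub>" for k
    unfolding group_exponent_def by (rule Least_le) (use that in blast)
  ultimately have "n mod ?m = 0"
    using mod_less_divisor[OF m(1), of n] by (meson gr0I not_less)
  then have "nat_dvd ?m \<pi>" using nat_dvd_dvd[OF n(1)] by (simp add: mod_eq_0_iff_dvd)
  then have "supernatural_dvd (supernatural_of ?m) \<pi>" by (simp only: nat_dvd_def)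
  then show "S \<in> Ab \<pi>" using S(2) grp unfolding Ab_def Let_def by blast
qed

lemma Ab_Fin: "Ab \<pi> \<subseteq> Fin_Sgrp"
  using Ab_iff by blast

lemma sgrp_exponent_dvd:
  assumes S: "semigroup_on S" and m: "sgrp_exponent m S" "m dvd n" "0 < n"
  shows "sgrp_exponent n S"
proof -
  obtain k where k: "n = m * k" using m(2) ..
  have mk: "0 < m" "0 < k" using m(3) k by auto
  show ?thesis
    unfolding sgrp_exponent_def k
  proof (intro ballI)
    fix x y assume x: "x \<in> carrier S" and y: "y \<in> carrier S"
    have "smult S (spow S (spow S x m) k) y = y"
      using mk(2)
    proof (induction k)
      case (Suc k)
      have xm: "spow S x m \<in> carrier S" by (intro spow_closed S x)
      show ?case
      proof (cases "k = 0")
        case False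
        have "spow S (spow S x m) k \<in> carrier S" by (intro spow_closed S xm)
        with False Suc xm show ?thesis
          using semigroup_onD(3)[OF S _ xm y, of "spow S (spow S x m) k"] m(1) x y
          by (simp add: spow_Suc sgrp_exponent_def)
      qed (use m(1) x y in \<open>simp add: sgrp_exponent_def\<close>)
    qed simp
    then show "smult S (spow S x (m * k)) y = y" using spow_mult[OF S x mk] by simp
  qed
qed

text \<open>Through \<open>Ab_iff\<close> every closure property becomes the transport of two laws
  along homomorphisms. For a product, the exponents m and n are replaced by their least common
  multiple, which still divides \<open>\<pi>\<close>.\<close>

lemma pseudovariety_Ab: "pseudovariety (Ab \<pi>)"
  unfolding pseudovariety_def
proof (intro conjI ballI impI)
  fix S T assume S: "S \<in> Ab \<pi>" and T: "T \<in> Fin_Sgrp"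
  from S obtain n where n: "nat_dvd n \<pi>" "sgrp_exponent n S"
    and comm: "\<And>x y. x \<in> carrier S \<Longrightarrow> y \<in> carrier S \<Longrightarrow> smult S x y = smult S y x"
    and SF: "S \<in> Fin_Sgrp"
    unfolding Ab_iff by blast
  {
    assume sub: "carrier T \<subseteq> carrier S \<and> (\<lambda>x. x) \<in> shom T S"
    then have eq: "smult T x y = smult S x y" if "x \<in> carrier T" "y \<in> carrier T" for x y
      using that by (auto simp: shom_def)
    have pow: "spow T x n = spow S x n" if "x \<in> carrier T" for x
      using sub that spow_hom[of "\<lambda>x. x" T S x n] Fin_SgrpD(1)[OF T] by auto
    have "sgrp_exponent n T"
      unfolding sgrp_exponent_def
    proof (intro ballI)
      fix x y assume xy: "x \<in> carrier T" "y \<in> carrier T"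
      have "spow T x n \<in> carrier T" by (intro spow_closed Fin_SgrpD T xy)
      then show "smult T (spow T x n) y = y"
        using xy n(2) sub by (auto simp: eq pow sgrp_exponent_def)
    qed
    moreover have "\<forall>x\<in>carrier T. \<forall>y\<in>carrier T. smult T x y = smult T y x"
      using sub comm by (auto simp: eq)
    ultimately show "T \<in> Ab \<pi>" using T n(1) unfolding Ab_iff by blast
  next
    assume "\<exists>h\<in>shom S T. h ` carrier S = carrier T"
    then obtain h where h: "h \<in> shom S T" "h ` carrier S = carrier T" by blast
    have hm: "h (smult S x y) = smult T (h x) (h y)" if "x \<in> carrier S" "y \<in> carrier S" for x y
      using h(1) that by (auto simp: shom_def)
    have "sgrp_exponent n T"
      unfolding sgrp_exponent_def
    proof (intro ballI)
      fix x y assume "x \<in> carrier T" "y \<in> carrier T"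
      then obtain x' y' where xy: "x' \<in> carrier S" "y' \<in> carrier S" "x = h x'" "y = h y'"
        using h(2) by blast
      have "smult T (spow T x n) y = h (smult S (spow S x' n) y')"
        using xy spow_closed[OF Fin_SgrpD(1)[OF SF]]
        by (simp add: hm spow_hom[OF h(1) Fin_SgrpD(1)[OF SF]])
      also have "\<dots> = y" using xy n(2) by (simp add: sgrp_exponent_def)
      finally show "smult T (spow T x n) y = y" .
    qed
    moreover have "smult T x y = smult T y x" if cl: "x \<in> carrier T" "y \<in> carrier T" for x y
    proof -
      obtain x' y' where xy: "x' \<in> carrier S" "y' \<in> carrier S" "x = h x'" "y = h y'"
        using h(2) cl by blast
      show ?thesis
        unfolding xy(3,4) hm[OF xy(1,2), symmetric] hm[OF xy(2,1), symmetric] comm[OF xy(1,2)] ..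
    qed
    ultimately show "T \<in> Ab \<pi>" using T n(1) unfolding Ab_iff by blast
  }
next
  fix S T U assume S: "S \<in> Ab \<pi>" and T: "T \<in> Ab \<pi>" and U: "U \<in> Fin_Sgrp"
    and "sgrp_iso U (sgrp_prod S T)"
  then obtain h where h: "h \<in> shom U (sgrp_prod S T)" "bij_betw h (carrier U) (carrier (sgrp_prod S T))"
    by (auto simp: sgrp_iso_def)
  from S obtain m where m: "nat_dvd m \<pi>" "sgrp_exponent m S"
    and Sc: "\<And>x y. x \<in> carrier S \<Longrightarrow> y \<in> carrier S \<Longrightarrow> smult S x y = smult S y x"
    and SF: "semigroup_on S"
    unfolding Ab_iff Fin_Sgrp_def by blast
  from T obtain n where n: "nat_dvd n \<pi>" "sgrp_exponent n T"
    and Tc: "\<And>x y. x \<in> carrier T \<Longrightarrow> y \<in> carrier T \<Longrightarrow> smult T x y = smult T y x"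
    and TF: "semigroup_on T"
    unfolding Ab_iff Fin_Sgrp_def by blast
  let ?l = "lcm m n"
  have l: "nat_dvd ?l \<pi>" by (intro nat_dvd_lcm m n)
  have eS: "sgrp_exponent ?l S" and eT: "sgrp_exponent ?l T"
    using sgrp_exponent_dvd[OF SF m(2)] sgrp_exponent_dvd[OF TF n(2)] nat_dvd_pos[OF l] by auto
  have US: "semigroup_on U" using U by (rule Fin_SgrpD)
  have hP: "h x \<in> carrier S \<times> carrier T" if "x \<in> carrier U" for x
    using h(1) that by (simp add: shom_def sgrp_prod_def Pi_iff)
  have hc: "fst (h x) \<in> carrier S" "snd (h x) \<in> carrier T" if "x \<in> carrier U" for x
    using hP[OF that] by (simp_all add: mem_Times_iff)
  have hm: "h (smult U x y) = (smult S (fst (h x)) (fst (h y)), smult T (snd (h x)) (snd (h y)))"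
    if "x \<in> carrier U" "y \<in> carrier U" for x y
    using h(1) that by (simp add: shom_def sgrp_prod_def)
  have inj: "x = y" if "x \<in> carrier U" "y \<in> carrier U" "h x = h y" for x y
    using h(2) that by (auto simp: bij_betw_def dest: inj_onD)
  have h1: "(\<lambda>x. fst (h x)) \<in> shom U S" and h2: "(\<lambda>x. snd (h x)) \<in> shom U T"
    using hc hm by (auto simp: shom_def)
  have "sgrp_exponent ?l U"
    unfolding sgrp_exponent_def
  proof (intro ballI)
    fix x y assume xy: "x \<in> carrier U" "y \<in> carrier U"
    have xl: "spow U x ?l \<in> carrier U" by (intro spow_closed US xy)
    have "h (smult U (spow U x ?l) y) = h y"
      using hm[OF xl xy(2)] spow_hom[OF h1 US xy(1), of ?l] spow_hom[OF h2 US xy(1), of ?l]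
        eS eT hc[OF xy(1)] hc[OF xy(2)] by (simp add: sgrp_exponent_def)
    then show "smult U (spow U x ?l) y = y"
      using inj xl xy semigroup_onD(2)[OF US] by blast
  qed
  moreover have "smult U x y = smult U y x" if xy: "x \<in> carrier U" "y \<in> carrier U" for x y
    using xy semigroup_onD(2)[OF US] hm[OF xy] hm[OF xy(2,1)] Sc Tc hc by (intro inj) auto
  ultimately show "U \<in> Ab \<pi>" using U l unfolding Ab_iff by blast
next
  fix U assume U: "U \<in> Fin_Sgrp" "card (carrier U) = 1"
  then obtain a where a: "carrier U = {a}" using card_1_singletonE by blast
  have "smult U a a = a" using semigroup_onD(2)[OF Fin_SgrpD(1)[OF U(1)], of a a] a by simp
  then have "sgrp_exponent 1 U" using a by (simp add: sgrp_exponent_def)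
  then show "U \<in> Ab \<pi>" using U(1) a nat_dvd_1[of \<pi>] unfolding Ab_iff by auto
qed (rule Ab_Fin)

subsection \<open>Coefficients modulo \<open>N\<close>\<close>

definition cyclic :: "nat \<Rightarrow> nat sgrp" where
  "cyclic N = \<lparr>carrier = {..<N}, smult = \<lambda>x y. (x + y) mod N\<rparr>"

lemma cyclic_simps [simp]: "carrier (cyclic N) = {..<N}" "smult (cyclic N) x y = (x + y) mod N"
  by (simp_all add: cyclic_def)

lemma cyclic_Fin: "0 < N \<Longrightarrow> cyclic N \<in> Fin_Sgrp"
  by (auto simp: Fin_Sgrp_def semigroup_on_def mod_simps add.assoc)

lemma spow_cyclic: "x < N \<Longrightarrow> 0 < n \<Longrightarrow> spow (cyclic N) x n = n * x mod N"
proof (induction n)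
  case (Suc n)
  then show ?case by (cases "n = 0") (auto simp: spow_Suc mod_simps add.commute)
qed simp

lemma cyclic_Ab: "nat_dvd N \<pi> \<Longrightarrow> cyclic N \<in> Ab \<pi>"
  unfolding Ab_iff using cyclic_Fin nat_dvd_pos[of N \<pi>]
  by (auto simp: sgrp_exponent_def spow_cyclic add.commute intro!: exI[of _ N])

lemma word_value_cyclic:
  assumes "finite B" "u \<noteq> []" "set u \<subseteq> B" "\<And>b. b \<in> B \<Longrightarrow> \<psi> b < N"
  shows "word_value (cyclic N) \<psi> u = (\<Sum>b\<in>B. count_list u b * \<psi> b) mod N"
  using assms(2,3)
proof (induction u rule: rev_nonempty_induct)
  case (single a)
  have "(\<Sum>b\<in>B. count_list [a] b * \<psi> b) = (\<Sum>b\<in>B. if b = a then \<psi> b else 0)"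
    by (intro sum.cong) auto
  then show ?case using assms single by simp
next
  case (snoc a u)
  have "(\<Sum>b\<in>B. count_list (u @ [a]) b * \<psi> b)
      = (\<Sum>b\<in>B. count_list u b * \<psi> b) + (\<Sum>b\<in>B. if b = a then \<psi> b else 0)"
    unfolding sum.distrib[symmetric] by (intro sum.cong) (auto simp: algebra_simps)
  also have "\<dots> = (\<Sum>b\<in>B. count_list u b * \<psi> b) + \<psi> a" using snoc assms by simp
  finally show ?case using snoc by (simp add: word_value_snoc mod_simps)
qed

text \<open>Writing \<open>1 mod N\<close> keeps the assignment inside the carrier when N =
  1.\<close>

definition unit_vec :: "nat \<Rightarrow> nat set \<Rightarrow> nat \<Rightarrow> nat \<Rightarrow> nat" where
  "unit_vec N A a = (\<lambda>b\<in>A. if b = a then 1 mod N else 0)"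

text \<open>The number of occurrences of the letter a modulo N, extended from words to profinite
  elements by continuity.\<close>

definition coef :: "nat \<Rightarrow> nat set \<Rightarrow> pro_elem \<Rightarrow> nat \<Rightarrow> nat" where
  "coef N A w a = w (cyclic N, unit_vec N A a)"

lemma unit_vec_index:
  "0 < N \<Longrightarrow> cyclic N \<in> V \<Longrightarrow> (cyclic N, unit_vec N A a) \<in> pro_index V A"
  by (auto simp: pro_index_def unit_vec_def)

lemma unit_vec_index_Fin: "0 < N \<Longrightarrow> (cyclic N, unit_vec N A a) \<in> pro_index Fin_Sgrp A"
  by (intro unit_vec_index cyclic_Fin)

lemma coef_less: "w \<in> pro_carrier Fin_Sgrp A \<Longrightarrow> 0 < N \<Longrightarrow> coef N A w a < N"
  using pro_carrierD(1)[OF _ unit_vec_index_Fin[of N A a], of w] by (simp add: coef_def)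

lemma word_value_unit_vec:
  assumes "finite A" "u \<noteq> []" "set u \<subseteq> A" "a \<in> A" "0 < N"
  shows "word_value (cyclic N) (unit_vec N A a) u = count_list u a mod N"
proof -
  have "word_value (cyclic N) (unit_vec N A a) u = (\<Sum>b\<in>A. count_list u b * unit_vec N A a b) mod N"
    using assms by (intro word_value_cyclic) (auto simp: unit_vec_def)
  also have "(\<Sum>b\<in>A. count_list u b * unit_vec N A a b)
      = (\<Sum>b\<in>A. if b = a then count_list u b * (1 mod N) else 0)"
    by (intro sum.cong) (auto simp: unit_vec_def)
  also have "\<dots> = count_list u a * (1 mod N)" using assms by simp
  finally show ?thesis by (simp add: mod_mult_right_eq)
qed

lemma coef_gen:
  "a \<in> A \<Longrightarrow> b \<in> A \<Longrightarrow> 0 < N \<Longrightarrow> coef N A (gen Fin_Sgrp A b) a = of_bool (b = a) mod N"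
  using unit_vec_index_Fin[of N A a] by (simp add: coef_def gen_def unit_vec_def)

lemma coef_smult:
  "0 < N \<Longrightarrow> coef N A (smult (Free_Pro Fin_Sgrp A) v w) a = (coef N A v a + coef N A w a) mod N"
  using unit_vec_index_Fin[of N A a] by (simp add: coef_def)

lemma coef_spow:
  assumes "w \<in> pro_carrier Fin_Sgrp A" "0 < N" "0 < n"
    "v (cyclic N, unit_vec N A a) = spow (cyclic N) (w (cyclic N, unit_vec N A a)) n"
  shows "coef N A v a = n * coef N A w a mod N"
  using assms spow_cyclic[OF coef_less[OF assms(1,2)] assms(3)] by (simp add: coef_def)

text \<open>Reduction modulo M is a homomorphism from \<open>cyclic N\<close> to
  \<open>cyclic M\<close> that carries unit vectors to unit vectors, so naturality of w
  applies.\<close>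

lemma coef_mod:
  assumes w: "w \<in> pro_carrier Fin_Sgrp A" and N: "0 < N" "M dvd N"
  shows "coef M A w a = coef N A w a mod M"
proof -
  have M: "0 < M" using N by (auto intro: Nat.gr0I)
  have "(\<lambda>x. x mod M) \<in> shom (cyclic N) (cyclic M)"
    using M N by (auto simp: shom_def mod_mod_cancel mod_simps)
  moreover have "compose A (\<lambda>x. x mod M) (unit_vec N A a) = unit_vec M A a"
    using N by (auto simp: compose_def unit_vec_def restrict_def mod_mod_cancel fun_eq_iff)
  ultimately show ?thesis
    using pro_natural[OF w cyclic_Fin[OF N(1)] cyclic_Fin[OF M], of "unit_vec N A a" "\<lambda>x. x mod M"]
      unit_vec_index_Fin[OF N(1), of A a]
    by (simp add: coef_def pro_index_def)
qed

text \<open>One word u can match w both at the assignment of the coefficients of the s b and at all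
  unit vectors. For words the formula just counts letters.\<close>

lemma coef_extend:
  assumes B: "finite B" and w: "w \<in> pro_carrier Fin_Sgrp B" and s: "\<And>b. b \<in> B \<Longrightarrow> s b \<in> pro_carrier Fin_Sgrp A"
    and N: "0 < N"
  shows "coef N A (extend Fin_Sgrp A B s w) a = (\<Sum>b\<in>B. coef N B w b * coef N A (s b) a) mod N"
proof -
  let ?\<psi> = "\<lambda>b\<in>B. coef N A (s b) a"
  have \<psi>: "(cyclic N, ?\<psi>) \<in> pro_index Fin_Sgrp B"
    using coef_less[OF s N] cyclic_Fin[OF N] by (auto simp: pro_index_def)
  let ?F = "insert (cyclic N, ?\<psi>) ((\<lambda>b. (cyclic N, unit_vec N B b)) ` B)"
  have "finite ?F" "?F \<subseteq> pro_index Fin_Sgrp B"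
    using B \<psi> unit_vec_index_Fin[OF N] by auto
  from approx_by_word[OF w this] obtain u where u: "u \<noteq> []" "set u \<subseteq> B"
    "w (cyclic N, ?\<psi>) = word_value (cyclic N) ?\<psi> u"
    "\<And>b. b \<in> B \<Longrightarrow> coef N B w b = word_value (cyclic N) (unit_vec N B b) u"
    by (auto simp: coef_def)
  have "coef N A (extend Fin_Sgrp A B s w) a = word_value (cyclic N) ?\<psi> u"
    using u(3) unit_vec_index_Fin[OF N, of A a] by (simp add: coef_def extend_def)
  also have "\<dots> = (\<Sum>b\<in>B. count_list u b * ?\<psi> b) mod N"
    using coef_less[OF s N] by (intro word_value_cyclic B u) auto
  also have "\<dots> = (\<Sum>b\<in>B. (count_list u b * ?\<psi> b) mod N) mod N" by (simp add: mod_sum_eq)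
  also have "(\<Sum>b\<in>B. (count_list u b * ?\<psi> b) mod N) = (\<Sum>b\<in>B. (coef N B w b * coef N A (s b) a) mod N)"
    using u(4) word_value_unit_vec[OF B u(1,2) _ N] by (intro sum.cong) (auto simp: mod_simps)
  finally show ?thesis by (simp add: mod_sum_eq)
qed

lemma word_value_group:
  assumes G: "comm_group (group_of S e)" and A: "finite A" "u \<noteq> []" "set u \<subseteq> A" "\<phi> \<in> A \<rightarrow> carrier S"
  shows "word_value S \<phi> u = finprod (group_of S e) (\<lambda>a. \<phi> a [^]\<^bsub>group_of S e\<^esub> count_list u a) A"
  using A(2,3)
proof (induction u rule: rev_nonempty_induct)
  interpret comm_group "group_of S e" by fact
  let ?G = "group_of S e"
  have \<phi>: "\<phi> \<in> A \<rightarrow> carrier ?G" using A by simp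
  have delta: "finprod ?G (\<lambda>a. if b = a then \<phi> a else \<one>\<^bsub>?G\<^esub>) A = \<phi> b" if "b \<in> A" for b
    using finprod_singleton[OF that A(1) \<phi>] by simp
  {
    case (single b)
    have "finprod ?G (\<lambda>a. \<phi> a [^]\<^bsub>?G\<^esub> count_list [b] a) A
        = finprod ?G (\<lambda>a. if b = a then \<phi> a else \<one>\<^bsub>?G\<^esub>) A"
      using \<phi> using one_closed[simplified] by (intro finprod_cong') (auto simp: Pi_iff l_one[simplified])
    then show ?case using delta[of b] single by simp
  next
    case (snoc b u)
    have "finprod ?G (\<lambda>a. \<phi> a [^]\<^bsub>?G\<^esub> count_list (u @ [b]) a) A
        = finprod ?G (\<lambda>a. \<phi> a [^]\<^bsub>?G\<^esub> count_list u a \<otimes>\<^bsub>?G\<^esub> (if b = a then \<phi> a else \<one>\<^bsub>?G\<^esub>)) A"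
    proof (intro finprod_cong')
      fix a assume "a \<in> A"
      then have a: "\<phi> a \<in> carrier ?G" using \<phi> by auto
      show "\<phi> a [^]\<^bsub>?G\<^esub> count_list (u @ [b]) a
          = \<phi> a [^]\<^bsub>?G\<^esub> count_list u a \<otimes>\<^bsub>?G\<^esub> (if b = a then \<phi> a else \<one>\<^bsub>?G\<^esub>)"
        using r_one[OF nat_pow_closed[OF a], of "count_list u a"]
        by (cases "b = a") (auto simp del: monoid.simps)
    qed (use \<phi> nat_pow_closed one_closed[simplified] m_closed in \<open>auto simp: Pi_iff\<close>)
    also have "\<dots> = finprod ?G (\<lambda>a. \<phi> a [^]\<^bsub>?G\<^esub> count_list u a) A
        \<otimes>\<^bsub>?G\<^esub> finprod ?G (\<lambda>a. if b = a then \<phi> a else \<one>\<^bsub>?G\<^esub>) A"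
      using \<phi> nat_pow_closed one_closed[simplified] by (intro finprod_multf) (auto simp: Pi_iff)
    finally show ?case using delta[of b] snoc by (simp add: word_value_snoc)
  }
qed

text \<open>For the converse, let n be an exponent of the group S. Replace v and w by words that are
  correct at the index i and at the unit vectors modulo n. Their letter counts agree modulo n, so
  their values in the commutative group S coincide.\<close>

theorem satisfies_Ab_iff:
  assumes A: "finite A" and v: "v \<in> pro_carrier Fin_Sgrp A" and w: "w \<in> pro_carrier Fin_Sgrp A"
  shows "satisfies (Ab \<pi>) A v w \<longleftrightarrow> (\<forall>N. nat_dvd N \<pi> \<longrightarrow> (\<forall>a\<in>A. coef N A v a = coef N A w a))"
  unfolding satisfies_iff[OF Ab_Fin v w]
proof (intro iffI allI impI ballI)
  fix N a assume "\<forall>i\<in>pro_index (Ab \<pi>) A. v i = w i" "nat_dvd N \<pi>" "a \<in> A"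
  then show "coef N A v a = coef N A w a"
    using unit_vec_index[of N "Ab \<pi>" A a] cyclic_Ab nat_dvd_pos by (auto simp: coef_def)
next
  fix i assume *: "\<forall>N. nat_dvd N \<pi> \<longrightarrow> (\<forall>a\<in>A. coef N A v a = coef N A w a)"
    and i: "i \<in> pro_index (Ab \<pi>) A"
  obtain S \<phi> where id: "i = (S, \<phi>)" by force
  have S: "S \<in> Ab \<pi>" and \<phi>: "\<phi> \<in> A \<rightarrow> carrier S" using i by (auto simp: id pro_index_def)
  from S obtain e n where e: "comm_group (group_of S e)" "nat_dvd n \<pi>"
    "\<And>x. x \<in> carrier S \<Longrightarrow> x [^]\<^bsub>group_of S e\<^esub> n = e" using Ab_D by metis
  let ?G = "group_of S e"
  interpret comm_group ?G by fact
  have n: "0 < n" using e(2) by (rule nat_dvd_pos)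
  have iF: "i \<in> pro_index Fin_Sgrp A" using pro_index_mono[OF Ab_Fin i] .
  let ?F = "insert i ((\<lambda>a. (cyclic n, unit_vec n A a)) ` A)"
  have F: "finite ?F" "?F \<subseteq> pro_index Fin_Sgrp A"
    using A iF unit_vec_index_Fin[OF n] by auto
  have *: "\<exists>u. u \<noteq> [] \<and> set u \<subseteq> A \<and> x i = word_value S \<phi> u \<and> (\<forall>a\<in>A. coef n A x a = count_list u a mod n)"
    if x: "x \<in> pro_carrier Fin_Sgrp A" for x
    using approx_by_word[OF x F] word_value_unit_vec[OF A _ _ _ n] by (auto simp: coef_def id)
  have pow_mod: "x [^]\<^bsub>?G\<^esub> k = x [^]\<^bsub>?G\<^esub> (k mod n)" if "x \<in> carrier ?G" for x k
  proof -
    have "x [^]\<^bsub>?G\<^esub> k = (x [^]\<^bsub>?G\<^esub> n) [^]\<^bsub>?G\<^esub> (k div n) \<otimes>\<^bsub>?G\<^esub> x [^]\<^bsub>?G\<^esub> (k mod n)"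
      using that by (simp only: nat_pow_pow nat_pow_mult mult_div_mod_eq)
    moreover have "x [^]\<^bsub>?G\<^esub> n = \<one>\<^bsub>?G\<^esub>" using e(3) that by simp
    ultimately show ?thesis using that by (simp only: nat_pow_one l_one nat_pow_closed)
  qed
  obtain u where u: "u \<noteq> []" "set u \<subseteq> A" "v i = word_value S \<phi> u" "\<And>a. a \<in> A \<Longrightarrow> coef n A v a = count_list u a mod n"
    using *[OF v] by blast
  obtain u' where u': "u' \<noteq> []" "set u' \<subseteq> A" "w i = word_value S \<phi> u'" "\<And>a. a \<in> A \<Longrightarrow> coef n A w a = count_list u' a mod n"
    using *[OF w] by blast
  have "\<phi> a [^]\<^bsub>?G\<^esub> count_list u a = \<phi> a [^]\<^bsub>?G\<^esub> count_list u' a" if "a \<in> A" for a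
    using pow_mod[of "\<phi> a" "count_list u a"] pow_mod[of "\<phi> a" "count_list u' a"] \<phi> that
      u(4)[OF that] u'(4)[OF that] \<open>\<forall>N. nat_dvd N \<pi> \<longrightarrow> (\<forall>a\<in>A. coef N A v a = coef N A w a)\<close> e(2)
    by (auto simp: Pi_iff)
  then have "word_value S \<phi> u = word_value S \<phi> u'"
    unfolding word_value_group[OF e(1) A u(1,2) \<phi>] word_value_group[OF e(1) A u'(1,2) \<phi>]
    using \<phi> nat_pow_closed by (intro finprod_cong') (auto simp: Pi_iff)
  then show "v i = w i" using u u' by simp
qed

section \<open>Coefficients of powers\<close>

lemma eventually_exponent_seq_pos: "1 \<le> f \<Longrightarrow> \<forall>\<^sub>F k in sequentially. 0 < exponent_seq f k"
  using exponent_seq_convergent[of f] unfolding profinitely_convergent_def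
  by (auto elim!: allE[of _ 1] eventually_mono)

lemma coef_limit_power:
  assumes w: "w \<in> pro_carrier Fin_Sgrp A" and f: "1 \<le> f" and N: "0 < N" "N \<le> l"
    and ev: "\<And>i. i \<in> pro_index Fin_Sgrp A \<Longrightarrow>
      \<forall>\<^sub>F k in sequentially. v i = spow (fst i) (w i) (exponent_seq f k)"
  shows "coef N A v a = exponent_seq f l * coef N A w a mod N"
proof -
  have "\<forall>\<^sub>F k in sequentially. coef N A v a = exponent_seq f l * coef N A w a mod N"
    using ev[OF unit_vec_index_Fin[OF N(1), of A a]] eventually_exponent_seq_pos[OF f]
      eventually_ge_at_top[of N]
  proof eventually_elim
    case (elim k)
    then have "coef N A v a = exponent_seq f k * coef N A w a mod N"
      using w N by (intro coef_spow) auto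
    also have "\<dots> = exponent_seq f l * coef N A w a mod N"
      using exponent_seq_mod[OF N(1) elim(3) N(2)] by (metis mod_mult_left_eq)
    finally show ?case .
  qed
  then show ?thesis by simp
qed

lemma coef_eval_power:
  assumes t: "sterm_over (sigma_pi \<pi>) A t" and f: "1 \<le> f" and N: "0 < N" "N \<le> l"
  shows "coef N A (sterm_eval (sigma_pi \<pi>) Fin_Sgrp A (App f [t])) a
      = exponent_seq f l * coef N A (sterm_eval (sigma_pi \<pi>) Fin_Sgrp A t) a mod N"
  using eval_power(2)[OF order_refl f eval_in[OF order_refl t]]
  by (intro coef_limit_power eval_in order_refl assms)

text \<open>The two clauses serve different ends: being a positive power at each coordinate keeps v
  in the closure of a star, while the coefficient rule enters the equations.\<close>

lemma Omega_coef_power: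
  assumes "w \<in> Omega_sig (sigma_pi \<pi>) Fin_Sgrp A" "f = 1 \<or> f \<in> finite_primes \<pi>"
  shows "\<exists>v\<in>Omega_sig (sigma_pi \<pi>) Fin_Sgrp A.
    (\<forall>i\<in>pro_index Fin_Sgrp A. \<exists>n>0. v i = spow (fst i) (w i) n) \<and>
    (\<forall>N>0. \<forall>a. coef N A v a = exponent_seq f N * coef N A w a mod N)"
proof -
  obtain v where v: "v \<in> Omega_sig (sigma_pi \<pi>) Fin_Sgrp A" and
    ev: "\<And>i. i \<in> pro_index Fin_Sgrp A \<Longrightarrow>
      \<forall>\<^sub>F k in sequentially. v i = spow (fst i) (w i) (exponent_seq f k)"
    using Omega_power[OF assms] by blast
  have f: "1 \<le> f" using assms(2) finite_primesD(2)[of f \<pi>] by auto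
  have "\<exists>n>0. v i = spow (fst i) (w i) n" if "i \<in> pro_index Fin_Sgrp A" for i
    using eventually_happens[OF eventually_conj[OF ev[OF that] eventually_exponent_seq_pos[OF f]]] by auto
  moreover have "coef N A v a = exponent_seq f N * coef N A w a mod N" if "0 < N" for N a
    by (rule coef_limit_power[OF Omega_in[OF order_refl assms(1)] f that order_refl ev])
  ultimately show ?thesis using v by blast
qed

subsection \<open>Local components\<close>

lemma dvd_if_prime_powers_dvd:
  fixes N z :: nat
  assumes N: "0 < N" and *: "\<And>p. prime p \<Longrightarrow> p ^ multiplicity p N dvd z"
  shows "N dvd z"
proof (cases "z = 0")
  case False
  show ?thesis
  proof (rule multiplicity_le_imp_dvd)
    fix p :: nat assume p: "prime p"
    then show "multiplicity p N \<le> multiplicity p z"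
      using *[OF p] False prime_gt_1_nat[OF p] by (intro multiplicity_geI) auto
  qed (use N in simp)
qed simp

text \<open>R settles the primes dividing d once and for all: at each of them \<open>\<pi>\<close>
  is finite and R contains the largest power that divides \<open>\<pi>\<close>.\<close>

definition full_at :: "nat \<Rightarrow> nat \<Rightarrow> supernatural \<Rightarrow> bool" where
  "full_at d R \<pi> \<longleftrightarrow> nat_dvd R \<pi> \<and> (\<forall>p. prime p \<longrightarrow> p dvd d \<longrightarrow> \<pi> p = enat (multiplicity p R))"

text \<open>Each prime power in N is treated alone. If its prime divides d, the power divides R;
  otherwise the power is itself a divisor M of N coprime to d.\<close>

lemma cong_local_global:
  fixes x y :: int
  assumes R: "full_at d R \<pi>" and N: "nat_dvd N \<pi>"
    and 1: "[x = y] (mod int R)"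
    and 2: "\<And>M. M dvd N \<Longrightarrow> coprime M d \<Longrightarrow> [x = y] (mod int M)"
  shows "[x = y] (mod int N)"
proof -
  have "N dvd nat \<bar>x - y\<bar>"
  proof (rule dvd_if_prime_powers_dvd)
    show "0 < N" using N by (rule nat_dvd_pos)
    fix p :: nat assume p: "prime p"
    have pN: "p ^ multiplicity p N dvd N" by (rule multiplicity_dvd)
    show "p ^ multiplicity p N dvd nat \<bar>x - y\<bar>"
    proof (cases "p dvd d")
      case True
      then have "enat (multiplicity p N) \<le> enat (multiplicity p R)"
        using R N p by (auto simp: full_at_def nat_dvd_iff)
      then have "p ^ multiplicity p N dvd R" by (intro multiplicity_dvd') simp
      then have "int (p ^ multiplicity p N) dvd x - y"
        using 1 unfolding cong_iff_dvd_diff by (metis dvd_trans of_nat_dvd_iff)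
      then show ?thesis by (simp only: nat_abs_dvd_iff int_dvd_int_iff dvd_nat_abs_iff)
    next
      case False
      then have "coprime (p ^ multiplicity p N) d"
        using p by (simp add: prime_imp_coprime)
      then have "int (p ^ multiplicity p N) dvd x - y"
        using 2[OF pN] unfolding cong_iff_dvd_diff by blast
      then show ?thesis by (simp only: dvd_nat_abs_iff)
    qed
  qed
  then show ?thesis unfolding cong_iff_dvd_diff by (simp only: dvd_nat_abs_iff)
qed

lemma coef_local_global:
  assumes R: "full_at D R \<pi>" and v: "v \<in> pro_carrier Fin_Sgrp A" and w: "w \<in> pro_carrier Fin_Sgrp A"
    and 1: "coef R A v a = coef R A w a"
    and 2: "\<And>K. nat_dvd K \<pi> \<Longrightarrow> coprime K D \<Longrightarrow> coef K A v a = coef K A w a"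
    and N: "nat_dvd N \<pi>"
  shows "coef N A v a = coef N A w a"
proof -
  \<comment> \<open>Coefficients for different moduli are comparable only as reductions from a
    common multiple that still divides \<open>\<pi>\<close>.\<close>
  define L where "L = lcm R N"
  have L: "nat_dvd L \<pi>" "R dvd L" "N dvd L"
    unfolding L_def using R N by (auto simp: full_at_def intro: nat_dvd_lcm)
  have L0: "0 < L" using L(1) by (rule nat_dvd_pos)
  have K: "[int (coef L A v a) = int (coef L A w a)] (mod int K)"
    if "K dvd L" "coef K A v a = coef K A w a" for K
    using that coef_mod[OF v L0 that(1), of a] coef_mod[OF w L0 that(1), of a]
    by (simp add: cong_def zmod_int[symmetric])
  have "[int (coef L A v a) = int (coef L A w a)] (mod int L)"
    using R L(1) by (rule cong_local_global) (use 1 2 L nat_dvd_dvd in \<open>auto intro!: K\<close>)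
  then have "coef L A v a = coef L A w a"
    using coef_less[OF v L0, of a] coef_less[OF w L0, of a] by (simp add: cong_def zmod_int[symmetric])
  then show ?thesis unfolding coef_mod[OF v L0 L(3)] coef_mod[OF w L0 L(3)] by simp
qed

text \<open>The powers of q modulo N become periodic after exponent i; since q is invertible, q^i
  cancels, and the period divides k!.\<close>

lemma power_fact_cong_1:
  fixes q N :: nat
  assumes "coprime q N" "0 < N" "N \<le> k"
  shows "[q ^ fact k = 1] (mod N)"
proof -
  obtain i d where id: "0 < d" "i + d \<le> N"
    and per: "\<And>m k. i \<le> m \<Longrightarrow> q ^ (m + d * k) mod N = q ^ m mod N"
    using power_mod_periodic[OF assms(2), of q] by metis
  have "d dvd fact k" using id assms by (intro dvd_fact) auto
  then obtain j where j: "fact k = d * j" ..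
  have "[q ^ i * q ^ (d * j) = q ^ i * 1] (mod N)"
    using per[of i j] by (simp add: cong_def power_add)
  then show ?thesis unfolding j
    using assms(1) by (subst (asm) cong_mult_lcancel_nat) (auto simp: coprime_commute)
qed

text \<open>The product is q^(N!), so q^(omega-1) acts as 1/q away from the prime q.\<close>

lemma exponent_seq_inverse:
  assumes "prime q" "coprime q N" "0 < N"
  shows "[q * exponent_seq q N = 1] (mod N)"
proof -
  have "q * exponent_seq q N = q ^ fact N"
    using prime_gt_1_nat[OF assms(1)] fact_gt_zero[of N, where 'a = nat]
    by (simp add: exponent_seq_def power_Suc[symmetric] del: power_Suc)
  then show ?thesis using power_fact_cong_1[OF assms(2,3) order_refl] by simp
qed

lemma exponent_seq_1: "0 < N \<Longrightarrow> [int (exponent_seq 1 N) = -1] (mod int N)"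
proof -
  assume N: "0 < N"
  have "int (exponent_seq 1 N) = int (fact N) - 1"
    using fact_ge_1[of N, where 'a = nat] by (simp add: exponent_seq_def of_nat_diff)
  moreover have "int N dvd int (fact N)" using N by (simp add: dvd_fact del: of_nat_fact)
  ultimately show ?thesis by (simp add: cong_iff_dvd_diff)
qed

subsection \<open>Values of terms\<close>

lemma le_pair_encode: "a + b \<le> prod_encode (a, b)"
proof -
  have "k \<le> triangle k" for k by (induction k) auto
  from this[of "a + b"] show ?thesis by (simp add: prod_encode_def)
qed

text \<open>The sum of symbol and subterm code is needed, not only the larger of the two: the new
  denominator q times d has to stay below 2 to the power of the code.\<close>

lemma sterm_encode_App1: "f + sterm_encode t < sterm_encode (App f [t])"
proof -
  have "sterm_encode t \<le> prod_encode (sterm_encode t, 0)" using le_pair_encode[of "sterm_encode t" 0] by simp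
  moreover have "Suc f + Suc (prod_encode (sterm_encode t, 0)) \<le> sterm_encode (App f [t])"
    using le_pair_encode[of "Suc f" "Suc (prod_encode (sterm_encode t, 0))"] by simp
  ultimately show ?thesis by linarith
qed

lemma sterm_encode_App2: "sterm_encode s + sterm_encode t < sterm_encode (App f [s, t])"
proof -
  let ?s = "sterm_encode s" and ?t = "sterm_encode t"
  have "?t \<le> prod_encode (?t, 0)" using le_pair_encode[of ?t 0] by simp
  moreover have "?s + Suc (prod_encode (?t, 0)) \<le> prod_encode (?s, Suc (prod_encode (?t, 0)))"
    by (rule le_pair_encode)
  moreover have "Suc f + Suc (prod_encode (?s, Suc (prod_encode (?t, 0)))) \<le> sterm_encode (App f [s, t])"
    using le_pair_encode[of "Suc f" "Suc (prod_encode (?s, Suc (prod_encode (?t, 0))))"] by simp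
  ultimately show ?thesis by linarith
qed

text \<open>At the primes not dividing \<open>d\<close>, the coefficients of a term are the rational numbers \<open>u a / d\<close>.\<close>

lemma term_coef_rational:
  assumes "sterm_over (sigma_pi \<pi>) A t"
  shows "\<exists>d u. 0 < d \<and> d \<le> 2 ^ sterm_encode t \<and>
    (\<forall>p. prime p \<longrightarrow> p dvd d \<longrightarrow> p \<in> finite_primes \<pi> \<and> p \<le> sterm_encode t) \<and>
    (\<forall>a. \<bar>u a\<bar> \<le> 2 ^ sterm_encode t) \<and>
    (\<forall>N>0. coprime N d \<longrightarrow> (\<forall>a\<in>A.
      [int d * int (coef N A (sterm_eval (sigma_pi \<pi>) Fin_Sgrp A t) a) = u a] (mod int N)))"
  using assms
proof (induction rule: sigma_term_induct)
  case (Var b)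
  show ?case
    by (rule exI[of _ 1], rule exI[of _ "\<lambda>a. of_bool (b = a)"])
      (use Var in \<open>auto simp: coef_gen cong_def zmod_int\<close>)
next
  case (mult s t)
  let ?e = "sterm_eval (sigma_pi \<pi>) Fin_Sgrp A" and ?c = sterm_encode
  obtain d u where s: "0 < d" "d \<le> 2 ^ ?c s" "\<And>a. \<bar>u a\<bar> \<le> 2 ^ ?c s"
    "\<And>p. prime p \<Longrightarrow> p dvd d \<Longrightarrow> p \<in> finite_primes \<pi> \<and> p \<le> ?c s"
    "\<And>N a. 0 < N \<Longrightarrow> coprime N d \<Longrightarrow> a \<in> A \<Longrightarrow> [int d * int (coef N A (?e s) a) = u a] (mod int N)"
    using mult.IH(1) by blast
  obtain d' u' where t: "0 < d'" "d' \<le> 2 ^ ?c t" "\<And>a. \<bar>u' a\<bar> \<le> 2 ^ ?c t"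
    "\<And>p. prime p \<Longrightarrow> p dvd d' \<Longrightarrow> p \<in> finite_primes \<pi> \<and> p \<le> ?c t"
    "\<And>N a. 0 < N \<Longrightarrow> coprime N d' \<Longrightarrow> a \<in> A \<Longrightarrow> [int d' * int (coef N A (?e t) a) = u' a] (mod int N)"
    using mult.IH(2) by blast
  let ?n = "?c (App 0 [s, t])"
  have n: "?c s + ?c t < ?n" by (rule sterm_encode_App2)
  \<comment> \<open>The strict inequality between the codes yields the factor 2 that pays for adding
    two cross products in the numerator.\<close>
  have pw: "2 * (2 ^ ?c s * 2 ^ ?c t) \<le> (2 ^ ?n :: 'a :: linordered_semidom)"
  proof -
    have "2 * (2 ^ ?c s * 2 ^ ?c t) = (2 ^ Suc (?c s + ?c t) :: 'a)" by (simp add: power_add)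
    also have "\<dots> \<le> 2 ^ ?n" using n by (intro power_increasing) auto
    finally show ?thesis .
  qed
  let ?u = "\<lambda>a. u a * int d' + u' a * int d"
  have 1: "d * d' \<le> 2 ^ ?n"
  proof -
    have "d * d' \<le> 2 ^ ?c s * 2 ^ ?c t" by (intro mult_mono s t) auto
    also have "\<dots> \<le> 2 * (2 ^ ?c s * 2 ^ ?c t)" by simp
    also have "\<dots> \<le> 2 ^ ?n" by (rule pw)
    finally show ?thesis .
  qed
  have 2: "\<bar>?u a\<bar> \<le> 2 ^ ?n" for a
  proof -
    have d: "int d \<le> 2 ^ ?c s" "int d' \<le> 2 ^ ?c t"
      using s(2) t(2) by (metis of_nat_le_iff of_nat_numeral of_nat_power)+
    have "\<bar>?u a\<bar> \<le> \<bar>u a\<bar> * int d' + \<bar>u' a\<bar> * int d"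
      by (rule order_trans[OF abs_triangle_ineq]) (simp add: abs_mult)
    also have "\<dots> \<le> 2 ^ ?c s * 2 ^ ?c t + 2 ^ ?c t * 2 ^ ?c s"
      by (intro add_mono mult_mono s t d) auto
    also have "\<dots> = 2 * (2 ^ ?c s * 2 ^ ?c t)" by simp
    also have "\<dots> \<le> 2 ^ ?n" by (rule pw)
    finally show ?thesis .
  qed
  have 3: "p \<in> finite_primes \<pi> \<and> p \<le> ?n" if "prime p" "p dvd d * d'" for p
    using that s(4)[OF that(1)] t(4)[OF that(1)] n by (auto simp: prime_dvd_mult_iff)
  have 4: "[int (d * d') * int (coef N A (?e (App 0 [s, t])) a) = ?u a] (mod int N)"
    if N: "0 < N" "coprime N (d * d')" "a \<in> A" for N a
  proof -
    have "?e (App 0 [s, t]) = smult (Free_Pro Fin_Sgrp A) (?e s) (?e t)"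
      using mult by (intro eval_mult eval_in order_refl)
    then have "[int (coef N A (?e (App 0 [s, t])) a) = int (coef N A (?e s) a) + int (coef N A (?e t) a)] (mod int N)"
      using N(1) by (simp only: coef_smult) (simp add: cong_def zmod_int)
    then have "[int (d * d') * int (coef N A (?e (App 0 [s, t])) a)
        = int (d * d') * (int (coef N A (?e s) a) + int (coef N A (?e t) a))] (mod int N)"
      by (rule cong_scalar_left)
    also have "int (d * d') * (int (coef N A (?e s) a) + int (coef N A (?e t) a))
        = int d * int (coef N A (?e s) a) * int d' + int d' * int (coef N A (?e t) a) * int d"
      by (simp add: algebra_simps)
    also have "[\<dots> = ?u a] (mod int N)"
      using N by (intro cong_add cong_mult cong_refl s(5) t(5)) auto
    finally show ?thesis .
  qed
  show ?case
  proof (rule exI[of _ "d * d'"], rule exI[of _ ?u], intro conjI)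
    show "0 < d * d'" using s(1) t(1) by simp
  qed (use 1 2 3 4 in blast)+
next
  case (inv t)
  let ?e = "sterm_eval (sigma_pi \<pi>) Fin_Sgrp A" and ?c = sterm_encode
  obtain d u where t: "0 < d" "d \<le> 2 ^ ?c t" "\<And>a. \<bar>u a\<bar> \<le> 2 ^ ?c t"
    "\<And>p. prime p \<Longrightarrow> p dvd d \<Longrightarrow> p \<in> finite_primes \<pi> \<and> p \<le> ?c t"
    "\<And>N a. 0 < N \<Longrightarrow> coprime N d \<Longrightarrow> a \<in> A \<Longrightarrow> [int d * int (coef N A (?e t) a) = u a] (mod int N)"
    using inv.IH by blast
  let ?n = "?c (App 1 [t])"
  have n: "?c t \<le> ?n" using sterm_encode_App1[of 1 t] by simp
  have pw: "2 ^ ?c t \<le> (2 ^ ?n :: 'a :: linordered_semidom)" using n by (intro power_increasing) auto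
  have 4: "[int d * int (coef N A (?e (App 1 [t])) a) = - u a] (mod int N)"
    if N: "0 < N" "coprime N d" "a \<in> A" for N a
  proof -
    have "[int d * int (coef N A (?e (App 1 [t])) a)
        = int d * (int (exponent_seq 1 N) * int (coef N A (?e t) a))] (mod int N)"
      using coef_eval_power[OF inv(1) order_refl N(1) order_refl, of a]
      by (intro cong_scalar_left) (simp add: cong_def zmod_int del: sterm_eval.simps)
    also have "int d * (int (exponent_seq 1 N) * int (coef N A (?e t) a))
        = int (exponent_seq 1 N) * (int d * int (coef N A (?e t) a))" by simp
    also have "[\<dots> = -1 * u a] (mod int N)"
      by (intro cong_mult exponent_seq_1 t(5) N)
    finally show ?thesis by simp
  qed
  have 1: "d \<le> 2 ^ ?n" by (rule order_trans[OF t(2) pw])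
  have 2: "\<bar>- u a\<bar> \<le> 2 ^ ?n" for a unfolding abs_minus_cancel by (rule order_trans[OF t(3) pw])
  have 3: "p \<in> finite_primes \<pi> \<and> p \<le> ?n" if "prime p" "p dvd d" for p
    using t(4)[OF that] n by linarith
  show ?case
    by (rule exI[of _ d], rule exI[of _ "\<lambda>a. - u a"]) (use t(1) 1 2 3 4 in blast)
next
  case (pow q t)
  let ?e = "sterm_eval (sigma_pi \<pi>) Fin_Sgrp A" and ?c = sterm_encode
  obtain d u where t: "0 < d" "d \<le> 2 ^ ?c t" "\<And>a. \<bar>u a\<bar> \<le> 2 ^ ?c t"
    "\<And>p. prime p \<Longrightarrow> p dvd d \<Longrightarrow> p \<in> finite_primes \<pi> \<and> p \<le> ?c t"
    "\<And>N a. 0 < N \<Longrightarrow> coprime N d \<Longrightarrow> a \<in> A \<Longrightarrow> [int d * int (coef N A (?e t) a) = u a] (mod int N)"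
    using pow.IH by blast
  let ?n = "?c (App q [t])"
  have q: "prime q" "1 \<le> q" using finite_primesD[OF pow(1)] by auto
  have n: "q + ?c t < ?n" by (rule sterm_encode_App1)
  have pw: "2 ^ ?c t \<le> (2 ^ ?n :: 'a :: linordered_semidom)" using n by (intro power_increasing) auto
  have 1: "d * q \<le> 2 ^ ?n"
  proof -
    have "d * q \<le> 2 ^ ?c t * 2 ^ q"
      using less_exp[of q] by (intro mult_mono t) auto
    also have "\<dots> = 2 ^ (q + ?c t)" by (simp add: power_add)
    also have "\<dots> \<le> 2 ^ ?n" using n by (intro power_increasing) auto
    finally show ?thesis .
  qed
  have 3: "p \<in> finite_primes \<pi> \<and> p \<le> ?n" if "prime p" "p dvd d * q" for p
  proof (cases "p dvd d")
    case True
    then show ?thesis using t(4)[OF that(1)] n by auto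
  next
    case False
    then have "p = q" using that q(1) by (simp add: prime_dvd_mult_iff primes_dvd_imp_eq)
    then show ?thesis using pow(1) n by auto
  qed
  have 4: "[int (d * q) * int (coef N A (?e (App q [t])) a) = u a] (mod int N)"
    if N: "0 < N" "coprime N (d * q)" "a \<in> A" for N a
  proof -
    have "[int (d * q) * int (coef N A (?e (App q [t])) a)
        = int (d * q) * (int (exponent_seq q N) * int (coef N A (?e t) a))] (mod int N)"
      using coef_eval_power[OF pow(2) q(2) N(1) order_refl, of a]
      by (intro cong_scalar_left) (simp add: cong_def zmod_int del: sterm_eval.simps)
    also have "int (d * q) * (int (exponent_seq q N) * int (coef N A (?e t) a))
        = int (q * exponent_seq q N) * (int d * int (coef N A (?e t) a))" by simp
    also have "[\<dots> = int 1 * u a] (mod int N)"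
    proof (intro cong_mult t(5) N)
      have "[q * exponent_seq q N = 1] (mod N)"
        using N q by (intro exponent_seq_inverse) (auto simp: coprime_commute)
      then show "[int (q * exponent_seq q N) = int 1] (mod int N)" by (simp only: cong_int_iff)
      show "coprime N d" using N by simp
    qed
    finally show ?thesis by simp
  qed
  show ?case
  proof (rule exI[of _ "d * q"], rule exI[of _ u], intro conjI)
    show "0 < d * q" using t(1) q(2) by simp
    show "\<forall>a. \<bar>u a\<bar> \<le> 2 ^ ?n" using order_trans[OF t(3) pw] by blast
  qed (use 1 3 4 in blast)+
qed

text \<open>\<open>\<int>/N\<close> then suffices for testing the equality of terms with codes up to \<open>n\<close>: by the lower bound on
  \<open>M\<close>, a congruence modulo \<open>M\<close> between numerators of coefficients is an equality.\<close>

definition sufficient :: "supernatural \<Rightarrow> nat \<Rightarrow> nat \<Rightarrow> bool" where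
  "sufficient \<pi> n N \<longleftrightarrow> nat_dvd N \<pi> \<and>
    ((\<forall>M. nat_dvd M \<pi> \<longrightarrow> M dvd N) \<or>
     (\<exists>R M. R dvd N \<and> M dvd N \<and> 2 * (2 ^ n * 2 ^ n) < M \<and>
       (\<forall>q\<in>finite_primes \<pi>. q \<le> n \<longrightarrow> \<not> q dvd M \<and> \<pi> q = enat (multiplicity q R))))"

text \<open>In the first alternative N is a multiple of every modulus that occurs. In the second,
  the cross-multiplied difference of the numerators is divisible by M and smaller than M, hence 0;
  this settles all moduli coprime to both denominators, and R settles the primes dividing a
  denominator.\<close>

lemma sufficient_coef_eq:
  assumes N: "sufficient \<pi> n N"
    and s: "sterm_over (sigma_pi \<pi>) A s" "sterm_encode s \<le> n"
    and t: "sterm_over (sigma_pi \<pi>) A t" "sterm_encode t \<le> n"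
    and a: "a \<in> A"
    and eq: "coef N A (sterm_eval (sigma_pi \<pi>) Fin_Sgrp A s) a = coef N A (sterm_eval (sigma_pi \<pi>) Fin_Sgrp A t) a"
    and N': "nat_dvd N' \<pi>"
  shows "coef N' A (sterm_eval (sigma_pi \<pi>) Fin_Sgrp A s) a = coef N' A (sterm_eval (sigma_pi \<pi>) Fin_Sgrp A t) a"
proof -
  let ?e = "sterm_eval (sigma_pi \<pi>) Fin_Sgrp A"
  have es: "?e s \<in> pro_carrier Fin_Sgrp A" and et: "?e t \<in> pro_carrier Fin_Sgrp A"
    using s t by (auto intro: eval_in)
  have N0: "0 < N" "0 < N'" using N N' nat_dvd_pos by (auto simp: sufficient_def)
  have eq_dvd: "coef M A (?e s) a = coef M A (?e t) a" if "M dvd N" for M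
    using coef_mod[OF es N0(1) that] coef_mod[OF et N0(1) that] eq by simp
  consider "\<forall>M. nat_dvd M \<pi> \<longrightarrow> M dvd N" | R M where "R dvd N" "M dvd N" "2 * (2 ^ n * 2 ^ n) < M"
      "\<And>q. q \<in> finite_primes \<pi> \<Longrightarrow> q \<le> n \<Longrightarrow> \<not> q dvd M \<and> \<pi> q = enat (multiplicity q R)"
    using N unfolding sufficient_def by blast
  then show ?thesis
  proof cases
    case 1
    then show ?thesis using eq_dvd N' by blast
  next
    case (2 R M)
    have RM: "nat_dvd R \<pi>" "nat_dvd M \<pi>"
      using N 2(1,2) unfolding sufficient_def by (auto intro: nat_dvd_dvd)
    obtain d u where du: "0 < d" "d \<le> 2 ^ sterm_encode s" "\<And>a. \<bar>u a\<bar> \<le> 2 ^ sterm_encode s"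
      "\<And>p. prime p \<Longrightarrow> p dvd d \<Longrightarrow> p \<in> finite_primes \<pi> \<and> p \<le> sterm_encode s"
      "\<And>N a. 0 < N \<Longrightarrow> coprime N d \<Longrightarrow> a \<in> A \<Longrightarrow> [int d * int (coef N A (?e s) a) = u a] (mod int N)"
      using term_coef_rational[OF s(1)] by blast
    obtain d' u' where du': "0 < d'" "d' \<le> 2 ^ sterm_encode t" "\<And>a. \<bar>u' a\<bar> \<le> 2 ^ sterm_encode t"
      "\<And>p. prime p \<Longrightarrow> p dvd d' \<Longrightarrow> p \<in> finite_primes \<pi> \<and> p \<le> sterm_encode t"
      "\<And>N a. 0 < N \<Longrightarrow> coprime N d' \<Longrightarrow> a \<in> A \<Longrightarrow> [int d' * int (coef N A (?e t) a) = u' a] (mod int N)"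
      using term_coef_rational[OF t(1)] by blast
    let ?D = "d * d'"
    have primes: "p \<in> finite_primes \<pi> \<and> p \<le> n" if "prime p" "p dvd ?D" for p
      using that du(4)[OF that(1)] du'(4)[OF that(1)] s(2) t(2) by (auto simp: prime_dvd_mult_iff)
    have key: "[int ?D * int (coef K A (?e s) a) - int ?D * int (coef K A (?e t) a)
        = u a * int d' - u' a * int d] (mod int K)" if K: "0 < K" "coprime K ?D" for K
    proof -
      have "[int d * int (coef K A (?e s) a) * int d' - int d' * int (coef K A (?e t) a) * int d
          = u a * int d' - u' a * int d] (mod int K)"
        using K a by (intro cong_diff cong_mult cong_refl du(5) du'(5)) auto
      then show ?thesis by (simp add: algebra_simps)
    qed
    have M0: "0 < M" using 2(3) by simp
    have MD: "coprime M ?D"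
    proof (rule ccontr)
      assume "\<not> coprime M ?D"
      then have "gcd M ?D \<noteq> 1" by (simp only: coprime_iff_gcd_eq_1 not_False_eq_True)
      from prime_factor_nat[OF this] obtain p where "prime p" "p dvd M" "p dvd ?D"
        by (auto simp only: gcd_greatest_iff)
      then show False using primes 2(4) by blast
    qed
    have "int M dvd u a * int d' - u' a * int d"
      using key[OF M0 MD] eq_dvd[OF 2(2)] by (simp add: cong_0_iff cong_sym_eq[of 0])
    moreover have "\<bar>u a * int d' - u' a * int d\<bar> < int M"
    proof -
      have "sterm_encode s \<le> n" "sterm_encode t \<le> n" by fact+
      then have pw: "(2::int) ^ sterm_encode s \<le> 2 ^ n" "(2::int) ^ sterm_encode t \<le> 2 ^ n"
        by (simp_all add: power_increasing)
      have "int d \<le> 2 ^ sterm_encode s" "int d' \<le> 2 ^ sterm_encode t"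
        using du(2) du'(2) by (metis of_nat_le_iff of_nat_numeral of_nat_power)+
      then have b: "int d \<le> 2 ^ n" "int d' \<le> 2 ^ n" using pw by linarith+
      have c: "\<bar>u a\<bar> \<le> 2 ^ n" "\<bar>u' a\<bar> \<le> 2 ^ n"
        using order_trans[OF du(3) pw(1)] order_trans[OF du'(3) pw(2)] .
      have "\<bar>u a * int d' - u' a * int d\<bar> \<le> \<bar>u a\<bar> * int d' + \<bar>u' a\<bar> * int d"
        by (rule order_trans[OF abs_triangle_ineq4]) (simp add: abs_mult)
      also have "\<dots> \<le> 2 ^ n * 2 ^ n + 2 ^ n * 2 ^ n"
        by (intro add_mono mult_mono b c) auto
      also have "\<dots> = int (2 * (2 ^ n * 2 ^ n))" by simp
      also have "\<dots> < int M" using 2(3) by (simp only: of_nat_less_iff)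
      finally show ?thesis .
    qed
    ultimately have zero: "u a * int d' - u' a * int d = 0"
      using dvd_imp_le_int[of "u a * int d' - u' a * int d" "int M"] by linarith
    have "full_at ?D R \<pi>" using RM(1) primes 2(4) by (auto simp: full_at_def)
    then show ?thesis
    proof (rule coef_local_global[OF _ es et eq_dvd[OF 2(1)] _ N'])
      fix K assume K: "nat_dvd K \<pi>" "coprime K ?D"
      have K0: "0 < K" using K(1) by (rule nat_dvd_pos)
      have "[int ?D * int (coef K A (?e s) a) = int ?D * int (coef K A (?e t) a)] (mod int K)"
        using key[OF K0 K(2)] zero by (simp add: cong_diff_iff_cong_0)
      then have "[int (coef K A (?e s) a) = int (coef K A (?e t) a)] (mod int K)"
        using K(2) by (subst (asm) cong_mult_lcancel) (auto simp: coprime_commute simp del: of_nat_mult)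
      then show "coef K A (?e s) a = coef K A (?e t) a"
        using coef_less[OF es K0, of a] coef_less[OF et K0, of a]
        by (simp add: cong_def zmod_int[symmetric])
    qed
  qed
qed

subsection \<open>Computability of the supernatural number\<close>

text \<open>The value 0 stands for non-primes and for primes with value infinity. A nonzero value
  thus marks exactly the finite primes and exceeds \<open>\<pi> p\<close> by one.\<close>

definition prime_code :: "supernatural \<Rightarrow> nat \<Rightarrow> nat" where
  "prime_code \<pi> p = (if prime p then enat_encode (\<pi> p) else 0)"

lemma computable_prime_code:
  assumes "recursive_supernatural \<pi>" "computable g"
  shows "computable (\<lambda>n. prime_code \<pi> (g n))"
proof -
  obtain f where f: "partrec f" "\<And>p. prime p \<Longrightarrow> f p = Some (enat_encode (\<pi> p))"
    using assms(1) by (auto simp: recursive_supernatural_def)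
  have "computable (prime_code \<pi>)"
    unfolding prime_code_def using f by (intro computable_partial_guard computable_intros)
  then show ?thesis by (rule computable_comp[OF _ assms(2)])
qed

lemma enat_encode_eq_iff: "enat_encode x = 0 \<longleftrightarrow> x = \<infinity>" "enat_encode x = Suc k \<longleftrightarrow> x = enat k"
  by (cases x; simp)+

lemma finite_primes_iff: "q \<in> finite_primes \<pi> \<longleftrightarrow> prime_code \<pi> q \<noteq> 0"
  by (cases "\<pi> q") (auto simp: finite_primes_def prime_code_def)

lemma prime_code_finite: "q \<in> finite_primes \<pi> \<Longrightarrow> \<pi> q = enat (prime_code \<pi> q - 1)"
  by (cases "\<pi> q") (auto simp: finite_primes_def prime_code_def)

text \<open>The product of p to the power \<open>\<pi> p\<close> over the finite primes p up to n;
  it plays the part of R in \<open>sufficient\<close>.\<close>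

definition full_part :: "supernatural \<Rightarrow> nat \<Rightarrow> nat" where
  "full_part \<pi> n = (\<Prod>p<Suc n. if prime_code \<pi> p \<noteq> 0 then p ^ (prime_code \<pi> p - 1) else 1)"

lemma computable_full_part:
  assumes "recursive_supernatural \<pi>" "computable f"
  shows "computable (\<lambda>n. full_part \<pi> (f n))"
  unfolding full_part_def
  by (intro computable_prod_lessThan computable_intros computable_prime_code assms)

lemma multiplicity_full_part:
  assumes "prime p"
  shows "multiplicity p (full_part \<pi> n) = (if p \<in> finite_primes \<pi> \<and> p \<le> n then prime_code \<pi> p - 1 else 0)"
proof -
  let ?S = "{p\<in>{..<Suc n}. prime_code \<pi> p \<noteq> 0}"
  have "full_part \<pi> n = (\<Prod>p\<in>?S. p ^ (prime_code \<pi> p - 1))"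
    unfolding full_part_def by (rule prod.inter_filter[symmetric]) simp
  moreover have "prime q" if "q \<in> ?S" for q
    using that by (auto simp: prime_code_def split: if_splits)
  then have "multiplicity p (\<Prod>p\<in>?S. p ^ (prime_code \<pi> p - 1)) = (if p \<in> ?S then prime_code \<pi> p - 1 else 0)"
    using assms by (intro multiplicity_prod_prime_powers) auto
  ultimately have "multiplicity p (full_part \<pi> n) = (if p \<in> ?S then prime_code \<pi> p - 1 else 0)"
    by (simp only:)
  then show ?thesis by (auto simp: finite_primes_iff)
qed

lemma full_part_pos: "0 < full_part \<pi> n"
  unfolding full_part_def
  by (intro prod_pos) (auto simp: prime_code_def prime_gt_0_nat split: if_splits)

lemma full_part_dvd: "nat_dvd (full_part \<pi> n) \<pi>"
  unfolding nat_dvd_iff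
  using full_part_pos prime_code_finite
  by (auto simp: multiplicity_full_part zero_enat_def[symmetric])

lemma full_part_full:
  "q \<in> finite_primes \<pi> \<Longrightarrow> q \<le> n \<Longrightarrow> \<pi> q = enat (multiplicity q (full_part \<pi> n))"
  using prime_code_finite[of q \<pi>] multiplicity_full_part[OF finite_primesD(1)] by simp

text \<open>All primes in \<open>full_part \<pi> n\<close> are finite primes up to n, which M
  avoids. The two factors are coprime, so their product still divides \<open>\<pi>\<close>.\<close>

lemma sufficient_product:
  assumes M: "nat_dvd M \<pi>" "2 * (2 ^ n * 2 ^ n) < M"
    "\<And>q. q \<in> finite_primes \<pi> \<Longrightarrow> q \<le> n \<Longrightarrow> \<not> q dvd M"
  shows "sufficient \<pi> n (full_part \<pi> n * M)"
proof -
  have "coprime (full_part \<pi> n) M"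
  proof (rule ccontr)
    assume "\<not> coprime (full_part \<pi> n) M"
    then have "gcd (full_part \<pi> n) M \<noteq> 1" by (simp only: coprime_iff_gcd_eq_1 not_False_eq_True)
    from prime_factor_nat[OF this] obtain p where p: "prime p" "p dvd full_part \<pi> n" "p dvd M"
      by (auto simp only: gcd_greatest_iff)
    have "0 < multiplicity p (full_part \<pi> n)"
      using p full_part_pos[of \<pi> n] by (simp add: prime_multiplicity_gt_zero_iff)
    then show False using M(3)[of p] p by (auto simp: multiplicity_full_part split: if_splits)
  qed
  then have nd: "nat_dvd (full_part \<pi> n * M) \<pi>"
    by (intro nat_dvd_mult_coprime full_part_dvd M)
  show ?thesis unfolding sufficient_def
    by (rule conjI[OF nd], rule disjI2, rule exI[of _ "full_part \<pi> n"], rule exI[of _ M])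
      (use M full_part_full[of _ \<pi> n] in auto)
qed

lemma nat_dvd_prime_power:
  assumes "prime p" "enat k \<le> \<pi> p"
  shows "nat_dvd (p ^ k) \<pi>"
  unfolding nat_dvd_iff
proof (intro conjI allI impI)
  show "0 < p ^ k" using assms(1) by (simp add: prime_gt_0_nat)
  fix q :: nat assume q: "prime q"
  show "enat (multiplicity q (p ^ k)) \<le> \<pi> q"
    using assms q multiplicity_distinct_prime_power[of q p k]
    by (cases "q = p") (auto simp: zero_enat_def[symmetric])
qed

text \<open>A large M free of small finite primes is a power of a prime with value infinity, or a
  large prime dividing \<open>\<pi>\<close>. If neither is to be had, \<open>\<pi>\<close> is a
  natural number and can itself serve as N. Each case has its own algorithm.\<close>

lemma computable_sufficient:
  assumes \<pi>: "recursive_supernatural \<pi>"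
  shows "\<exists>N. computable N \<and> (\<forall>n. sufficient \<pi> n (N n))"
proof -
  consider (inf) p where "prime p" "\<pi> p = \<infinity>"
    | (many) "infinite {p. prime p \<and> \<pi> p \<noteq> 0}"
    | (fin) "finite {p. prime p \<and> \<pi> p \<noteq> 0}" "\<And>p. prime p \<Longrightarrow> \<pi> p \<noteq> \<infinity>" by blast
  then show ?thesis
  proof cases
    case inf
    \<comment> \<open>The required lower bound itself is taken as exponent, as p^k exceeds
      k.\<close>
    let ?M = "\<lambda>n::nat. p ^ (2 * (2 ^ n * 2 ^ n))"
    have "sufficient \<pi> n (full_part \<pi> n * ?M n)" for n
    proof (rule sufficient_product)
      show "nat_dvd (?M n) \<pi>" using inf by (intro nat_dvd_prime_power) auto
      show "2 * (2 ^ n * 2 ^ n) < ?M n" using prime_gt_1_nat[OF inf(1)] by (intro power_gt_expt) auto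
      fix q assume "q \<in> finite_primes \<pi>" "q \<le> n"
      then have "prime q" "q \<noteq> p" using inf by (auto simp: finite_primes_def)
      then show "\<not> q dvd ?M n" using inf(1) by (meson prime_dvd_power primes_dvd_imp_eq)
    qed
    moreover have "computable (\<lambda>n. full_part \<pi> n * ?M n)"
      by (intro computable_intros computable_full_part \<pi>)
    ultimately show ?thesis by blast
  next
    case many
    \<comment> \<open>Since 0 is coded by 1, the last condition says that \<open>\<pi> p\<close> is
      not 0; the value infinity is allowed.\<close>
    define P where "P n p \<longleftrightarrow> 2 * (2 ^ n * 2 ^ n) < p \<and> prime p \<and> prime_code \<pi> p \<noteq> 1" for n p :: nat
    have code: "prime_code \<pi> p = 1 \<longleftrightarrow> \<pi> p = 0" if "prime p" for p
      using that enat_encode_eq_iff(2)[of "\<pi> p" 0] by (simp add: prime_code_def zero_enat_def)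
    have ex: "\<exists>p. P n p" for n
      using many unfolding infinite_nat_iff_unbounded P_def using code by blast
    let ?M = "\<lambda>n. LEAST p. P n p"
    have M: "P n (?M n)" for n using LeastI_ex[OF ex] .
    have "sufficient \<pi> n (full_part \<pi> n * ?M n)" for n
    proof (rule sufficient_product)
      have pi: "\<pi> (?M n) \<noteq> 0" "prime (?M n)" using M[of n] code unfolding P_def by auto
      have "enat 1 \<le> \<pi> (?M n)" using pi(1) by (simp add: one_enat_def[symmetric] ileI1 one_eSuc[symmetric] iless_eSuc0 Suc_ile_eq zero_enat_def[symmetric])
      then show "nat_dvd (?M n) \<pi>" using nat_dvd_prime_power[OF pi(2), of 1] by simp
      show lt: "2 * (2 ^ n * 2 ^ n) < ?M n" using M[of n] unfolding P_def by blast
      fix q assume q: "q \<in> finite_primes \<pi>" "q \<le> n"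
      have "n < 2 ^ n" by (rule less_exp)
      also have "(2::nat) ^ n \<le> 2 * (2 ^ n * 2 ^ n)" by simp
      finally have "q < ?M n" using lt q by simp
      then show "\<not> q dvd ?M n" using pi(2) finite_primesD(1)[OF q(1)] by (auto dest: primes_dvd_imp_eq)
    qed
    moreover have "computable (\<lambda>n. full_part \<pi> n * ?M n)"
      using ex unfolding P_def
      by (intro computable_intros computable_full_part \<pi> computable_Least computable_prime_code)
    ultimately show ?thesis by blast
  next
    case fin
    \<comment> \<open>All primes dividing \<open>\<pi>\<close> are at most b and finite, so
      \<open>full_part \<pi> b\<close> is \<open>\<pi>\<close> itself.\<close>
    obtain b where b: "\<And>p. prime p \<Longrightarrow> \<pi> p \<noteq> 0 \<Longrightarrow> p \<le> b"
      using fin(1) unfolding finite_nat_set_iff_bounded_le by auto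
    have "M dvd full_part \<pi> b" if M: "nat_dvd M \<pi>" for M
    proof (rule multiplicity_le_imp_dvd)
      show "M \<noteq> 0" using M by (auto simp: nat_dvd_iff)
      fix p :: nat assume p: "prime p"
      have le: "enat (multiplicity p M) \<le> \<pi> p" using M p by (simp add: nat_dvd_iff)
      have fp: "p \<in> finite_primes \<pi>" using fin(2) p by (simp add: finite_primes_def)
      show "multiplicity p M \<le> multiplicity p (full_part \<pi> b)"
      proof (cases "\<pi> p = 0")
        case True
        then show ?thesis using le by (simp add: zero_enat_def)
      next
        case False
        then show ?thesis using le full_part_full[OF fp b[OF p False]] by simp
      qed
    qed
    then have "sufficient \<pi> n (full_part \<pi> b)" for n
      using full_part_dvd unfolding sufficient_def by blast
    then show ?thesis using computable_const by blast
  qed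
qed

subsection \<open>The word problem\<close>

text \<open>Each limit along k! is replaced by its k-th member, which turns the coefficient into a
  natural number. For k = N it is correct modulo N, by \<open>exponent_seq_mod\<close>.\<close>

primrec sterm_val :: "nat \<Rightarrow> nat \<Rightarrow> sterm \<Rightarrow> nat" where
  "sterm_val k a (Var b) = of_bool (b = a)"
| "sterm_val k a (App f ts) = (let vs = map (sterm_val k a) ts in
     if f = 0 then vs ! 0 + vs ! 1 else (if f = 1 then fact k - 1 else f ^ (fact k - 1)) * vs ! 0)"

lemma coef_sterm_val:
  assumes t: "sterm_over (sigma_pi \<pi>) A t" and N: "0 < N" and a: "a \<in> A"
  shows "coef N A (sterm_eval (sigma_pi \<pi>) Fin_Sgrp A t) a = sterm_val N a t mod N"
  using t
proof (induction rule: sigma_term_induct)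
  case (Var b)
  then show ?case using coef_gen[OF a Var N] by simp
next
  case (mult s t)
  have "coef N A (sterm_eval (sigma_pi \<pi>) Fin_Sgrp A (App 0 [s, t])) a
     = (sterm_val N a s mod N + sterm_val N a t mod N) mod N"
    using mult N by (simp only: eval_mult eval_in order_refl coef_smult)
  then show ?case by (simp add: mod_simps)
next
  case (inv t)
  then show ?case using coef_eval_power[OF inv(1) order_refl N order_refl, of a]
    by (simp add: exponent_seq_def mod_simps del: sterm_eval.simps)
next
  case (pow q t)
  then have q: "2 \<le> q" using finite_primesD by blast
  then show ?case using coef_eval_power[OF pow(2) _ N order_refl, of q a] pow(3)
    by (simp add: exponent_seq_def mod_simps del: sterm_eval.simps)
qed

text \<open>A variable never exceeds its own code, nor the code of a term containing it. The
  algorithm can therefore run over a bounded range of letters without consulting A.\<close>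

lemma sterm_val_0:
  assumes "sterm_over (sigma_pi \<pi>) A t" "a \<notin> A \<or> sterm_encode t < a"
  shows "sterm_val k a t = 0"
  using assms
proof (induction rule: sigma_term_induct)
  case (Var b)
  then show ?case using le_pair_encode[of 0 b] by auto
next
  case (mult s t)
  then show ?case using sterm_encode_App2[of s t 0] by (auto simp del: sterm_encode.simps)
next
  case (inv t)
  then show ?case using sterm_encode_App1[of 1 t] by (auto simp del: sterm_encode.simps)
next
  case (pow q t)
  then show ?case using sterm_encode_App1[of q t] finite_primesD(2)[OF pow(1)]
    by (auto simp del: sterm_encode.simps)
qed

text \<open>\<open>e\<close> codes the pair (k, a) and n codes the term. A variable has first
  component 0 and a symbol f has \<open>Suc f\<close>; hence 1 and 2 stand for multiplication and
  omega - 1, and a larger value for the prime below it. Subterms are looked up in the history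
  h.\<close>

definition val_step :: "nat \<Rightarrow> nat \<Rightarrow> nat \<Rightarrow> nat" where
  "val_step e n h =
     (if pfst n = 0 then of_bool (psnd n = psnd e)
      else if pfst n = 1 then
        nth_code h (n - Suc (nth_code (psnd n) 0)) + nth_code h (n - Suc (nth_code (psnd n) 1))
      else (if pfst n = 2 then fact (pfst e) - 1 else (pfst n - 1) ^ (fact (pfst e) - 1)) *
        nth_code h (n - Suc (nth_code (psnd n) 0)))"

lemma computable_val:
  "computable f \<Longrightarrow> computable g \<Longrightarrow> computable (\<lambda>n. course_of_values val_step (f n) (g n))"
  unfolding val_step_def
  by (rule computable_course_of_values) (intro computable_intros; assumption?)+

lemmas val_step_unfold = course_of_values_def[of val_step, unfolded val_step_def[of _ _ "history val_step _ _"]]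

lemma val_step_term:
  assumes "sterm_over (sigma_pi \<pi>) A t"
  shows "course_of_values val_step (prod_encode (k, a)) (sterm_encode t) = sterm_val k a t"
  using assms
proof (induction rule: sigma_term_induct)
  case (Var b)
  then show ?case by (subst val_step_unfold) simp
next
  case (mult s t)
  have *: "sterm_encode s < sterm_encode (App 0 [s, t])" "sterm_encode t < sterm_encode (App 0 [s, t])"
    using sterm_encode_App2[of s t 0] by linarith+
  have "prod_decode (sterm_encode (App 0 [s, t])) = (1, list_encode [sterm_encode s, sterm_encode t])"
    by simp
  then show ?case
    using mult history_lookup[OF *(1)] history_lookup[OF *(2)]
    by (subst val_step_unfold) (simp add: Let_def del: sterm_encode.simps list_encode.simps)
next
  case (inv t)
  have *: "sterm_encode t < sterm_encode (App 1 [t])"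
    using sterm_encode_App1[of 1 t] by linarith
  have "prod_decode (sterm_encode (App 1 [t])) = (2, list_encode [sterm_encode t])"
    by (simp add: numeral_2_eq_2)
  then show ?case
    using inv history_lookup[OF *]
    by (subst val_step_unfold) (simp add: Let_def del: sterm_encode.simps list_encode.simps)
next
  case (pow q t)
  have q: "2 \<le> q" using finite_primesD(2)[OF pow(1)] .
  have *: "sterm_encode t < sterm_encode (App q [t])"
    using sterm_encode_App1[of q t] by linarith
  have "prod_decode (sterm_encode (App q [t])) = (Suc q, list_encode [sterm_encode t])"
    by simp
  then show ?case
    using pow q history_lookup[OF *]
    by (subst val_step_unfold) (simp add: Let_def del: sterm_encode.simps list_encode.simps)
qed

text \<open>The sum of the two codes bounds both of them, so one sufficient modulus is computed from
  it and the terms are compared letter by letter modulo that number.\<close>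

lemma decidable_word_problem_Ab:
  assumes \<pi>: "recursive_supernatural \<pi>" and A: "finite A"
  shows "decidable_word_problem (sigma_pi \<pi>) (Ab \<pi>) A"
proof -
  obtain N where N: "computable N" "\<And>n. sufficient \<pi> n (N n)" using computable_sufficient[OF \<pi>] by blast
  let ?v = "\<lambda>k a c. course_of_values val_step (prod_encode (k, a)) c"
  define f where "f m = (of_bool (\<forall>a<Suc (pfst m + psnd m).
    ?v (N (pfst m + psnd m)) a (pfst m) mod N (pfst m + psnd m) = ?v (N (pfst m + psnd m)) a (psnd m) mod N (pfst m + psnd m)) :: nat)" for m
  have "computable f" unfolding f_def by (intro computable_intros computable_val computable_comp[OF N(1)])
  moreover have "f (prod_encode (sterm_encode s, sterm_encode t)) =
      (if sterm_eval (sigma_pi \<pi>) (Ab \<pi>) A s = sterm_eval (sigma_pi \<pi>) (Ab \<pi>) A t then 1 else 0)"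
    if s: "sterm_over (sigma_pi \<pi>) A s" and t: "sterm_over (sigma_pi \<pi>) A t" for s t
  proof -
    let ?e = "sterm_eval (sigma_pi \<pi>) Fin_Sgrp A"
    let ?n = "sterm_encode s + sterm_encode t"
    have es: "?e s \<in> pro_carrier Fin_Sgrp A" and et: "?e t \<in> pro_carrier Fin_Sgrp A"
      using s t by (auto intro: eval_in)
    have Nd: "nat_dvd (N ?n) \<pi>" using N(2) by (simp add: sufficient_def)
    note N0 = nat_dvd_pos[OF Nd]
    have "sterm_eval (sigma_pi \<pi>) (Ab \<pi>) A s = sterm_eval (sigma_pi \<pi>) (Ab \<pi>) A t
        \<longleftrightarrow> (\<forall>i\<in>pro_index (Ab \<pi>) A. ?e s i = ?e t i)"
      using eval_restrict[OF Ab_Fin _ s] eval_restrict[OF Ab_Fin _ t]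
        pro_eqI[OF eval_in[OF Ab_Fin s] eval_in[OF Ab_Fin t]] by metis
    also have "\<dots> \<longleftrightarrow> (\<forall>K. nat_dvd K \<pi> \<longrightarrow> (\<forall>a\<in>A. coef K A (?e s) a = coef K A (?e t) a))"
      using satisfies_Ab_iff[OF A es et] satisfies_iff[OF Ab_Fin es et] by blast
    also have "\<dots> \<longleftrightarrow> (\<forall>a\<in>A. coef (N ?n) A (?e s) a = coef (N ?n) A (?e t) a)"
      using sufficient_coef_eq[OF N(2) s _ t, of ?n] Nd by auto
    also have "\<dots> \<longleftrightarrow> (\<forall>a\<in>A. sterm_val (N ?n) a s mod N ?n = sterm_val (N ?n) a t mod N ?n)"
      using coef_sterm_val[OF s N0] coef_sterm_val[OF t N0] by auto
    also have "\<dots> \<longleftrightarrow> (\<forall>a<Suc ?n. sterm_val (N ?n) a s mod N ?n = sterm_val (N ?n) a t mod N ?n)"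
    proof -
      have "sterm_val (N ?n) a s = 0" "sterm_val (N ?n) a t = 0" if "a \<notin> A \<or> ?n < a" for a
        using that by (auto intro!: sterm_val_0[OF s] sterm_val_0[OF t])
      then show ?thesis by (metis not_less_eq)
    qed
    finally show ?thesis unfolding f_def using val_step_term[OF s] val_step_term[OF t] by simp
  qed
  ultimately show ?thesis unfolding decidable_word_problem_def computable_def by auto
qed

subsection \<open>Enumerability\<close>

lemma symbols_enumerable:
  assumes "recursive_supernatural \<pi>"
  shows "recursively_enumerable (symbols (sigma_pi \<pi>))"
proof (rule recursively_enumerableI)
  \<comment> \<open>The default value 0 is harmless because 0 is itself a symbol.\<close>
  let ?f = "\<lambda>x. if x = 1 \<or> prime_code \<pi> x \<noteq> 0 then x else 0"
  show "computable ?f" by (intro computable_intros computable_prime_code assms)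
  show "symbols (sigma_pi \<pi>) = range ?f"
    by (auto simp: finite_primes_iff image_iff)
qed

lemma implicit_signature_sigma_pi:
  assumes "recursive_supernatural \<pi>"
  shows "implicit_signature (sigma_pi \<pi>)"
  unfolding implicit_signature_def
proof (intro conjI ballI)
  fix f assume "f \<in> symbols (sigma_pi \<pi>)"
  show "interp (sigma_pi \<pi>) f \<in> carrier (Free_Pro Fin_Sgrp {..<arity (sigma_pi \<pi>) f})"
  proof (cases "f = 0")
    case False
    then show ?thesis using power_limit_spec(1)[OF exponent_seq_convergent[of f]]
      by (simp add: interp_power del: sigma_pi_simps(3))
  qed (use mult_op_in in simp)
qed (use symbols_enumerable[OF assms] in auto)

text \<open>The table is stored row by row. Reduction modulo n makes any number c the code of an
  operation on the n elements.\<close>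

definition table :: "nat \<Rightarrow> nat \<Rightarrow> nat \<Rightarrow> nat \<Rightarrow> nat" where
  "table n c i j = nth_code c (i * n + j) mod n"

definition table_sgrp :: "nat \<Rightarrow> nat \<Rightarrow> nat sgrp" where
  "table_sgrp n c = \<lparr>carrier = {..<n}, smult = table n c\<rparr>"

text \<open>A form of \<open>Ab_iff\<close> with bounded quantifiers only, for an exponent d given
  in advance. The recursion with d - 1 steps computes the d-th power of i.\<close>

definition valid_table :: "supernatural \<Rightarrow> nat \<Rightarrow> nat \<Rightarrow> nat \<Rightarrow> bool" where
  "valid_table \<pi> n d c \<longleftrightarrow> 0 < n \<and> 0 < d \<and>
     (\<forall>p<Suc d. prime_code \<pi> p \<noteq> 0 \<longrightarrow> \<not> p ^ prime_code \<pi> p dvd d) \<and>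
     (\<forall>i<n. \<forall>j<n. table n c i j = table n c j i \<and>
        table n c (rec_nat i (\<lambda>y r. table n c r i) (d - 1)) j = j \<and>
        (\<forall>k<n. table n c (table n c i j) k = table n c i (table n c j k)))"

text \<open>For a finite prime p, the power with exponent \<open>prime_code \<pi> p\<close> is the
  first one that must not divide d. A prime with such a power dividing d is at most d, which bounds
  the quantifier.\<close>

lemma nat_dvd_code_iff:
  "nat_dvd d \<pi> \<longleftrightarrow> 0 < d \<and> (\<forall>p<Suc d. prime_code \<pi> p \<noteq> 0 \<longrightarrow> \<not> p ^ prime_code \<pi> p dvd d)"
proof (cases "0 < d")
  case d: True
  have *: "enat (multiplicity p d) \<le> \<pi> p \<longleftrightarrow> (prime_code \<pi> p \<noteq> 0 \<longrightarrow> \<not> p ^ prime_code \<pi> p dvd d)"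
    if p: "prime p" for p
  proof (cases "\<pi> p")
    case (enat k)
    have "p ^ Suc k dvd d \<longleftrightarrow> Suc k \<le> multiplicity p d"
      using d prime_gt_1_nat[OF p] by (intro power_dvd_iff_le_multiplicity) auto
    then show ?thesis using p enat by (auto simp: prime_code_def simp del: power_Suc)
  qed (use p in \<open>simp add: prime_code_def\<close>)
  have **: "p < Suc d" if "prime_code \<pi> p \<noteq> 0" "p ^ prime_code \<pi> p dvd d" for p
  proof -
    have "p dvd p ^ prime_code \<pi> p" using that(1) by (simp add: dvd_power)
    then show ?thesis using that(2) d by (meson dvd_imp_le dvd_trans less_Suc_eq_le)
  qed
  have "nat_dvd d \<pi> \<longleftrightarrow> (\<forall>p. prime p \<longrightarrow> prime_code \<pi> p \<noteq> 0 \<longrightarrow> \<not> p ^ prime_code \<pi> p dvd d)"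
    using d * by (auto simp: nat_dvd_iff)
  also have "\<dots> \<longleftrightarrow> (\<forall>p<Suc d. prime_code \<pi> p \<noteq> 0 \<longrightarrow> \<not> p ^ prime_code \<pi> p dvd d)"
    using ** by (metis prime_code_def)
  finally show ?thesis using d by simp
qed (simp add: nat_dvd_iff)

lemma valid_table_Ab:
  "valid_table \<pi> n d c \<longleftrightarrow> 0 < n \<and> nat_dvd d \<pi> \<and> sgrp_exponent d (table_sgrp n c) \<and>
     table_sgrp n c \<in> Fin_Sgrp \<and> (\<forall>i<n. \<forall>j<n. table n c i j = table n c j i)"
proof -
  have pow: "spow (table_sgrp n c) i d = rec_nat i (\<lambda>y r. table n c r i) (d - 1)" for i
  proof -
    have "((\<lambda>y. table n c y i) ^^ k) i = rec_nat i (\<lambda>y r. table n c r i) k" for k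
      by (induction k) auto
    then show ?thesis by (simp add: spow_def table_sgrp_def)
  qed
  have "0 < n \<Longrightarrow> table_sgrp n c \<in> Fin_Sgrp \<longleftrightarrow>
     (\<forall>i<n. \<forall>j<n. \<forall>k<n. table n c (table n c i j) k = table n c i (table n c j k))"
    by (auto simp: Fin_Sgrp_def semigroup_on_def table_sgrp_def table_def)
  moreover have "sgrp_exponent d (table_sgrp n c) \<longleftrightarrow>
     (\<forall>i<n. \<forall>j<n. table n c (rec_nat i (\<lambda>y r. table n c r i) (d - 1)) j = j)"
    unfolding sgrp_exponent_def pow by (auto simp: table_sgrp_def)
  ultimately show ?thesis unfolding valid_table_def nat_dvd_code_iff by blast
qed

lemma computable_table [computable_intros]:
  "computable n \<Longrightarrow> computable c \<Longrightarrow> computable i \<Longrightarrow> computable j \<Longrightarrow> computable (\<lambda>m. table (n m) (c m) (i m) (j m))"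
  unfolding table_def by (intro computable_intros)

lemma decidable_valid_table:
  assumes \<pi>: "recursive_supernatural \<pi>"
  shows "decidable (\<lambda>m. valid_table \<pi> (pfst m) (pfst (psnd m)) (psnd (psnd m)))"
  unfolding valid_table_def by (intro computable_intros computable_prime_code \<pi>)

lemma exists_table:
  assumes "\<And>i j. i < n \<Longrightarrow> j < n \<Longrightarrow> f i j < (n::nat)"
  shows "\<exists>c. \<forall>i<n. \<forall>j<n. table n c i j = f i j"
proof -
  let ?l = "map (\<lambda>k. f (k div n) (k mod n)) [0..<n * n]"
  have "table n (list_encode ?l) i j = f i j" if "i < n" "j < n" for i j
  proof -
    have "i * n + j < i * n + n" using that by simp
    also have "\<dots> = Suc i * n" by simp
    also have "\<dots> \<le> n * n" using that by (intro mult_right_mono) auto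
    finally have "i * n + j < length ?l" by simp
    then show ?thesis using that assms[OF that] by (simp add: table_def)
  qed
  then show ?thesis by blast
qed

lemma sgrp_encode_cong:
  assumes "carrier S = {..<n}" "carrier T = {..<n}" "\<And>i j. i < n \<Longrightarrow> j < n \<Longrightarrow> smult S i j = smult T i j"
  shows "sgrp_encode S = sgrp_encode T"
  unfolding sgrp_encode_def Let_def using assms
  by (intro arg_cong[of _ _ list_encode] map_cong) auto

text \<open>The enumeration runs through all triples of a size n, an exponent d and a table c.
  Carrying d along makes membership of the triple decidable.\<close>

lemma re_class_Ab:
  assumes \<pi>: "recursive_supernatural \<pi>"
  shows "re_class (Ab \<pi>)"
proof -
  define W where "W = {S \<in> Ab \<pi>. carrier S = {..<card (carrier S)}}"
  have iso: "\<exists>T\<in>W. sgrp_iso S T" if S: "S \<in> Ab \<pi>" for S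
  proof -
    have SF: "S \<in> Fin_Sgrp" "semigroup_on S" "finite (carrier S)"
      using S Ab_Fin by (auto simp: Fin_Sgrp_def)
    let ?n = "card (carrier S)"
    obtain h where h: "bij_betw h (carrier S) {..<?n}"
      using ex_bij_betw_finite_nat[OF SF(3)] by (auto simp: atLeast0LessThan)
    define g where "g = the_inv_into (carrier S) h"
    have g: "g i \<in> carrier S" "h (g i) = i" if "i < ?n" for i
      using h that unfolding g_def bij_betw_def
      by (auto intro!: the_inv_into_into f_the_inv_into_f)
    have gh: "g (h x) = x" if "x \<in> carrier S" for x
      using h that unfolding g_def bij_betw_def by (simp add: the_inv_into_f_f)
    have hx: "h x < ?n" if "x \<in> carrier S" for x using h that by (auto simp: bij_betw_def)
    \<comment> \<open>The multiplication is transported along the bijection h; T belongs to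
      \<open>Ab \<pi>\<close> as a homomorphic image of S.\<close>
    define T where "T = \<lparr>carrier = {..<?n}, smult = \<lambda>i j. h (smult S (g i) (g j))\<rparr>"
    have mult: "smult S (g i) (g j) \<in> carrier S" if "i < ?n" "j < ?n" for i j
      using g that semigroup_onD(2)[OF SF(2)] by blast
    have "?n \<noteq> 0" using SF semigroup_onD(1)[OF SF(2)] by simp
    then have TF: "T \<in> Fin_Sgrp"
      using mult hx gh g semigroup_onD(3)[OF SF(2)]
      by (auto simp: T_def Fin_Sgrp_def semigroup_on_def)
    have hT: "h \<in> shom S T" using gh hx by (auto simp: shom_def T_def)
    moreover have "h ` carrier S = carrier T" using h by (simp add: T_def bij_betw_def)
    ultimately have "T \<in> Ab \<pi>" using pseudovariety_Ab[of \<pi>] S TF unfolding pseudovariety_def by blast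
    then have "T \<in> W" by (simp add: W_def T_def)
    moreover have "sgrp_iso S T"
      unfolding sgrp_iso_def by (rule bexI[OF _ hT]) (use h in \<open>simp add: T_def\<close>)
    ultimately show ?thesis by blast
  qed
  define code where "code n c = list_encode (map (\<lambda>i. list_encode (map (\<lambda>j. table n c i j) [0..<n])) [0..<n])" for n c
  have code: "code n c = sgrp_encode (table_sgrp n c)" for n c
    by (simp add: code_def sgrp_encode_def table_sgrp_def)
  have table_W: "table_sgrp n c \<in> W" if "valid_table \<pi> n d c" for n d c
    using that unfolding valid_table_Ab W_def Ab_iff by (auto simp: table_sgrp_def)
  have W_table: "\<exists>n d c. valid_table \<pi> n d c \<and> sgrp_encode S = code n c" if S: "S \<in> W" for S
  proof -
    obtain n where car: "carrier S = {..<n}" using S unfolding W_def by blast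
    from S obtain d where d: "nat_dvd d \<pi>" "sgrp_exponent d S"
      and comm: "\<And>x y. x \<in> carrier S \<Longrightarrow> y \<in> carrier S \<Longrightarrow> smult S x y = smult S y x"
      and SF: "S \<in> Fin_Sgrp"
      unfolding Ab_iff W_def by blast
    have cl: "smult S i j < n" if "i < n" "j < n" for i j
      using semigroup_onD(2)[OF Fin_SgrpD(1)[OF SF], of i j] that car by (metis lessThan_iff)
    obtain c where c: "\<And>i j. i < n \<Longrightarrow> j < n \<Longrightarrow> table n c i j = smult S i j"
      using exists_table[of n "smult S"] cl by blast
    let ?T = "table_sgrp n c"
    have n0: "0 < n" using semigroup_onD(1)[OF Fin_SgrpD(1)[OF SF]] car by auto
    have TF: "?T \<in> Fin_Sgrp"
      using n0 cl c semigroup_onD(3)[OF Fin_SgrpD(1)[OF SF]] car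
      by (auto simp: Fin_Sgrp_def semigroup_on_def table_sgrp_def)
    have hom: "(\<lambda>x. x) \<in> shom S ?T"
      unfolding shom_def table_sgrp_def using car c by auto
    have "smult ?T (spow ?T i d) j = j" if "i < n" "j < n" for i j
    proof -
      have iS: "i \<in> carrier S" "j \<in> carrier S" using that car by auto
      have p: "spow ?T i d = spow S i d" using spow_hom[OF hom Fin_SgrpD(1)[OF SF] iS(1)] by simp
      have "spow S i d \<in> carrier S" by (intro spow_closed Fin_SgrpD SF iS)
      then have "spow S i d < n" using car by auto
      then show ?thesis using d(2) iS c[OF _ that(2), of "spow S i d"] p
        by (simp add: sgrp_exponent_def table_sgrp_def)
    qed
    then have "sgrp_exponent d ?T" by (simp add: sgrp_exponent_def table_sgrp_def)
    moreover have "table n c i j = table n c j i" if "i < n" "j < n" for i j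
      using c that comm[of i j] car by (metis lessThan_iff)
    ultimately have "valid_table \<pi> n d c" using n0 d TF by (simp add: valid_table_Ab)
    moreover have "sgrp_encode S = sgrp_encode ?T"
      by (rule sgrp_encode_cong[OF car]) (use c in \<open>auto simp: table_sgrp_def\<close>)
    ultimately show ?thesis using code by auto
  qed
  \<comment> \<open>The one-element semigroup is what the enumeration outputs for invalid
    triples.\<close>
  have triv: "valid_table \<pi> 1 1 0"
    by (auto simp: valid_table_def table_def prime_code_def prime_gt_1_nat dest: prime_gt_1_nat)
  let ?f = "\<lambda>m. if valid_table \<pi> (pfst m) (pfst (psnd m)) (psnd (psnd m)) then code (pfst m) (psnd (psnd m)) else code 1 0"
  have "sgrp_encode ` W = range ?f"
  proof (intro subset_antisym image_subsetI)
    fix S assume "S \<in> W"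
    then obtain n d c where "valid_table \<pi> n d c" "sgrp_encode S = code n c" using W_table by blast
    then show "sgrp_encode S \<in> range ?f"
      by (intro range_eqI[of _ _ "prod_encode (n, prod_encode (d, c))"]) simp
  next
    fix m show "?f m \<in> sgrp_encode ` W"
      using table_W triv by (auto simp: code)
  qed
  moreover have "computable ?f"
    unfolding code_def by (intro computable_intros computable_list_encode_map decidable_valid_table \<pi>)
  ultimately have "recursively_enumerable (sgrp_encode ` W)" by (intro recursively_enumerableI)
  then show ?thesis unfolding re_class_def using iso by (intro exI[of _ W]) (auto simp: W_def)
qed

subsection \<open>Integer linear systems\<close>

definition finite_part :: "supernatural \<Rightarrow> nat \<Rightarrow> bool" where
  "finite_part \<pi> s \<longleftrightarrow> 0 < s \<and> (\<forall>p. prime p \<longrightarrow> p dvd s \<longrightarrow> p \<in> finite_primes \<pi>)"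

definition infinite_part :: "supernatural \<Rightarrow> nat \<Rightarrow> bool" where
  "infinite_part \<pi> t \<longleftrightarrow> 0 < t \<and> (\<forall>p. prime p \<longrightarrow> p dvd t \<longrightarrow> \<pi> p = \<infinity>)"

lemma finite_part_1 [simp]: "finite_part \<pi> (Suc 0)"
  by (auto simp: finite_part_def)

lemma finite_part_mult: "finite_part \<pi> s \<Longrightarrow> finite_part \<pi> t \<Longrightarrow> finite_part \<pi> (s * t)"
  by (auto simp: finite_part_def prime_dvd_mult_iff)

lemma infinite_part_1 [simp]: "infinite_part \<pi> (Suc 0)"
  by (auto simp: infinite_part_def)

lemma infinite_part_mult: "infinite_part \<pi> s \<Longrightarrow> infinite_part \<pi> t \<Longrightarrow> infinite_part \<pi> (s * t)"
  by (auto simp: infinite_part_def prime_dvd_mult_iff)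

lemma parts_decompose:
  assumes "0 < (d::nat)"
  shows "\<exists>s t. finite_part \<pi> s \<and> infinite_part \<pi> t \<and> d = s * t"
  using assms
proof (induction d rule: less_induct)
  case (less d)
  show ?case
  proof (cases "d = 1")
    case True
    then show ?thesis by (intro exI[of _ 1]) auto
  next
    case False
    then obtain p where p: "prime p" "p dvd d" using prime_factor_nat by blast
    then obtain d' where d': "d = p * d'" by blast
    have "d' < d" "0 < d'" using less.prems p(1) d' prime_gt_1_nat[OF p(1)] by auto
    from less.IH[OF this] obtain s t where st: "finite_part \<pi> s" "infinite_part \<pi> t" "d' = s * t"
      by blast
    show ?thesis
    proof (cases "\<pi> p = \<infinity>")
      case True
      then have "infinite_part \<pi> p" using p(1) by (auto simp: infinite_part_def prime_gt_0_nat dest: primes_dvd_imp_eq)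
      then have "infinite_part \<pi> (p * t)" using st by (intro infinite_part_mult)
      then show ?thesis using st d' by (intro exI[of _ s] exI[of _ "p * t"]) auto
    next
      case False
      then have "finite_part \<pi> p" using p(1)
        by (auto simp: finite_part_def finite_primes_def prime_gt_0_nat dest: primes_dvd_imp_eq)
      then have "finite_part \<pi> (p * s)" using st by (intro finite_part_mult)
      then show ?thesis using st d' by (intro exI[of _ "p * s"] exI[of _ t]) auto
    qed
  qed
qed

definition int_subgroup :: "('i \<Rightarrow> int) set \<Rightarrow> bool" where
  "int_subgroup H \<longleftrightarrow> (\<lambda>_. 0) \<in> H \<and> (\<forall>x\<in>H. \<forall>y\<in>H. (\<lambda>j. x j - y j) \<in> H)"

lemma int_subgroup_add:
  assumes "int_subgroup H" "x \<in> H" "y \<in> H"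
  shows "(\<lambda>j. x j + y j) \<in> H"
proof -
  have sub: "\<And>x y. x \<in> H \<Longrightarrow> y \<in> H \<Longrightarrow> (\<lambda>j. x j - y j) \<in> H" and "(\<lambda>_. 0) \<in> H"
    using assms(1) by (simp_all add: int_subgroup_def)
  from sub[OF assms(2) sub[OF this(2) assms(3)]] have "(\<lambda>j. x j - (0 - y j)) \<in> H" .
  then show ?thesis by simp
qed

lemma int_subgroup_mult:
  assumes "int_subgroup H" "x \<in> H"
  shows "(\<lambda>j. k * x j) \<in> H"
proof (induction k rule: int_induct[where k = 0])
  case base
  then show ?case using assms by (simp add: int_subgroup_def)
next
  case (step1 i)
  then show ?case using int_subgroup_add[OF assms(1) step1(2) assms(2)] by (simp add: algebra_simps)
next
  case (step2 i)
  have "(\<lambda>j. i * x j - x j) \<in> H"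
    using assms step2(2) unfolding int_subgroup_def by (elim conjE) (drule (1) bspec, drule (1) bspec)
  then show ?case by (simp add: algebra_simps)
qed

text \<open>One coordinate \<open>j\<close> is eliminated at a time by means of a generator \<open>d = s * t\<close> of the image of
  \<open>H\<close> in it: the part \<open>t\<close> at the infinite primes divides \<open>b j\<close>, and the part \<open>s\<close> is absorbed
  into the multiplier.\<close>

lemma integral_solution:
  fixes b :: "'i \<Rightarrow> int"
  assumes "finite J" "int_subgroup H"
    and NN: "1 \<in> NN" "0 \<notin> NN" "\<And>N t. N \<in> NN \<Longrightarrow> infinite_part \<pi> t \<Longrightarrow> N * t \<in> NN"
    and sol: "\<And>N. N \<in> NN \<Longrightarrow> \<exists>h\<in>H. \<forall>j\<in>J. [b j = h j] (mod int N)"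
  shows "\<exists>s h. finite_part \<pi> s \<and> h \<in> H \<and> (\<forall>N\<in>NN. \<forall>j\<in>J. [int s * b j = h j] (mod int N))"
  using assms(1,2) sol
proof (induction J arbitrary: H b rule: finite_induct)
  case empty
  then show ?case by (intro exI[of _ 1]) (auto simp: int_subgroup_def)
next
  case (insert j J H b)
  note H = insert.prems(1) and sol = insert.prems(2)
  show ?case
  \<comment> \<open>Without a pivot, \<open>b j\<close> is 0 modulo every admissible N, so the
    coordinate j is satisfied by any multiplier.\<close>
  proof (cases "\<forall>h\<in>H. h j = 0")
    case True
    have "\<exists>h\<in>H. \<forall>j\<in>J. [b j = h j] (mod int N)" if "N \<in> NN" for N using sol[OF that] by auto
    from insert.IH[OF H this] obtain s h where sh: "finite_part \<pi> s" "h \<in> H"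
      "\<And>N j. N \<in> NN \<Longrightarrow> j \<in> J \<Longrightarrow> [int s * b j = h j] (mod int N)" by blast
    have "[int s * b j = h j] (mod int N)" if "N \<in> NN" for N
    proof -
      have "[b j = 0] (mod int N)" using sol[OF that] True by auto
      then have "[int s * b j = int s * 0] (mod int N)" by (rule cong_scalar_left)
      then show ?thesis using bspec[OF True sh(2)] by simp
    qed
    then show ?thesis using sh by blast
  next
    case False
    then obtain h0 where h0: "h0 \<in> H" "h0 j \<noteq> 0" by blast
    define Q where "Q d \<longleftrightarrow> 0 < d \<and> (\<exists>h\<in>H. h j = int d)" for d :: nat
    have "\<exists>h\<in>H. h j = int (nat \<bar>h0 j\<bar>)"
    proof (cases "0 < h0 j")
      case True
      then show ?thesis using h0 by (intro bexI[of _ h0]) auto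
    next
      case False
      then show ?thesis using int_subgroup_mult[OF H h0(1), of "-1"]
        by (intro bexI[of _ "\<lambda>j. -1 * h0 j"]) auto
    qed
    then have "Q (nat \<bar>h0 j\<bar>)" using h0(2) by (simp add: Q_def)
    then have "\<exists>d. Q d" ..
    define d where "d = (LEAST d. Q d)"
    have "Q d" unfolding d_def by (rule LeastI_ex) fact
    then obtain h1 where d: "0 < d" and h1: "h1 \<in> H" "h1 j = int d" unfolding Q_def by blast
    have dvd: "int d dvd h j" if "h \<in> H" for h
    proof (rule ccontr)
      assume "\<not> int d dvd h j"
      then have "h j mod int d \<noteq> 0" unfolding dvd_eq_mod_eq_0 .
      then have r: "0 < h j mod int d" "h j mod int d < int d"
        using d pos_mod_bound[of "int d" "h j"] pos_mod_sign[of "int d" "h j"] by linarith+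
      have "(\<lambda>i. h i + (- (h j div int d)) * h1 i) \<in> H"
        by (intro int_subgroup_add int_subgroup_mult H that h1)
      moreover have "h j + (- (h j div int d)) * h1 j = int (nat (h j mod int d))"
        using r by (simp add: h1 minus_div_mult_eq_mod)
      ultimately have "Q (nat (h j mod int d))" using r unfolding Q_def by auto
      then have "d \<le> nat (h j mod int d)" unfolding d_def by (rule Least_le)
      then show False using r by linarith
    qed
    obtain s t where st: "finite_part \<pi> s" "infinite_part \<pi> t" "d = s * t"
      using parts_decompose[OF d] by blast
    have t0: "0 < t" using st by (simp add: infinite_part_def)
    \<comment> \<open>The number t is itself an admissible modulus. As t divides d, every
      \<open>h j\<close> vanishes modulo t, and so does \<open>b j\<close>.\<close>
    have tN: "t \<in> NN" using NN(3)[OF NN(1) st(2)] by simp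
    have "int t dvd b j"
    proof -
      obtain h where h: "h \<in> H" "[b j = h j] (mod int t)" using sol[OF tN] by auto
      have "int t dvd h j" using dvd[OF h(1)] st(3) by (metis dvd_mult_right of_nat_mult)
      then show ?thesis using h(2) by (simp add: cong_dvd_iff)
    qed
    then obtain c where c: "b j = int t * c" ..
    \<comment> \<open>Since \<open>int s * b j = int d * c\<close>, subtracting c times the pivot
      vector \<open>h1\<close> clears the coordinate j and leaves a problem for the subgroup
      \<open>H'\<close>.\<close>
    define b' where "b' i = int s * b i - c * h1 i" for i
    define H' where "H' = {h \<in> H. h j = 0}"
    have H': "int_subgroup H'" using H by (auto simp: H'_def int_subgroup_def)
    have "\<exists>h\<in>H'. \<forall>i\<in>J. [b' i = h i] (mod int N)" if N: "N \<in> NN" for N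
    proof -
      \<comment> \<open>Solving modulo N t instead of N compensates for the later division by t,
        which yields c = s k modulo N.\<close>
      obtain h where h: "h \<in> H" "\<And>i. i \<in> insert j J \<Longrightarrow> [b i = h i] (mod int (N * t))"
        using sol[OF NN(3)[OF N st(2)]] by blast
      obtain k where k: "h j = int d * k" using dvd[OF h(1)] ..
      have "int (N * t) dvd int t * c - int d * k"
        using h(2)[of j] c k by (simp add: cong_iff_dvd_diff)
      then have "int t * int N dvd int t * (c - int s * k)"
        by (simp add: st(3) algebra_simps)
      then have Nk: "int N dvd c - int s * k" using t0 by simp
      let ?h = "\<lambda>i. int s * h i + (- (int s * k)) * h1 i"
      have "?h \<in> H" by (intro int_subgroup_add int_subgroup_mult H h h1)
      moreover have "?h j = 0" by (simp add: k h1)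
      moreover have "[b' i = ?h i] (mod int N)" if "i \<in> J" for i
      proof -
        have "int N dvd b i - h i"
          using h(2)[of i] that by (auto simp: cong_iff_dvd_diff intro: dvd_mult_left)
        from dvd_diff[OF dvd_mult[OF this] dvd_mult2[OF Nk]]
        have "int N dvd int s * (b i - h i) - (c - int s * k) * h1 i" .
        moreover have "b' i - ?h i = int s * (b i - h i) - (c - int s * k) * h1 i"
          by (simp add: b'_def algebra_simps)
        ultimately show ?thesis by (simp add: cong_iff_dvd_diff)
      qed
      ultimately show ?thesis unfolding H'_def by (intro bexI[of _ ?h]) auto
    qed
    from insert.IH[OF H' this] obtain s' h' where sh: "finite_part \<pi> s'" "h' \<in> H'"
      "\<And>N i. N \<in> NN \<Longrightarrow> i \<in> J \<Longrightarrow> [int s' * b' i = h' i] (mod int N)" by blast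
    \<comment> \<open>The multiple of the pivot that was subtracted in \<open>b'\<close>, scaled by
      the multiplier s' of the smaller problem, is added again.\<close>
    let ?h = "\<lambda>i. h' i + (int s' * c) * h1 i"
    have "?h \<in> H" using sh(2) by (intro int_subgroup_add int_subgroup_mult H h1) (simp add: H'_def)
    moreover have "[int (s' * s) * b i = ?h i] (mod int N)" if "N \<in> NN" "i \<in> insert j J" for N i
    proof (cases "i = j")
      case True
      have "int (s' * s) * b j = ?h j" using sh(2) by (simp add: c h1 st(3) H'_def)
      then show ?thesis using True by simp
    next
      case False
      then have "[int s' * b' i + int s' * c * h1 i = h' i + int s' * c * h1 i] (mod int N)"
        using that by (intro cong_add sh(3) cong_refl) auto
      then show ?thesis by (simp add: b'_def algebra_simps)
    qed
    ultimately show ?thesis using finite_part_mult[OF sh(1) st(1)] by blast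
  qed
qed

subsection \<open>Exponents\<close>

abbreviation sigma_elems :: "supernatural \<Rightarrow> nat set \<Rightarrow> pro_elem set" where
  "sigma_elems \<pi> A \<equiv> Omega_sig (sigma_pi \<pi>) Fin_Sgrp A"

text \<open>\<open>y\<close> is \<open>x\<^sup>e\<close> for the implicit operation with exponent \<open>e N\<close> modulo \<open>N\<close>.\<close>

definition is_power :: "nat set \<Rightarrow> (nat \<Rightarrow> int) \<Rightarrow> pro_elem \<Rightarrow> pro_elem \<Rightarrow> bool" where
  "is_power A e x y \<longleftrightarrow> (\<forall>i\<in>pro_index Fin_Sgrp A. \<exists>n>0. y i = spow (fst i) (x i) n) \<and>
     (\<forall>N>0. \<forall>a. [int (coef N A y a) = e N * int (coef N A x a)] (mod int N))"

lemma is_powerD: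
  assumes "is_power A e x y"
  shows "i \<in> pro_index Fin_Sgrp A \<Longrightarrow> \<exists>n>0. y i = spow (fst i) (x i) n"
    "0 < N \<Longrightarrow> [int (coef N A y a) = e N * int (coef N A x a)] (mod int N)"
  using assms by (simp_all add: is_power_def)

lemma is_powerI:
  assumes "\<And>i. i \<in> pro_index Fin_Sgrp A \<Longrightarrow> \<exists>n>0. y i = spow (fst i) (x i) n"
    "\<And>N a. 0 < N \<Longrightarrow> [int (coef N A y a) = e N * int (coef N A x a)] (mod int N)"
  shows "is_power A e x y"
  using assms by (simp add: is_power_def)

text \<open>These exponents are closed under pointwise sums, products and negatives: two powers of
  one element multiply to a sum, and iterated powers give a product. They replace the integers as
  scalars.\<close>

definition is_exponent :: "supernatural \<Rightarrow> nat set \<Rightarrow> (nat \<Rightarrow> int) \<Rightarrow> bool" where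
  "is_exponent \<pi> A e \<longleftrightarrow> (\<forall>x\<in>sigma_elems \<pi> A. \<exists>y\<in>sigma_elems \<pi> A. is_power A e x y)"

lemma is_exponentD: "is_exponent \<pi> A e \<Longrightarrow> x \<in> sigma_elems \<pi> A \<Longrightarrow> \<exists>y\<in>sigma_elems \<pi> A. is_power A e x y"
  by (simp add: is_exponent_def)

lemma is_exponentI: "(\<And>x. x \<in> sigma_elems \<pi> A \<Longrightarrow> \<exists>y\<in>sigma_elems \<pi> A. is_power A e x y) \<Longrightarrow> is_exponent \<pi> A e"
  by (simp add: is_exponent_def)

lemma sigma_elems_apply:
  assumes "x \<in> sigma_elems \<pi> A" "i \<in> pro_index Fin_Sgrp A"
  shows "semigroup_on (fst i)" "x i \<in> carrier (fst i)"
  using pro_carrierD(1)[OF Omega_in[OF order_refl assms(1)] assms(2)] pro_indexD(1)[OF assms(2)]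
  by (auto dest: Fin_SgrpD)

lemma is_exponent_1: "is_exponent \<pi> A (\<lambda>N. 1)"
  by (rule is_exponentI) (auto intro!: bexI is_powerI exI[of _ "Suc 0"])

lemma is_exponent_cong:
  assumes "is_exponent \<pi> A e" "\<And>N. 0 < N \<Longrightarrow> [e N = e' N] (mod int N)"
  shows "is_exponent \<pi> A e'"
proof (rule is_exponentI)
  fix x assume "x \<in> sigma_elems \<pi> A"
  with assms(1) obtain y where y: "y \<in> sigma_elems \<pi> A" "is_power A e x y" using is_exponentD by blast
  have "is_power A e' x y"
  proof (rule is_powerI)
    fix N a assume N: "0 < (N::nat)"
    show "[int (coef N A y a) = e' N * int (coef N A x a)] (mod int N)"
      using is_powerD(2)[OF y(2) N] cong_mult[OF assms(2)[OF N] cong_refl] by (rule cong_trans)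
  qed (rule is_powerD(1)[OF y(2)])
  then show "\<exists>y\<in>sigma_elems \<pi> A. is_power A e' x y" using y(1) by blast
qed

lemma is_exponent_seq:
  assumes "f = 1 \<or> f \<in> finite_primes \<pi>"
  shows "is_exponent \<pi> A (\<lambda>N. int (exponent_seq f N))"
proof (rule is_exponentI)
  fix x assume "x \<in> sigma_elems \<pi> A"
  from Omega_coef_power[OF this assms] obtain y where y: "y \<in> sigma_elems \<pi> A"
    "\<forall>i\<in>pro_index Fin_Sgrp A. \<exists>n>0. y i = spow (fst i) (x i) n"
    "\<forall>N>0. \<forall>a. coef N A y a = exponent_seq f N * coef N A x a mod N"
    by (elim bexE conjE)
  have "is_power A (\<lambda>N. int (exponent_seq f N)) x y"
    using y(2,3) by (intro is_powerI) (simp_all add: cong_def zmod_int)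
  then show "\<exists>y\<in>sigma_elems \<pi> A. is_power A (\<lambda>N. int (exponent_seq f N)) x y" using y(1) by blast
qed

lemma is_exponent_minus_1: "is_exponent \<pi> A (\<lambda>N. -1)"
  using is_exponent_seq[of 1] exponent_seq_1 by (rule is_exponent_cong) auto

lemma coef_smult_int:
  "0 < N \<Longrightarrow> [int (coef N A (smult (Free_Pro Fin_Sgrp A) v w) a)
    = int (coef N A v a) + int (coef N A w a)] (mod int N)"
  by (simp only: coef_smult) (simp add: cong_def zmod_int)

lemma is_exponent_add:
  assumes "is_exponent \<pi> A e" "is_exponent \<pi> A e'"
  shows "is_exponent \<pi> A (\<lambda>N. e N + e' N)"
proof (rule is_exponentI)
  fix x assume x: "x \<in> sigma_elems \<pi> A"
  obtain y where y: "y \<in> sigma_elems \<pi> A" "is_power A e x y" using is_exponentD[OF assms(1) x] by blast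
  obtain y' where y': "y' \<in> sigma_elems \<pi> A" "is_power A e' x y'" using is_exponentD[OF assms(2) x] by blast
  let ?y = "smult (Free_Pro Fin_Sgrp A) y y'"
  have "is_power A (\<lambda>N. e N + e' N) x ?y"
  proof (rule is_powerI)
    fix i assume i: "i \<in> pro_index Fin_Sgrp A"
    obtain m n where "0 < m" "y i = spow (fst i) (x i) m" "0 < n" "y' i = spow (fst i) (x i) n"
      using is_powerD(1)[OF y(2) i] is_powerD(1)[OF y'(2) i] by blast
    then show "\<exists>n>0. ?y i = spow (fst i) (x i) n"
      using i spow_add[OF sigma_elems_apply[OF x i], of m n] by (intro exI[of _ "m + n"]) simp
  next
    fix N a assume N: "0 < (N::nat)"
    show "[int (coef N A ?y a) = (e N + e' N) * int (coef N A x a)] (mod int N)"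
      using cong_trans[OF coef_smult_int[OF N] cong_add[OF is_powerD(2)[OF y(2) N] is_powerD(2)[OF y'(2) N]]]
      by (simp only: distrib_right)
  qed
  then show "\<exists>y\<in>sigma_elems \<pi> A. is_power A (\<lambda>N. e N + e' N) x y" using Omega_smult[OF y(1) y'(1)] by blast
qed

lemma is_exponent_mult:
  assumes "is_exponent \<pi> A e" "is_exponent \<pi> A e'"
  shows "is_exponent \<pi> A (\<lambda>N. e N * e' N)"
proof (rule is_exponentI)
  fix x assume x: "x \<in> sigma_elems \<pi> A"
  obtain y where y: "y \<in> sigma_elems \<pi> A" "is_power A e' x y" using is_exponentD[OF assms(2) x] by blast
  obtain z where z: "z \<in> sigma_elems \<pi> A" "is_power A e y z" using is_exponentD[OF assms(1) y(1)] by blast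
  have "is_power A (\<lambda>N. e N * e' N) x z"
  proof (rule is_powerI)
    fix i assume i: "i \<in> pro_index Fin_Sgrp A"
    obtain m n where "0 < m" "y i = spow (fst i) (x i) m" "0 < n" "z i = spow (fst i) (y i) n"
      using is_powerD(1)[OF y(2) i] is_powerD(1)[OF z(2) i] by blast
    then show "\<exists>n>0. z i = spow (fst i) (x i) n"
      using i spow_mult[OF sigma_elems_apply[OF x i], of m n] by (intro exI[of _ "m * n"]) simp
  next
    fix N a assume N: "0 < (N::nat)"
    show "[int (coef N A z a) = (e N * e' N) * int (coef N A x a)] (mod int N)"
      using cong_trans[OF is_powerD(2)[OF z(2) N] cong_scalar_left[OF is_powerD(2)[OF y(2) N]]]
      by (simp only: mult.assoc)
  qed
  then show "\<exists>y\<in>sigma_elems \<pi> A. is_power A (\<lambda>N. e N * e' N) x y" using z(1) by blast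
qed

lemma is_exponent_uminus: "is_exponent \<pi> A e \<Longrightarrow> is_exponent \<pi> A (\<lambda>N. - e N)"
  using is_exponent_mult[OF is_exponent_minus_1] by simp

text \<open>This is x times its power omega - 1, that is, the idempotent power of x: a positive
  power at each coordinate although all coefficients vanish.\<close>

lemma is_exponent_0: "is_exponent \<pi> A (\<lambda>N. 0)"
  using is_exponent_add[OF is_exponent_1 is_exponent_minus_1] by simp

lemma is_exponent_of_nat: "is_exponent \<pi> A (\<lambda>N. int k)"
proof (induction k)
  case (Suc k)
  then show ?case using is_exponent_add[OF is_exponent_1 Suc] by simp
qed (simp add: is_exponent_0)

lemma is_exponent_prod:
  assumes "finite Q" "\<And>q. q \<in> Q \<Longrightarrow> is_exponent \<pi> A (e q)"
  shows "is_exponent \<pi> A (\<lambda>N. \<Prod>q\<in>Q. e q N)"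
  using assms by (induction Q rule: finite_induct) (auto intro: is_exponent_1 is_exponent_mult)

text \<open>The product of the exponents q^(omega-1) over the prime factors q of s, taken with
  multiplicity.\<close>

lemma inverse_exponent:
  assumes "finite_part \<pi> s"
  shows "\<exists>e. is_exponent \<pi> A e \<and> (\<forall>N>0. coprime N s \<longrightarrow> [int s * e N = 1] (mod int N))"
  using assms
proof (induction s rule: less_induct)
  case (less s)
  show ?case
  proof (cases "s = 1")
    case True
    then show ?thesis using is_exponent_1 by (intro exI[of _ "\<lambda>N. 1"]) auto
  next
    case False
    then obtain p where p: "prime p" "p dvd s" using prime_factor_nat by blast
    then obtain s' where s': "s = p * s'" by blast
    have s0: "0 < s" and pf: "p \<in> finite_primes \<pi>" using less.prems p by (auto simp: finite_part_def)
    have lt: "s' < s" using s0 s' prime_gt_1_nat[OF p(1)] by auto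
    have "finite_part \<pi> s'" using less.prems s' by (auto simp: finite_part_def)
    from less.IH[OF lt this] obtain e where e: "is_exponent \<pi> A e"
      "\<And>N. 0 < N \<Longrightarrow> coprime N s' \<Longrightarrow> [int s' * e N = 1] (mod int N)" by blast
    have "[int s * (int (exponent_seq p N) * e N) = 1] (mod int N)" if N: "0 < N" "coprime N s" for N
    proof -
      have "[p * exponent_seq p N = 1] (mod N)"
        using N s' by (intro exponent_seq_inverse p) (auto simp: coprime_commute)
      then have "[int (p * exponent_seq p N) = int 1] (mod int N)" by (simp only: cong_int_iff)
      from cong_mult[OF this e(2)[OF N(1)]] N s' show ?thesis by (simp add: algebra_simps)
    qed
    moreover have "is_exponent \<pi> A (\<lambda>N. int (exponent_seq p N) * e N)"
      using pf e(1) by (intro is_exponent_mult is_exponent_seq) auto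
    ultimately show ?thesis by blast
  qed
qed

text \<open>R is the product of p to the power \<open>\<pi> p\<close> over the primes dividing D, a
  natural number because \<open>\<pi>\<close> is finite there. That R has no further primes lets the
  idempotent below vanish modulo R.\<close>

lemma exists_full:
  assumes D: "finite_part \<pi> D"
  shows "\<exists>R. full_at D R \<pi> \<and> (\<forall>p. prime p \<longrightarrow> p dvd R \<longrightarrow> p dvd D)"
proof -
  let ?k = "\<lambda>p. THE k. \<pi> p = enat k"
  define R where "R = (\<Prod>p\<in>prime_factors D. p ^ ?k p)"
  have D0: "D \<noteq> 0" using D by (simp add: finite_part_def)
  have k: "\<pi> p = enat (?k p)" if "prime p" "p dvd D" for p
    using D that unfolding finite_part_def finite_primes_def by (cases "\<pi> p") auto
  have mult: "multiplicity p R = (if p dvd D then ?k p else 0)" if p: "prime p" for p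
  proof -
    have "multiplicity p R = (if p \<in> prime_factors D then ?k p else 0)"
      unfolding R_def using p by (intro multiplicity_prod_prime_powers) auto
    then show ?thesis using p D0 by (auto simp: prime_factors_dvd)
  qed
  have R0: "0 < R" unfolding R_def by (intro prod_pos) (auto intro!: prime_gt_0_nat)
  have "nat_dvd R \<pi>"
    unfolding nat_dvd_iff using R0 mult k by (auto simp: zero_enat_def[symmetric])
  moreover have "p dvd D" if "prime p" "p dvd R" for p
  proof (rule ccontr)
    assume "\<not> p dvd D"
    then have "multiplicity p R = 0" using mult[OF that(1)] by simp
    moreover have "0 < multiplicity p R" using that R0 by (simp add: prime_multiplicity_gt_zero_iff)
    ultimately show False by simp
  qed
  ultimately show ?thesis using mult k unfolding full_at_def by (intro exI[of _ R]) auto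
qed

lemma idempotent_exponent:
  assumes D: "finite_part \<pi> D" and R: "0 < R" "\<And>p. prime p \<Longrightarrow> p dvd R \<Longrightarrow> p dvd D"
  shows "\<exists>e. is_exponent \<pi> A e \<and> (\<forall>N>0. coprime N D \<longrightarrow> [e N = 1] (mod int N)) \<and> [e R = 0] (mod int R)"
proof (intro exI conjI allI impI)
  let ?e = "\<lambda>N. \<Prod>q\<in>prime_factors D. int q * int (exponent_seq q N)"
  have D0: "D \<noteq> 0" using D by (simp add: finite_part_def)
  have pf: "q \<in> finite_primes \<pi>" "prime q" "q dvd D" if "q \<in> prime_factors D" for q
    using that D by (auto simp: finite_part_def prime_factors_dvd)
  show "is_exponent \<pi> A ?e"
    using pf by (intro is_exponent_prod is_exponent_mult is_exponent_of_nat is_exponent_seq) auto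
  show "[?e N = 1] (mod int N)" if N: "0 < N" "coprime N D" for N
  proof -
    have "[?e N = (\<Prod>q\<in>prime_factors D. 1)] (mod int N)"
    proof (rule cong_prod)
      fix q assume q: "q \<in> prime_factors D"
      have "coprime q N" using pf(3)[OF q] N(2) by (meson coprime_commute coprime_divisors dvd_refl)
      then have "[q * exponent_seq q N = 1] (mod N)" using N pf(2)[OF q] by (intro exponent_seq_inverse)
      then have "[int (q * exponent_seq q N) = int 1] (mod int N)" by (simp only: cong_int_iff)
      then show "[int q * int (exponent_seq q N) = 1] (mod int N)" by simp
    qed
    then show ?thesis by simp
  qed
  have "R dvd (\<Prod>q\<in>prime_factors D. q * exponent_seq q R)"
  proof (rule dvd_if_prime_powers_dvd[OF R(1)])
    fix p :: nat assume p: "prime p"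
    show "p ^ multiplicity p R dvd (\<Prod>q\<in>prime_factors D. q * exponent_seq q R)"
    proof (cases "p dvd R")
      case False
      then show ?thesis by (simp add: not_dvd_imp_multiplicity_0)
    next
      case True
      have "p \<noteq> 1" "0 < (fact R :: nat)" using p by auto
      then have e: "p * exponent_seq p R = p ^ fact R"
        by (simp add: exponent_seq_def power_Suc[symmetric] del: power_Suc)
      \<comment> \<open>The factor belonging to p is p to the power R!, and R! is at least the
        multiplicity of p in R; so this factor vanishes at the p-part of R.\<close>
      have "multiplicity p R < p ^ multiplicity p R"
        using prime_gt_1_nat[OF p] by (intro power_gt_expt) auto
      also have "\<dots> \<le> R" using R(1) by (intro dvd_imp_le multiplicity_dvd)
      also have "\<dots> \<le> fact R" by (rule fact_ge_self)
      finally have "p ^ multiplicity p R dvd p * exponent_seq p R"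
        unfolding e by (intro le_imp_power_dvd) simp
      also have "\<dots> dvd (\<Prod>q\<in>prime_factors D. q * exponent_seq q R)"
        using R(2)[OF p True] p D0 by (intro dvd_prodI) (auto simp: prime_factors_dvd)
      finally show ?thesis .
    qed
  qed
  then have "int R dvd int (\<Prod>q\<in>prime_factors D. q * exponent_seq q R)" by (simp only: of_nat_dvd_iff)
  then show "[?e R = 0] (mod int R)" by (simp add: cong_0_iff)
qed

subsection \<open>Rational constraints\<close>

lemma word_limits_mono: "w \<in> word_limits A K \<Longrightarrow> K \<subseteq> L \<Longrightarrow> w \<in> word_limits A L"
  unfolding word_limits_def by blast

lemma word_limits_smult:
  assumes v: "v \<in> word_limits A K" and w: "w \<in> word_limits A L"
    and sub: "\<And>u. u \<in> K \<Longrightarrow> set u \<subseteq> A" "\<And>u. u \<in> L \<Longrightarrow> set u \<subseteq> A"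
    and M: "\<And>x y. x \<in> K \<Longrightarrow> y \<in> L \<Longrightarrow> x @ y \<in> M"
  shows "smult (Free_Pro Fin_Sgrp A) v w \<in> word_limits A M"
  unfolding word_limits_def
proof (intro CollectI conjI ballI)
  show "smult (Free_Pro Fin_Sgrp A) v w \<in> pro_carrier Fin_Sgrp A"
    using v w by (intro smult_in) (auto simp: word_limits_def)
  fix i assume i: "i \<in> pro_index Fin_Sgrp A"
  obtain x y where xy: "x \<in> K" "x \<noteq> []" "v i = word_value (fst i) (snd i) x"
    "y \<in> L" "y \<noteq> []" "w i = word_value (fst i) (snd i) y"
    using v w i unfolding word_limits_def by blast
  have S: "semigroup_on (fst i)" "snd i \<in> A \<rightarrow>\<^sub>E carrier (fst i)"
    using pro_indexD[OF i] by (auto dest: Fin_SgrpD)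
  have "word_value (fst i) (snd i) (x @ y) = smult (fst i) (v i) (w i)"
    unfolding xy(3,6) using xy(2,5) sub(1)[OF xy(1)] sub(2)[OF xy(4)]
    by (intro word_value_append S(1)) (auto intro!: PiE_mem[OF S(2)])
  then show "\<exists>u\<in>M. u \<noteq> [] \<and> smult (Free_Pro Fin_Sgrp A) v w i = word_value (fst i) (snd i) u"
    using xy M i by (intro bexI[of _ "x @ y"]) auto
qed

abbreviation star :: "nat list set \<Rightarrow> nat list set" where
  "star L \<equiv> {concat ws |ws. set ws \<subseteq> L}"

lemma star_append: "u \<in> star L \<Longrightarrow> v \<in> star L \<Longrightarrow> u @ v \<in> star L"
proof -
  assume "u \<in> star L" "v \<in> star L"
  then obtain xs ys where "set (xs @ ys) \<subseteq> L" "u @ v = concat (xs @ ys)" by auto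
  then show ?thesis by blast
qed

lemma star_sub: "L \<subseteq> star L"
proof
  fix u assume "u \<in> L"
  then show "u \<in> star L" by (intro CollectI exI[of _ "[u]"]) auto
qed

lemma star_set: "(\<And>u. u \<in> L \<Longrightarrow> set u \<subseteq> A) \<Longrightarrow> u \<in> star L \<Longrightarrow> set u \<subseteq> A"
  by fastforce

text \<open>The positive exponent may differ from coordinate to coordinate, but
  \<open>star L\<close> absorbs all of them: an approximating word is simply repeated.\<close>

lemma word_limits_power:
  assumes y: "y \<in> word_limits A (star L)" and L: "\<And>u. u \<in> L \<Longrightarrow> set u \<subseteq> A"
    and z: "z \<in> pro_carrier Fin_Sgrp A" "is_power A e y z"
  shows "z \<in> word_limits A (star L)"
  unfolding word_limits_def
proof (intro CollectI conjI ballI z)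
  fix i assume i: "i \<in> pro_index Fin_Sgrp A"
  have S: "semigroup_on (fst i)" "snd i \<in> A \<rightarrow>\<^sub>E carrier (fst i)"
    using pro_indexD[OF i] by (auto dest: Fin_SgrpD)
  obtain u where u: "u \<in> star L" "u \<noteq> []" "y i = word_value (fst i) (snd i) u"
    using y i unfolding word_limits_def by blast
  have uA: "snd i \<in> set u \<rightarrow> carrier (fst i)" using star_set[OF L u(1)] S(2) by auto
  obtain n where n: "0 < n" "z i = spow (fst i) (y i) n" using is_powerD(1)[OF z(2) i] by blast
  have "\<exists>v\<in>star L. v \<noteq> [] \<and> set v \<subseteq> set u \<and> spow (fst i) (y i) n = word_value (fst i) (snd i) v"
    using n(1)
  proof (induction n)
    case (Suc n)
    show ?case
    proof (cases "n = 0")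
      case True
      then show ?thesis using u by (intro bexI[of _ u]) auto
    next
      case False
      then obtain v where v: "v \<in> star L" "v \<noteq> []" "set v \<subseteq> set u" "spow (fst i) (y i) n = word_value (fst i) (snd i) v"
        using Suc.IH by blast
      have "word_value (fst i) (snd i) (v @ u) = smult (fst i) (word_value (fst i) (snd i) v) (word_value (fst i) (snd i) u)"
        using v(2,3) u(2) uA by (intro word_value_append S) auto
      then have "spow (fst i) (y i) (Suc n) = word_value (fst i) (snd i) (v @ u)"
        using False v(4) u(3) by (simp add: spow_Suc)
      then show ?thesis using star_append[OF v(1) u(1)] v(2,3) by (intro bexI[of _ "v @ u"]) auto
    qed
  qed simp
  then show "\<exists>v\<in>star L. v \<noteq> [] \<and> z i = word_value (fst i) (snd i) v" using n(2) by auto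
qed

section \<open>Spans of integer vectors over the integers and over the exponents\<close>

inductive_set int_span :: "(nat \<Rightarrow> int) set \<Rightarrow> (nat \<Rightarrow> int) set" for B :: "(nat \<Rightarrow> int) set" where
  zero: "(\<lambda>_. 0) \<in> int_span B"
| add: "t \<in> int_span B \<Longrightarrow> b \<in> B \<Longrightarrow> (\<lambda>a. t a + b a) \<in> int_span B"
| diff: "t \<in> int_span B \<Longrightarrow> b \<in> B \<Longrightarrow> (\<lambda>a. t a - b a) \<in> int_span B"

lemma int_span_add: "t \<in> int_span B \<Longrightarrow> r \<in> int_span B \<Longrightarrow> (\<lambda>a. r a + t a) \<in> int_span B"
proof (induction rule: int_span.induct)
  case (add t b)
  then show ?case using int_span.add[OF add.IH, of b] by (simp add: algebra_simps)
next
  case (diff t b)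
  then show ?case using int_span.diff[OF diff.IH, of b] by (simp add: algebra_simps)
qed simp

lemma int_span_diff: "t \<in> int_span B \<Longrightarrow> r \<in> int_span B \<Longrightarrow> (\<lambda>a. r a - t a) \<in> int_span B"
proof (induction rule: int_span.induct)
  case (add t b)
  then show ?case using int_span.diff[OF add.IH, of b] by (simp add: algebra_simps)
next
  case (diff t b)
  then show ?case using int_span.add[OF diff.IH, of b] by (simp add: algebra_simps)
qed simp

lemma int_span_mono: "t \<in> int_span B \<Longrightarrow> B \<subseteq> C \<Longrightarrow> t \<in> int_span C"
  by (induction rule: int_span.induct) (auto intro: int_span.intros)

text \<open>The span with exponents as scalars; the first argument N of its elements is the modulus.
  \<open>int_span\<close> describes the letter counts of words, \<open>exp_span\<close> what
  elements built from the signature can attain.\<close>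

inductive_set exp_span :: "supernatural \<Rightarrow> nat set \<Rightarrow> (nat \<Rightarrow> int) set \<Rightarrow> (nat \<Rightarrow> nat \<Rightarrow> int) set"
  for \<pi> :: supernatural and A :: "nat set" and B :: "(nat \<Rightarrow> int) set" where
  zero: "(\<lambda>_ _. 0) \<in> exp_span \<pi> A B"
| step: "t \<in> exp_span \<pi> A B \<Longrightarrow> is_exponent \<pi> A e \<Longrightarrow> b \<in> B \<Longrightarrow>
    (\<lambda>N a. t N a + e N * b a) \<in> exp_span \<pi> A B"

lemma exp_span_add_mult:
  assumes "t \<in> int_span B" "is_exponent \<pi> A e" "r \<in> exp_span \<pi> A B"
  shows "(\<lambda>N a. r N a + e N * t a) \<in> exp_span \<pi> A B"
  using assms(1)
proof (induction rule: int_span.induct)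
  case (add t b)
  then show ?case using exp_span.step[OF add.IH assms(2), of b] by (simp add: algebra_simps)
next
  case (diff t b)
  then show ?case using exp_span.step[OF diff.IH is_exponent_uminus[OF assms(2)], of b]
    by (simp add: algebra_simps)
qed (use assms(3) in simp)

lemma exp_span_Un:
  assumes "t \<in> exp_span \<pi> A (B \<union> C)"
  shows "\<exists>r\<in>exp_span \<pi> A B. \<exists>s\<in>exp_span \<pi> A C. t = (\<lambda>N a. r N a + s N a)"
  using assms
proof (induction rule: exp_span.induct)
  case zero
  show ?case using exp_span.zero[of \<pi> A B] exp_span.zero[of \<pi> A C] by force
next
  case (step t e b)
  then obtain r s where rs: "r \<in> exp_span \<pi> A B" "s \<in> exp_span \<pi> A C" "t = (\<lambda>N a. r N a + s N a)"
    by blast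
  show ?case
  proof (cases "b \<in> B")
    case True
    have "(\<lambda>N a. r N a + e N * b a) \<in> exp_span \<pi> A B" by (rule exp_span.step[OF rs(1) step(2) True])
    then show ?thesis
      by (rule bexI[rotated], intro bexI[OF _ rs(2)]) (simp add: rs(3) algebra_simps)
  next
    case False
    then have "b \<in> C" using step by blast
    then have "(\<lambda>N a. s N a + e N * b a) \<in> exp_span \<pi> A C" by (rule exp_span.step[OF rs(2) step(2)])
    then show ?thesis
      by (intro bexI[OF _ rs(1)], rule bexI[rotated]) (simp add: rs(3) algebra_simps)
  qed
qed

definition realizes :: "nat set \<Rightarrow> pro_elem \<Rightarrow> (nat \<Rightarrow> nat \<Rightarrow> int) \<Rightarrow> bool" where
  "realizes A w t \<longleftrightarrow> (\<forall>N>0. \<forall>a\<in>A. [int (coef N A w a) = t N a] (mod int N))"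

text \<open>The whole translate of \<open>exp_span\<close> has to be attained, not only the vectors
  of words, so that the solution of the linear system can be chosen freely inside it.\<close>

definition realizable :: "supernatural \<Rightarrow> nat set \<Rightarrow> nat list set \<Rightarrow> (nat \<Rightarrow> int) \<Rightarrow> (nat \<Rightarrow> int) set \<Rightarrow> bool" where
  "realizable \<pi> A L b0 B \<longleftrightarrow> (\<forall>t\<in>exp_span \<pi> A B.
     \<exists>w\<in>sigma_elems \<pi> A. w \<in> word_limits A L \<and> realizes A w (\<lambda>N a. b0 a + t N a))"

lemma realizable_mono: "realizable \<pi> A K b0 B \<Longrightarrow> K \<subseteq> L \<Longrightarrow> realizable \<pi> A L b0 B"
  unfolding realizable_def using word_limits_mono by blast

lemma realizes_smult:
  assumes "realizes A v s" "realizes A w t"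
  shows "realizes A (smult (Free_Pro Fin_Sgrp A) v w) (\<lambda>N a. s N a + t N a)"
  unfolding realizes_def
proof (intro allI impI ballI)
  fix N a assume *: "0 < (N::nat)" "a \<in> A"
  show "[int (coef N A (smult (Free_Pro Fin_Sgrp A) v w) a) = s N a + t N a] (mod int N)"
    using * assms unfolding realizes_def
    by (intro cong_trans[OF coef_smult_int] cong_add) auto
qed

lemma realizes_power:
  assumes "realizes A w t" "is_power A e w z"
  shows "realizes A z (\<lambda>N a. e N * t N a)"
  unfolding realizes_def
proof (intro allI impI ballI)
  fix N a assume *: "0 < (N::nat)" "a \<in> A"
  show "[int (coef N A z a) = e N * t N a] (mod int N)"
    using * assms(1) unfolding realizes_def
    by (intro cong_trans[OF is_powerD(2)[OF assms(2)] cong_scalar_left]) auto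
qed

lemma realizes_cong: "realizes A w s \<Longrightarrow> (\<And>N a. s N a = t N a) \<Longrightarrow> realizes A w t"
  by (simp add: realizes_def)

lemma realizable_concat:
  assumes K: "realizable \<pi> A K b0 B" "\<And>u. u \<in> K \<Longrightarrow> set u \<subseteq> A"
    and L: "realizable \<pi> A L c0 C" "\<And>u. u \<in> L \<Longrightarrow> set u \<subseteq> A"
  shows "realizable \<pi> A {u @ v |u v. u \<in> K \<and> v \<in> L} (\<lambda>a. b0 a + c0 a) (B \<union> C)"
  unfolding realizable_def
proof
  fix t assume "t \<in> exp_span \<pi> A (B \<union> C)"
  then obtain r s where rs: "r \<in> exp_span \<pi> A B" "s \<in> exp_span \<pi> A C" "t = (\<lambda>N a. r N a + s N a)"
    using exp_span_Un by blast
  obtain v where v: "v \<in> sigma_elems \<pi> A" "v \<in> word_limits A K" "realizes A v (\<lambda>N a. b0 a + r N a)"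
    using K(1) rs(1) unfolding realizable_def by blast
  obtain w where w: "w \<in> sigma_elems \<pi> A" "w \<in> word_limits A L" "realizes A w (\<lambda>N a. c0 a + s N a)"
    using L(1) rs(2) unfolding realizable_def by blast
  let ?z = "smult (Free_Pro Fin_Sgrp A) v w"
  have "?z \<in> word_limits A {u @ v |u v. u \<in> K \<and> v \<in> L}"
    using v(2) w(2) K(2) L(2) by (rule word_limits_smult) auto
  moreover have "realizes A ?z (\<lambda>N a. b0 a + c0 a + t N a)"
    by (rule realizes_cong[OF realizes_smult[OF v(3) w(3)]]) (simp add: rs(3))
  ultimately show "\<exists>w\<in>sigma_elems \<pi> A. w \<in> word_limits A {u @ v |u v. u \<in> K \<and> v \<in> L} \<and>
      realizes A w (\<lambda>N a. b0 a + c0 a + t N a)"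
    using Omega_smult[OF v(1) w(1)] by blast
qed

text \<open>Inside the closure of a star, the exponents 0 and -1 are available. Hence the base
  vector of a patch can be cancelled, and each base vector and generator can be scaled separately by
  any exponent.\<close>

lemma realizable_star:
  assumes PP: "\<And>b0 B. (b0, B) \<in> PP \<Longrightarrow> realizable \<pi> A L b0 B" "PP \<noteq> {}"
    and L: "\<And>u. u \<in> L \<Longrightarrow> set u \<subseteq> A"
  shows "realizable \<pi> A (star L) (\<lambda>_. 0) (\<Union>(b0, B)\<in>PP. insert b0 B)"
proof -
  let ?W = "\<lambda>t. \<exists>w\<in>sigma_elems \<pi> A. w \<in> word_limits A (star L) \<and> realizes A w t"
  have base: "?W (\<lambda>N a. b0 a + t N a)" if "(b0, B) \<in> PP" "t \<in> exp_span \<pi> A B" for b0 B t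
    using PP(1)[OF that(1)] that(2) word_limits_mono[OF _ star_sub] unfolding realizable_def by blast
  have pow: "?W (\<lambda>N a. e N * t N a)" if W: "?W t" and e: "is_exponent \<pi> A e" for t e
  proof -
    obtain w where w: "w \<in> sigma_elems \<pi> A" "w \<in> word_limits A (star L)" "realizes A w t" using W by blast
    obtain z where z: "z \<in> sigma_elems \<pi> A" "is_power A e w z" using is_exponentD[OF e w(1)] by blast
    have "z \<in> word_limits A (star L)"
      by (rule word_limits_power[OF w(2) L Omega_in[OF order_refl z(1)] z(2)])
    then show ?thesis using z(1) realizes_power[OF w(3) z(2)] by blast
  qed
  have add: "?W (\<lambda>N a. s N a + t N a)" if W: "?W s" "?W t" for s t
  proof -
    obtain v where v: "v \<in> sigma_elems \<pi> A" "v \<in> word_limits A (star L)" "realizes A v s" using W(1) by blast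
    obtain w where w: "w \<in> sigma_elems \<pi> A" "w \<in> word_limits A (star L)" "realizes A w t" using W(2) by blast
    have "smult (Free_Pro Fin_Sgrp A) v w \<in> word_limits A (star L)"
      using v(2) w(2) star_set[OF L] star_set[OF L] star_append by (rule word_limits_smult)
    then show ?thesis using Omega_smult[OF v(1) w(1)] realizes_smult[OF v(3) w(3)] by blast
  qed
  have "?W t" if "t \<in> exp_span \<pi> A (\<Union>(b0, B)\<in>PP. insert b0 B)" for t
    using that
  proof (induction rule: exp_span.induct)
    case zero
    \<comment> \<open>The zero vector is attained by the omega-power of an element of any patch, for
      which one patch is needed.\<close>
    obtain b0 B where "(b0, B) \<in> PP" using PP(2) by auto
    from pow[OF base[OF this exp_span.zero] is_exponent_0] show ?case by simp
  next
    case (step t e b)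
    then obtain b0 B where P: "(b0, B) \<in> PP" "b = b0 \<or> b \<in> B" by auto
    note base0 = base[OF P(1) exp_span.zero]
    have "?W (\<lambda>N a. e N * b a)"
    proof (cases "b = b0")
      case True
      from pow[OF base0 step(2)] show ?thesis using True by simp
    next
      case False
      then have "b \<in> B" using P(2) by blast
      \<comment> \<open>The vector b0 + e b is attained in L, and adding -b0 leaves e b.\<close>
      from add[OF base[OF P(1) exp_span.step[OF exp_span.zero step(2) this]] pow[OF base0 is_exponent_minus_1]]
      show ?thesis by simp
    qed
    from add[OF step.IH this] show ?case .
  qed
  then show ?thesis unfolding realizable_def by simp
qed

text \<open>Semilinearity of commutative images, up to closure: a star contributes the whole subgroup, not
  just the submonoid, generated by its language. The empty word, being isolated, is left out.\<close>

lemma rational_patches: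
  assumes "rational A L" and A: "finite A"
  shows "\<exists>PP. finite PP \<and> (\<forall>(b0, B)\<in>PP. realizable \<pi> A L b0 B) \<and>
    (\<forall>u\<in>L. u \<noteq> [] \<longrightarrow> (\<exists>(b0, B)\<in>PP. \<exists>t\<in>int_span B. \<forall>a\<in>A. int (count_list u a) = b0 a + t a))"
    (is "\<exists>PP. finite PP \<and> ?real L PP \<and> ?cover L PP")
  using assms(1)
proof (induction rule: rational.induct)
  case 1
  show ?case by (intro exI[of _ "{}"]) auto
next
  case 2
  show ?case by (intro exI[of _ "{}"]) auto
next
  case (3 x)
  let ?b = "\<lambda>a. of_bool (x = a) :: int"
  have span: "t = (\<lambda>_ _. 0)" if "t \<in> exp_span \<pi> A {}" for t
    using that by (induction rule: exp_span.induct) auto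
  have "gen Fin_Sgrp A x \<in> word_limits A {[x]}"
    using gen_in[OF 3, of Fin_Sgrp] by (auto simp: word_limits_def)
  moreover have "gen Fin_Sgrp A x \<in> sigma_elems \<pi> A" using 3 by (rule Omega_sig.intros)
  moreover have "realizes A (gen Fin_Sgrp A x) (\<lambda>N a. ?b a + 0)"
    using 3 by (auto simp: realizes_def coef_gen cong_def zmod_int)
  ultimately have "realizable \<pi> A {[x]} ?b {}"
    unfolding realizable_def using span by blast
  then show ?case
    by (intro exI[of _ "{(?b, {})}"]) (auto intro!: bexI[OF _ int_span.zero])
next
  case (4 K L)
  obtain P where P: "finite P" "?real K P" "?cover K P" using 4(3) by (elim exE conjE)
  obtain Q where Q: "finite Q" "?real L Q" "?cover L Q" using 4(4) by (elim exE conjE)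
  show ?case
  proof (intro exI[of _ "P \<union> Q"] conjI)
    show "?real (K \<union> L) (P \<union> Q)"
      using P(2) Q(2) realizable_mono[of \<pi> A K _ _ "K \<union> L"] realizable_mono[of \<pi> A L _ _ "K \<union> L"]
      by auto
    show "?cover (K \<union> L) (P \<union> Q)"
      unfolding ball_Un bex_Un by (intro conjI ballI impI) (use P(3) Q(3) in blast)+
  qed (use P Q in simp)
next
  case (5 K L)
  obtain P where P: "finite P" "?real K P" "?cover K P" using 5(3) by (elim exE conjE)
  obtain Q where Q: "finite Q" "?real L Q" "?cover L Q" using 5(4) by (elim exE conjE)
  note setK = rational_lists[OF 5(1)] and setL = rational_lists[OF 5(2)]
  let ?KL = "{u @ v |u v. u \<in> K \<and> v \<in> L}"
  let ?f = "\<lambda>((b0, B), (c0, C)). (\<lambda>a. b0 a + c0 a :: int, B \<union> C)"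
  \<comment> \<open>Patches do not account for the empty word. If one factor contains it, the
    patches of the other factor are added on their own.\<close>
  let ?R = "?f ` (P \<times> Q) \<union> {x \<in> P. [] \<in> L} \<union> {x \<in> Q. [] \<in> K}"
  have "finite ?R" using P(1) Q(1) by simp
  moreover have "?real ?KL ?R"
  proof
    fix x assume "x \<in> ?R"
    then consider "x \<in> ?f ` (P \<times> Q)" | "[] \<in> L" "x \<in> P" | "[] \<in> K" "x \<in> Q"
      by (elim UnE CollectE conjE)
    then show "case x of (d0, D) \<Rightarrow> realizable \<pi> A ?KL d0 D"
    proof cases
      case 1
      then obtain p q where pq: "p \<in> P" "q \<in> Q" "x = ?f (p, q)" by blast
      obtain b0 B c0 C where pq': "p = (b0, B)" "q = (c0, C)" by (cases p, cases q)
      have x: "x = (\<lambda>a. b0 a + c0 a, B \<union> C)" "(b0, B) \<in> P" "(c0, C) \<in> Q"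
        using pq by (simp_all add: pq')
      have "realizable \<pi> A K b0 B" "realizable \<pi> A L c0 C" using P(2) Q(2) x(2,3) by auto
      then have "realizable \<pi> A ?KL (\<lambda>a. b0 a + c0 a) (B \<union> C)" by (intro realizable_concat setK setL)
      then show ?thesis unfolding x(1) by simp
    next
      case 2
      have "K \<subseteq> ?KL" using 2(1) by force
      then show ?thesis using bspec[OF P(2) 2(2)] realizable_mono[of \<pi> A K] by (cases x) simp
    next
      case 3
      have "L \<subseteq> ?KL" using 3(1) by force
      then show ?thesis using bspec[OF Q(2) 3(2)] realizable_mono[of \<pi> A L] by (cases x) simp
    qed
  qed
  moreover have "?cover ?KL ?R"
  proof (intro ballI impI)
    fix w assume "w \<in> ?KL" "w \<noteq> []"
    then obtain u v where uv: "u \<in> K" "v \<in> L" "w = u @ v" by blast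
    show "\<exists>(b0, B)\<in>?R. \<exists>t\<in>int_span B. \<forall>a\<in>A. int (count_list w a) = b0 a + t a"
    proof (cases "u = [] \<or> v = []")
      case True
      then consider "u = []" "v \<noteq> []" | "u \<noteq> []" "v = []" using \<open>w \<noteq> []\<close> uv by auto
      then show ?thesis
      proof cases
        case 1
        then obtain c0 C where "(c0, C) \<in> Q" "\<exists>t\<in>int_span C. \<forall>a\<in>A. int (count_list v a) = c0 a + t a"
          using Q(3) uv by blast
        then show ?thesis using 1 uv by (intro bexI[of _ "(c0, C)"]) auto
      next
        case 2
        then obtain c0 C where "(c0, C) \<in> P" "\<exists>t\<in>int_span C. \<forall>a\<in>A. int (count_list u a) = c0 a + t a"
          using P(3) uv by blast
        then show ?thesis using 2 uv by (intro bexI[of _ "(c0, C)"]) auto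
      qed
    next
      case False
      then obtain b0 B s where B: "(b0, B) \<in> P" "s \<in> int_span B" "\<forall>a\<in>A. int (count_list u a) = b0 a + s a"
        using P(3) uv by blast
      from False obtain c0 C t where C: "(c0, C) \<in> Q" "t \<in> int_span C" "\<forall>a\<in>A. int (count_list v a) = c0 a + t a"
        using Q(3) uv by blast
      have "(\<lambda>a. s a + t a) \<in> int_span (B \<union> C)"
        using int_span_mono[OF B(2)] int_span_mono[OF C(2)] by (intro int_span_add) auto
      moreover have "\<forall>a\<in>A. int (count_list w a) = (b0 a + c0 a) + (s a + t a)" using B(3) C(3) uv by simp
      moreover have "?f ((b0, B), (c0, C)) \<in> ?R" using B(1) C(1) by blast
      ultimately show ?thesis by (intro bexI[of _ "?f ((b0, B), (c0, C))"]) auto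
    qed
  qed
  ultimately show ?case by (intro exI[of _ ?R] conjI)
next
  case (6 L)
  obtain P where P: "finite P" "?real L P" "?cover L P" using 6(2) by (elim exE conjE)
  note setL = rational_lists[OF 6(1)]
  let ?U = "\<Union>(b0, B)\<in>P. insert b0 B"
  have span: "\<exists>t\<in>int_span ?U. \<forall>a\<in>A. int (count_list (concat ws) a) = t a" if "set ws \<subseteq> L" for ws
    using that
  proof (induction ws)
    case Nil
    show ?case by (rule bexI[OF _ int_span.zero]) simp
  next
    case (Cons u ws)
    then obtain t where t: "t \<in> int_span ?U" "\<forall>a\<in>A. int (count_list (concat ws) a) = t a" by auto
    show ?case
    proof (cases "u = []")
      case True
      then show ?thesis using t by auto
    next
      case False
      then obtain b0 B s where B: "(b0, B) \<in> P" "s \<in> int_span B" "\<forall>a\<in>A. int (count_list u a) = b0 a + s a"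
        using P(3) Cons.prems by auto
      have "s \<in> int_span ?U" using B(1) by (intro int_span_mono[OF B(2)]) auto
      then have "(\<lambda>a. t a + s a) \<in> int_span ?U" using t(1) by (rule int_span_add)
      moreover have "b0 \<in> ?U" using B(1) by auto
      ultimately have "(\<lambda>a. t a + s a + b0 a) \<in> int_span ?U" by (rule int_span.add)
      then show ?thesis by (rule bexI[rotated]) (use t(2) B(3) in simp)
    qed
  qed
  show ?case
  \<comment> \<open>Without patches, L contains at most the empty word, and then so does its
    star.\<close>
  proof (cases "P = {}")
    case True
    then have "L \<subseteq> {[]}" using P(3) by auto
    then have "u = []" if "u \<in> star L" for u using that by auto blast
    then show ?thesis by (intro exI[of _ "{}"]) auto
  next
    case False
    have "realizable \<pi> A (star L) (\<lambda>_. 0) ?U"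
      using P(2) False setL by (intro realizable_star) auto
    then show ?thesis using span by (intro exI[of _ "{(\<lambda>_. 0, ?U)}"]) auto
  qed
qed

section \<open>From constraints to reducibility\<close>

lemma nat_dvd_common_multiple:
  assumes "finite F" "\<And>m. m \<in> F \<Longrightarrow> nat_dvd (f m) \<pi>"
  shows "\<exists>L. nat_dvd L \<pi> \<and> (\<forall>m\<in>F. f m dvd L)"
  using assms
proof (induction F rule: finite_induct)
  case empty
  then show ?case using nat_dvd_1 by blast
next
  case (insert x F)
  then obtain L where "nat_dvd L \<pi>" "\<forall>m\<in>F. f m dvd L" by auto
  then show ?case using insert.prems by (intro exI[of _ "lcm (f x) L"]) (auto intro: nat_dvd_lcm)
qed

text \<open>Modulo each N a word near w lies in some patch, which may depend on N. If each of the
  finitely many patches failed at some modulus, a word near w modulo a common multiple of these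
  moduli would lie in a patch that cannot fail there.\<close>

lemma uniform_patch:
  assumes L: "rational A L" and A: "finite A" and w: "w \<in> word_limits A L"
  shows "\<exists>b0 B. realizable \<pi> A L b0 B \<and>
    (\<forall>N. nat_dvd N \<pi> \<longrightarrow> (\<exists>t\<in>int_span B. \<forall>a\<in>A. [int (coef N A w a) = b0 a + t a] (mod int N)))"
proof (rule ccontr)
  assume no: "\<nexists>b0 B. realizable \<pi> A L b0 B \<and>
    (\<forall>N. nat_dvd N \<pi> \<longrightarrow> (\<exists>t\<in>int_span B. \<forall>a\<in>A. [int (coef N A w a) = b0 a + t a] (mod int N)))"
  let ?P = "\<lambda>N p. \<exists>t\<in>int_span (snd p). \<forall>a\<in>A. [int (coef N A w a) = fst p a + t a] (mod int N)"
  have wP: "w \<in> pro_carrier Fin_Sgrp A" using w by (simp add: word_limits_def)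
  obtain PP where PP: "finite PP" "\<forall>(b0, B)\<in>PP. realizable \<pi> A L b0 B"
    "\<forall>u\<in>L. u \<noteq> [] \<longrightarrow> (\<exists>(b0, B)\<in>PP. \<exists>t\<in>int_span B. \<forall>a\<in>A. int (count_list u a) = b0 a + t a)"
    using rational_patches[OF L A, of \<pi>] by (elim exE conjE)
  have "\<exists>N. nat_dvd N \<pi> \<and> \<not> ?P N p" if "p \<in> PP" for p
  proof -
    have "realizable \<pi> A L (fst p) (snd p)" using PP(2) that by auto
    then show ?thesis using no by blast
  qed
  then obtain f where f: "\<And>p. p \<in> PP \<Longrightarrow> nat_dvd (f p) \<pi>" "\<And>p. p \<in> PP \<Longrightarrow> \<not> ?P (f p) p" by metis
  obtain M where M: "nat_dvd M \<pi>" "\<forall>p\<in>PP. f p dvd M"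
    using nat_dvd_common_multiple[OF PP(1), of f \<pi>] f(1) by blast
  have M0: "0 < M" using M(1) by (rule nat_dvd_pos)
  let ?F = "(\<lambda>a. (cyclic M, unit_vec M A a)) ` A"
  have "finite ?F" "?F \<subseteq> pro_index Fin_Sgrp A" using A unit_vec_index_Fin[OF M0] by auto
  from word_limits_finite[OF w this rational_lists[OF L]] obtain u where
    u: "u \<in> L" "u \<noteq> []" "\<forall>i\<in>?F. w i = word_value (fst i) (snd i) u" by blast
  have c: "coef M A w a = count_list u a mod M" if "a \<in> A" for a
    using u(3) that word_value_unit_vec[OF A u(2) rational_lists[OF L u(1)] that M0] by (simp add: coef_def)
  obtain p where p: "p \<in> PP" "\<exists>t\<in>int_span (snd p). \<forall>a\<in>A. int (count_list u a) = fst p a + t a"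
    using PP(3) u(1,2) by (fastforce simp: case_prod_beta)
  then obtain t where t: "t \<in> int_span (snd p)" "\<And>a. a \<in> A \<Longrightarrow> int (count_list u a) = fst p a + t a"
    by blast
  have "[int (coef (f p) A w a) = fst p a + t a] (mod int (f p))" if a: "a \<in> A" for a
  proof -
    have fM: "f p dvd M" using M(2) p(1) by blast
    have "coef (f p) A w a = count_list u a mod f p"
      unfolding coef_mod[OF wP M0 fM] c[OF a] using fM by (simp add: mod_mod_cancel)
    then show ?thesis unfolding t(2)[OF a, symmetric] by (simp add: cong_def zmod_int)
  qed
  then show False using f(2)[OF p(1)] t(1) by blast
qed

text \<open>The product of the denominators from \<open>term_coef_rational\<close> over the finitely
  many elements; it gives the equations integer coefficients away from finitely many finite
  primes.\<close>

lemma common_denominator: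
  assumes "finite F" "F \<subseteq> sigma_elems \<pi> B"
  shows "\<exists>d U. finite_part \<pi> d \<and> (\<forall>w\<in>F. \<forall>N>0. coprime N d \<longrightarrow>
    (\<forall>b\<in>B. [int d * int (coef N B w b) = U w b] (mod int N)))"
  using assms
proof (induction F rule: finite_induct)
  case empty
  show ?case by (intro exI[of _ 1]) simp
next
  case (insert w F)
  then obtain d U where d: "finite_part \<pi> d"
    and U: "\<And>v N b. v \<in> F \<Longrightarrow> 0 < N \<Longrightarrow> coprime N d \<Longrightarrow> b \<in> B \<Longrightarrow>
      [int d * int (coef N B v b) = U v b] (mod int N)" by blast
  obtain t where t: "sterm_over (sigma_pi \<pi>) B t" "w = sterm_eval (sigma_pi \<pi>) Fin_Sgrp B t"
    using insert.prems by (auto simp: Omega_sig_eq)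
  obtain d' u where d': "0 < d'" "\<forall>p. prime p \<longrightarrow> p dvd d' \<longrightarrow> p \<in> finite_primes \<pi> \<and> p \<le> sterm_encode t"
    and u': "\<forall>N>0. coprime N d' \<longrightarrow> (\<forall>b\<in>B. [int d' * int (coef N B w b) = u b] (mod int N))"
    using term_coef_rational[OF t(1)] unfolding t(2) by (elim exE conjE)
  have u: "[int d' * int (coef N B w b) = u b] (mod int N)" if "0 < N" "coprime N d'" "b \<in> B" for N b
    using u' that by blast
  have "finite_part \<pi> d'" using d' by (simp add: finite_part_def)
  then have "finite_part \<pi> (d * d')" using d by (intro finite_part_mult)
  moreover have "[int (d * d') * int (coef N B v b) = (if v = w then int d * u b else int d' * U v b)] (mod int N)"
    if v: "v \<in> insert w F" and N: "0 < N" "coprime N (d * d')" "b \<in> B" for v N b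
  proof (cases "v = w")
    case True
    then show ?thesis using cong_scalar_left[OF u[OF N(1) _ N(3)], of "int d"] N(2)
      by (simp add: mult.assoc)
  next
    case False
    then show ?thesis using cong_scalar_left[OF U[OF _ N(1) _ N(3)], of v "int d'"] N(2) v
      by (simp add: algebra_simps)
  qed
  ultimately show ?case
    by (intro exI[of _ "d * d'"] exI[of _ "\<lambda>v b. if v = w then int d * u b else int d' * U v b"]) blast
qed

text \<open>A continuous homomorphism is substitution of its values at the generators, so
  coefficients of images depend linearly on the coefficients of these values. This makes equations
  linear.\<close>

lemma coef_cont_hom:
  assumes h: "h \<in> cont_hom (Free_Pro Fin_Sgrp Y) (Free_Pro Fin_Sgrp A)"
    and Y: "finite Y" and u: "u \<in> pro_carrier Fin_Sgrp Y" and N: "0 < N"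
  shows "coef N A (h u) a = (\<Sum>y\<in>Y. coef N Y u y * coef N A (h (gen Fin_Sgrp Y y)) a) mod N"
proof -
  have s: "h (gen Fin_Sgrp Y y) \<in> pro_carrier Fin_Sgrp A" if "y \<in> Y" for y
    using h gen_in[OF that] by (auto simp: cont_hom_def shom_def)
  have "h u = extend Fin_Sgrp A Y (\<lambda>y. h (gen Fin_Sgrp Y y)) u"
    using fun_cong[OF cont_hom_eq_extend[OF h order_refl], of u] u by simp
  then show ?thesis using coef_extend[OF Y u s N] by simp
qed

text \<open>Multiplication by t changes the multiplicities only at primes where \<open>\<pi>\<close>
  imposes no bound. This is the closure property that \<open>integral_solution\<close> requires of
  the moduli.\<close>

lemma nat_dvd_mult_infinite:
  assumes N: "nat_dvd N \<pi>" and t: "infinite_part \<pi> t"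
  shows "nat_dvd (N * t) \<pi>"
  unfolding nat_dvd_iff
proof (intro conjI allI impI)
  show "0 < N * t" using N t by (simp add: nat_dvd_iff infinite_part_def)
  fix p :: nat assume p: "prime p"
  show "enat (multiplicity p (N * t)) \<le> \<pi> p"
  proof (cases "p dvd t")
    case True
    then show ?thesis using t p by (simp add: infinite_part_def)
  next
    case False
    then have "multiplicity p (N * t) = multiplicity p N"
      using p N t by (simp add: prime_elem_multiplicity_mult_distrib not_dvd_imp_multiplicity_0
          nat_dvd_iff infinite_part_def)
    then show ?thesis using N p by (simp add: nat_dvd_iff)
  qed
qed

lemma coprime_parts:
  assumes "finite_part \<pi> d" "infinite_part \<pi> t"
  shows "coprime t d"
proof (rule ccontr)
  assume "\<not> coprime t d"
  then have "gcd t d \<noteq> 1" by (simp only: coprime_iff_gcd_eq_1 not_False_eq_True)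
  from prime_factor_nat[OF this] obtain p where "prime p" "p dvd t" "p dvd d"
    by (auto simp only: gcd_greatest_iff)
  then show False using assms by (auto simp: finite_part_def infinite_part_def finite_primes_def)
qed

text \<open>Each variable is confined to one patch, so that the unknowns of the linear system are
  elements of the spans \<open>int_span (B x)\<close>. Exponents then mix two integral choices of
  them, one from the elimination and one read off from the given solution modulo R.\<close>

theorem reducible_Ab:
  assumes sys: "is_system (sigma_pi \<pi>) \<Sigma>"
  shows "reducible (sigma_pi \<pi>) (Ab \<pi>) \<Sigma>"
  unfolding reducible_def
proof
  assume "\<exists>\<delta>. solution_mod (Ab \<pi>) \<Sigma> \<delta>"
  then obtain \<delta> where sol: "solution_mod (Ab \<pi>) \<Sigma> \<delta>" ..
  define X P Y A E where "X = vars \<Sigma>" and "P = params \<Sigma>" and "Y = X \<union> P" and "A = alphabet \<Sigma>"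
    and "E = eqs \<Sigma>"
  note defs = X_def P_def Y_def A_def E_def
  have fin: "finite X" "finite P" "finite Y" "finite A" "finite E" and disj: "X \<inter> P = {}"
    and EY: "\<And>u v. (u, v) \<in> E \<Longrightarrow> u \<in> sigma_elems \<pi> Y \<and> v \<in> sigma_elems \<pi> Y"
    and rat: "\<And>x. x \<in> X \<Longrightarrow> rational A (constraint \<Sigma> x)"
    and par: "\<And>p. p \<in> P \<Longrightarrow> param_val \<Sigma> p \<in> sigma_elems \<pi> A"
    using sys unfolding is_system_def defs by auto
  let ?g = "gen Fin_Sgrp Y"
  have hom: "\<delta> \<in> cont_hom (Free_Pro Fin_Sgrp Y) (Free_Pro Fin_Sgrp A)"
    and cl: "\<And>x. x \<in> X \<Longrightarrow> Some (\<delta> (?g x)) \<in> Cl A (constraint \<Sigma> x)"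
    and dp: "\<And>p. p \<in> P \<Longrightarrow> \<delta> (?g p) = param_val \<Sigma> p"
    and sat: "\<And>u v. (u, v) \<in> E \<Longrightarrow> satisfies (Ab \<pi>) A (\<delta> u) (\<delta> v)"
    using sol unfolding solution_mod_def Let_def defs by auto
  have hom_in: "h w \<in> pro_carrier Fin_Sgrp A"
    if "h \<in> cont_hom (Free_Pro Fin_Sgrp Y) (Free_Pro Fin_Sgrp A)" "w \<in> pro_carrier Fin_Sgrp Y" for h w
    using that by (auto simp: cont_hom_def shom_def)
  have EP: "u \<in> pro_carrier Fin_Sgrp Y" "v \<in> pro_carrier Fin_Sgrp Y" if "(u, v) \<in> E" for u v
    using EY[OF that] by (auto intro: Omega_in)

  have "\<forall>x\<in>X. \<exists>p. realizable \<pi> A (constraint \<Sigma> x) (fst p) (snd p) \<and> (\<forall>N. nat_dvd N \<pi> \<longrightarrow>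
    (\<exists>t\<in>int_span (snd p). \<forall>a\<in>A. [int (coef N A (\<delta> (?g x)) a) = fst p a + t a] (mod int N)))"
  proof
    fix x assume x: "x \<in> X"
    have "\<delta> (?g x) \<in> word_limits A (constraint \<Sigma> x)"
      using cl[OF x] Some_in_Cl_iff[OF rational_lists[OF rat[OF x]]] by simp
    from uniform_patch[OF rat[OF x] fin(4) this, of \<pi>] show "\<exists>p. realizable \<pi> A (constraint \<Sigma> x) (fst p) (snd p) \<and>
      (\<forall>N. nat_dvd N \<pi> \<longrightarrow>
        (\<exists>t\<in>int_span (snd p). \<forall>a\<in>A. [int (coef N A (\<delta> (?g x)) a) = fst p a + t a] (mod int N)))"
      by (metis fst_conv snd_conv)
  qed
  from bchoice[OF this] obtain pt where
    real: "\<And>x. x \<in> X \<Longrightarrow> realizable \<pi> A (constraint \<Sigma> x) (fst (pt x)) (snd (pt x))" and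
    patch: "\<And>x N. x \<in> X \<Longrightarrow> nat_dvd N \<pi> \<Longrightarrow> \<exists>t\<in>int_span (snd (pt x)).
      \<forall>a\<in>A. [int (coef N A (\<delta> (?g x)) a) = fst (pt x) a + t a] (mod int N)" by metis
  define b0 B where "b0 x = fst (pt x)" and "B x = snd (pt x)" for x
  have patch': "\<exists>t. (\<forall>x\<in>X. t x \<in> int_span (B x)) \<and>
    (\<forall>x\<in>X. \<forall>a\<in>A. [int (coef N A (\<delta> (?g x)) a) = b0 x a + t x a] (mod int N))" if "nat_dvd N \<pi>" for N
  proof -
    have "\<forall>x\<in>X. \<exists>t. t \<in> int_span (B x) \<and>
      (\<forall>a\<in>A. [int (coef N A (\<delta> (?g x)) a) = b0 x a + t a] (mod int N))"
      using patch[OF _ that] unfolding b0_def B_def by blast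
    from bchoice[OF this] show ?thesis by blast
  qed

  \<comment> \<open>The number \<open>d1\<close> clears the denominators in both sides of the
    equations, and \<open>d2\<close> those in the values of the parameters.\<close>
  have "fst ` E \<union> snd ` E \<subseteq> sigma_elems \<pi> Y" using EY by auto
  from common_denominator[OF _ this] fin(5) obtain d1 U where d1: "finite_part \<pi> d1"
    and U: "\<And>w N y. w \<in> fst ` E \<union> snd ` E \<Longrightarrow> 0 < N \<Longrightarrow> coprime N d1 \<Longrightarrow> y \<in> Y \<Longrightarrow>
      [int d1 * int (coef N Y w y) = U w y] (mod int N)" by blast
  have "param_val \<Sigma> ` P \<subseteq> sigma_elems \<pi> A" using par by auto
  from common_denominator[OF _ this] fin(2) obtain d2 W where d2: "finite_part \<pi> d2"
    and W: "\<And>w N a. w \<in> param_val \<Sigma> ` P \<Longrightarrow> 0 < N \<Longrightarrow> coprime N d2 \<Longrightarrow> a \<in> A \<Longrightarrow>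
      [int d2 * int (coef N A w a) = W w a] (mod int N)" by blast
  \<comment> \<open>An equation is indexed by its pair of sides and a letter. With the denominators
    cleared, left minus right is \<open>b - lin t\<close>: \<open>G\<close> holds the coefficients,
    \<open>b\<close> the contribution of base vectors and parameters, and \<open>lin t\<close> the
    negated contribution of the unknowns t.\<close>
  define G where "G \<epsilon> y = U (fst \<epsilon>) y - U (snd \<epsilon>) y" for \<epsilon> y
  define b where "b j = (\<Sum>x\<in>X. G (fst j) x * (int d2 * b0 x (snd j)))
    + (\<Sum>p\<in>P. G (fst j) p * W (param_val \<Sigma> p) (snd j))" for j
  define lin where "lin t j = - (\<Sum>x\<in>X. G (fst j) x * (int d2 * t x (snd j)))"
    for t :: "nat \<Rightarrow> nat \<Rightarrow> int" and j
  \<comment> \<open>Stated for an arbitrary h, because it is applied both to the given solution and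
    to the one constructed below.\<close>
  have key: "[int (d1 * d2) * (int (coef N A (h u) a) - int (coef N A (h v) a)) = b ((u, v), a) - lin t ((u, v), a)] (mod int N)"
    if h: "h \<in> cont_hom (Free_Pro Fin_Sgrp Y) (Free_Pro Fin_Sgrp A)" "\<And>p. p \<in> P \<Longrightarrow> h (?g p) = param_val \<Sigma> p"
      and t: "\<And>x. x \<in> X \<Longrightarrow> [int (coef N A (h (?g x)) a) = b0 x a + t x a] (mod int N)"
      and N: "0 < N" "coprime N (d1 * d2)" and uv: "(u, v) \<in> E" and a: "a \<in> A" for h N t u v a
  proof -
    let ?k = "\<lambda>y. int (coef N A (h (?g y)) a)"
    have 1: "[int d1 * int (coef N A (h w) a) = (\<Sum>y\<in>Y. U w y * ?k y)] (mod int N)"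
      if w: "w \<in> fst ` E \<union> snd ` E" "w \<in> pro_carrier Fin_Sgrp Y" for w
    proof -
      have "[int (coef N A (h w) a) = (\<Sum>y\<in>Y. int (coef N Y w y) * ?k y)] (mod int N)"
        unfolding coef_cont_hom[OF h(1) fin(3) w(2) N(1)] by (simp add: cong_def zmod_int)
      then have "[int d1 * int (coef N A (h w) a) = int d1 * (\<Sum>y\<in>Y. int (coef N Y w y) * ?k y)] (mod int N)"
        by (rule cong_scalar_left)
      also have "int d1 * (\<Sum>y\<in>Y. int (coef N Y w y) * ?k y) = (\<Sum>y\<in>Y. (int d1 * int (coef N Y w y)) * ?k y)"
        by (simp add: sum_distrib_left mult.assoc)
      also have "[\<dots> = (\<Sum>y\<in>Y. U w y * ?k y)] (mod int N)"
        using N w(1) by (intro cong_sum cong_mult cong_refl U) auto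
      finally show ?thesis .
    qed
    have uE: "u \<in> fst ` E \<union> snd ` E" "v \<in> fst ` E \<union> snd ` E" using uv by force+
    have "[int d2 * (int d1 * int (coef N A (h u) a) - int d1 * int (coef N A (h v) a))
        = int d2 * ((\<Sum>y\<in>Y. U u y * ?k y) - (\<Sum>y\<in>Y. U v y * ?k y))] (mod int N)"
      by (intro cong_scalar_left cong_diff 1 uE EP[OF uv])
    also have "int d2 * ((\<Sum>y\<in>Y. U u y * ?k y) - (\<Sum>y\<in>Y. U v y * ?k y))
        = (\<Sum>y\<in>Y. G (u, v) y * (int d2 * ?k y))"
      unfolding sum_subtractf[symmetric] sum_distrib_left G_def
      by (intro sum.cong) (auto simp: algebra_simps)
    also have "\<dots> = (\<Sum>x\<in>X. G (u, v) x * (int d2 * ?k x)) + (\<Sum>p\<in>P. G (u, v) p * (int d2 * ?k p))"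
      unfolding Y_def using fin(1,2) disj by (intro sum.union_disjoint)
    also have "[\<dots> = (\<Sum>x\<in>X. G (u, v) x * (int d2 * (b0 x a + t x a)))
        + (\<Sum>p\<in>P. G (u, v) p * W (param_val \<Sigma> p) a)] (mod int N)"
      using N a h(2) by (intro cong_add cong_sum cong_scalar_left t) (auto intro!: W)
    also have "(\<Sum>x\<in>X. G (u, v) x * (int d2 * (b0 x a + t x a)))
        + (\<Sum>p\<in>P. G (u, v) p * W (param_val \<Sigma> p) a) = b ((u, v), a) - lin t ((u, v), a)"
      by (simp add: b_def lin_def algebra_simps sum.distrib)
    finally show ?thesis by (simp add: algebra_simps)
  qed

  define H where "H = {lin t |t. \<forall>x\<in>X. t x \<in> int_span (B x)}"
  \<comment> \<open>Only at moduli coprime to both denominators do the numerators \<open>U\<close>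
    and \<open>W\<close> determine the coefficients.\<close>
  define NN where "NN = {N. nat_dvd N \<pi> \<and> coprime N (d1 * d2)}"
  have d12: "finite_part \<pi> (d1 * d2)" by (intro finite_part_mult d1 d2)
  have "int_subgroup H"
    unfolding int_subgroup_def
  proof (intro conjI ballI)
    have "lin (\<lambda>x a. 0) \<in> H" unfolding H_def using int_span.zero by blast
    moreover have "lin (\<lambda>x a. 0) = (\<lambda>_. 0)" by (simp add: lin_def fun_eq_iff)
    ultimately show "(\<lambda>_. 0) \<in> H" by simp
    fix y z assume "y \<in> H" "z \<in> H"
    then obtain s t where st: "y = lin s" "z = lin t" "\<forall>x\<in>X. s x \<in> int_span (B x)" "\<forall>x\<in>X. t x \<in> int_span (B x)"
      unfolding H_def by blast
    have "(\<lambda>j. y j - z j) = lin (\<lambda>x a. s x a - t x a)"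
      by (simp add: st lin_def fun_eq_iff algebra_simps sum_subtractf)
    moreover have "\<forall>x\<in>X. (\<lambda>a. s x a - t x a) \<in> int_span (B x)" using st by (auto intro: int_span_diff)
    ultimately show "(\<lambda>j. y j - z j) \<in> H" unfolding H_def by blast
  qed
  moreover have "1 \<in> NN" "0 \<notin> NN" using nat_dvd_1[of \<pi>] by (auto simp: NN_def nat_dvd_iff)
  moreover have "N * t \<in> NN" if "N \<in> NN" "infinite_part \<pi> t" for N t
    using that nat_dvd_mult_infinite coprime_parts[OF d12 that(2)]
    by (simp add: NN_def del: coprime_mult_right_iff)
  moreover have "\<exists>h\<in>H. \<forall>j\<in>E \<times> A. [b j = h j] (mod int N)" if "N \<in> NN" for N
  proof -
    have N: "nat_dvd N \<pi>" "0 < N" "coprime N (d1 * d2)" using that nat_dvd_pos by (auto simp: NN_def)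
    obtain t where t: "\<forall>x\<in>X. t x \<in> int_span (B x)"
      "\<forall>x\<in>X. \<forall>a\<in>A. [int (coef N A (\<delta> (?g x)) a) = b0 x a + t x a] (mod int N)"
      using patch'[OF N(1)] by blast
    have "[b ((u, v), a) = lin t ((u, v), a)] (mod int N)" if uv: "(u, v) \<in> E" "a \<in> A" for u v a
    proof -
      have "coef N A (\<delta> u) a = coef N A (\<delta> v) a"
        using sat[OF uv(1)] satisfies_Ab_iff[OF fin(4) hom_in[OF hom EP(1)[OF uv(1)]] hom_in[OF hom EP(2)[OF uv(1)]]]
          N(1) uv(2) by blast
      then have "[0 = b ((u, v), a) - lin t ((u, v), a)] (mod int N)"
        using key[OF hom dp _ N(2,3) uv, of t] t(2) uv(2) by simp
      then show ?thesis by (simp add: cong_diff_iff_cong_0 cong_sym_eq[of 0])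
    qed
    moreover have "lin t \<in> H" using t(1) unfolding H_def by blast
    ultimately show ?thesis by (intro bexI[of _ "lin t"]) auto
  qed
  ultimately obtain s h where s: "finite_part \<pi> s" "h \<in> H"
    "\<forall>N\<in>NN. \<forall>j\<in>E \<times> A. [int s * b j = h j] (mod int N)"
    using integral_solution[of "E \<times> A" H NN \<pi> b] fin by blast
  from s(2) obtain t1 where t1: "\<And>x. x \<in> X \<Longrightarrow> t1 x \<in> int_span (B x)" "h = lin t1" unfolding H_def by blast

  \<comment> \<open>The exceptional primes: those in the denominators of the data and those in the
    multiplier s of the elimination.\<close>
  define D where "D = d1 * d2 * s"
  have D: "finite_part \<pi> D" unfolding D_def by (intro finite_part_mult d12 s)
  obtain R where R: "full_at D R \<pi>" "\<And>p. prime p \<Longrightarrow> p dvd R \<Longrightarrow> p dvd D" using exists_full[OF D] by blast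
  have Rpi: "nat_dvd R \<pi>" using R by (simp add: full_at_def)
  have R0: "0 < R" using Rpi by (rule nat_dvd_pos)
  obtain t2 where t2: "\<forall>x\<in>X. t2 x \<in> int_span (B x)"
    "\<forall>x\<in>X. \<forall>a\<in>A. [int (coef R A (\<delta> (?g x)) a) = b0 x a + t2 x a] (mod int R)"
    using patch'[OF Rpi] by blast
  obtain e where e: "is_exponent \<pi> A e" "\<And>N. 0 < N \<Longrightarrow> coprime N s \<Longrightarrow> [int s * e N = 1] (mod int N)"
    using inverse_exponent[OF s(1)] by blast
  obtain i where i: "is_exponent \<pi> A i" "\<And>N. 0 < N \<Longrightarrow> coprime N D \<Longrightarrow> [i N = 1] (mod int N)"
    "[i R = 0] (mod int R)"
    using idempotent_exponent[OF D R0 R(2)] by blast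
  \<comment> \<open>Away from D the idempotent i is 1 and this is t1 divided by s; modulo R it is 0
    and this is t2, taken from the given solution. The leading 0 fits the shape of
    \<open>exp_span_add_mult\<close>.\<close>
  define \<tau> where "\<tau> x N a = (0 + (e N * i N) * t1 x a) + (1 + - i N) * t2 x a" for x N a
  have "\<exists>w. w \<in> sigma_elems \<pi> A \<and> w \<in> word_limits A (constraint \<Sigma> x) \<and> realizes A w (\<lambda>N a. b0 x a + \<tau> x N a)"
    if x: "x \<in> X" for x
  proof -
    have "\<tau> x \<in> exp_span \<pi> A (B x)"
      unfolding \<tau>_def
      by (intro exp_span_add_mult t1 x t2[THEN bspec] is_exponent_mult is_exponent_add is_exponent_1
          is_exponent_uminus e i exp_span.zero)
    then show ?thesis using real[OF x] unfolding realizable_def b0_def B_def by blast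
  qed
  then obtain z where z: "\<And>x. x \<in> X \<Longrightarrow> z x \<in> sigma_elems \<pi> A" "\<And>x. x \<in> X \<Longrightarrow> z x \<in> word_limits A (constraint \<Sigma> x)"
    "\<And>x. x \<in> X \<Longrightarrow> realizes A (z x) (\<lambda>N a. b0 x a + \<tau> x N a)" by metis
  define s' where "s' y = (if y \<in> X then z y else param_val \<Sigma> y)" for y
  have s'P: "s' y \<in> pro_carrier Fin_Sgrp A" if "y \<in> Y" for y
    using that z(1) par by (auto simp: s'_def Y_def intro!: Omega_in)
  define \<delta>' where "\<delta>' = restrict (extend Fin_Sgrp A Y s') (pro_carrier Fin_Sgrp Y)"
  have hom': "\<delta>' \<in> cont_hom (Free_Pro Fin_Sgrp Y) (Free_Pro Fin_Sgrp A)"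
    unfolding \<delta>'_def by (rule extend_cont_hom[OF order_refl s'P])
  have g': "\<delta>' (?g y) = s' y" if "y \<in> Y" for y
    unfolding \<delta>'_def using extend_gen[OF order_refl s'P that] gen_in[OF that, of Fin_Sgrp] by simp
  have dp': "\<delta>' (?g p) = param_val \<Sigma> p" if "p \<in> P" for p
    using g'[of p] that disj by (auto simp: s'_def Y_def)
  have dx': "\<delta>' (?g x) = z x" if "x \<in> X" for x
    using g'[of x] that by (auto simp: s'_def Y_def)
  have coef_z: "[int (coef N A (z x) a) = b0 x a + \<tau> x N a] (mod int N)" if "x \<in> X" "0 < N" "a \<in> A" for x N a
    using z(3)[OF that(1)] that(2,3) unfolding realizes_def by blast

  have sat': "satisfies (Ab \<pi>) A (\<delta>' u) (\<delta>' v)" if uv: "(u, v) \<in> E" for u v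
    unfolding satisfies_Ab_iff[OF fin(4) hom_in[OF hom' EP(1)[OF uv]] hom_in[OF hom' EP(2)[OF uv]]]
  proof (intro allI impI ballI)
    fix N a assume N: "nat_dvd N \<pi>" and a: "a \<in> A"
    show "coef N A (\<delta>' u) a = coef N A (\<delta>' v) a"
      using R(1) hom_in[OF hom' EP(1)[OF uv]] hom_in[OF hom' EP(2)[OF uv]] _ _ N
    proof (rule coef_local_global)
      \<comment> \<open>Modulo R the new values have the same coefficients as the old ones at every
        variable and parameter, so the equations are inherited from \<delta>.\<close>
      have same: "coef R A (\<delta>' (?g y)) a = coef R A (\<delta> (?g y)) a" if y: "y \<in> Y" for y
      proof (cases "y \<in> X")
        case True
        have "[\<tau> y R a = (0 + (e R * 0) * t1 y a) + (1 + - 0) * t2 y a] (mod int R)"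
          unfolding \<tau>_def by (intro cong_add cong_mult cong_refl i(3) cong_uminus)
        then have "[b0 y a + \<tau> y R a = b0 y a + t2 y a] (mod int R)"
          by (intro cong_add cong_refl) simp
        with coef_z[OF True R0 a] have "[int (coef R A (z y) a) = b0 y a + t2 y a] (mod int R)"
          by (rule cong_trans)
        also have "[b0 y a + t2 y a = int (coef R A (\<delta> (?g y)) a)] (mod int R)"
          by (rule cong_sym) (use t2(2) True a in blast)
        finally have "[int (coef R A (\<delta>' (?g y)) a) = int (coef R A (\<delta> (?g y)) a)] (mod int R)"
          using dx'[OF True] by simp
        moreover have "coef R A (\<delta>' (?g y)) a < R" "coef R A (\<delta> (?g y)) a < R"
          using hom_in[OF hom' gen_in[OF y]] hom_in[OF hom gen_in[OF y]] R0 by (auto intro!: coef_less)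
        ultimately show ?thesis by (simp add: cong_def zmod_int[symmetric])
      next
        case False
        then show ?thesis using y dp dp' by (auto simp: Y_def)
      qed
      have "coef R A (\<delta>' w) a = coef R A (\<delta> w) a" if "w \<in> pro_carrier Fin_Sgrp Y" for w
        unfolding coef_cont_hom[OF hom' fin(3) that R0] coef_cont_hom[OF hom fin(3) that R0]
        using same by simp
      moreover have "coef R A (\<delta> u) a = coef R A (\<delta> v) a"
        using sat[OF uv] satisfies_Ab_iff[OF fin(4) hom_in[OF hom EP(1)[OF uv]] hom_in[OF hom EP(2)[OF uv]]]
          Rpi a by blast
      ultimately show "coef R A (\<delta>' u) a = coef R A (\<delta>' v) a" using EP[OF uv] by simp
    next
      fix K assume K: "nat_dvd K \<pi>" "coprime K D"
      have K0: "0 < K" using K(1) by (rule nat_dvd_pos)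
      have cop: "coprime K (d1 * d2)" "coprime K s" using K(2) unfolding D_def by auto
      have KN: "K \<in> NN" using K cop by (simp add: NN_def)
      \<comment> \<open>With i = 1 the unknowns become e times t1, and s e = 1. Multiplying
        \<open>key\<close> by s therefore turns its right-hand side into h - lin t1 = 0.\<close>
      let ?t = "\<lambda>x a. e K * t1 x a"
      have t: "[int (coef K A (\<delta>' (?g x)) a) = b0 x a + ?t x a] (mod int K)" if x: "x \<in> X" for x
      proof -
        have "[\<tau> x K a = (0 + (e K * 1) * t1 x a) + (1 + - 1) * t2 x a] (mod int K)"
          unfolding \<tau>_def by (intro cong_add cong_mult cong_refl i(2) K0 K(2) cong_uminus)
        then have "[b0 x a + \<tau> x K a = b0 x a + ?t x a] (mod int K)"
          by (intro cong_add cong_refl) simp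
        then show ?thesis unfolding dx'[OF x] using coef_z[OF x K0 a] by (rule cong_trans[rotated])
      qed
      have "[int (d1 * d2) * (int (coef K A (\<delta>' u) a) - int (coef K A (\<delta>' v) a))
          = b ((u, v), a) - lin ?t ((u, v), a)] (mod int K)"
        by (rule key[where h = \<delta>' and t = ?t, OF hom' dp' t K0 cop(1) uv a])
      then have "[int s * (int (d1 * d2) * (int (coef K A (\<delta>' u) a) - int (coef K A (\<delta>' v) a)))
          = int s * (b ((u, v), a) - lin ?t ((u, v), a))] (mod int K)" by (rule cong_scalar_left)
      also have "int s * (b ((u, v), a) - lin ?t ((u, v), a))
          = int s * b ((u, v), a) - (int s * e K) * lin t1 ((u, v), a)"
        by (simp add: lin_def algebra_simps sum_distrib_left)
      also have "[\<dots> = h ((u, v), a) - 1 * lin t1 ((u, v), a)] (mod int K)"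
        using s(3) KN uv a by (intro cong_diff cong_mult e(2) K0 cop cong_refl) auto
      also have "h ((u, v), a) - 1 * lin t1 ((u, v), a) = 0" by (simp add: t1(2))
      finally have "int K dvd int D * (int (coef K A (\<delta>' u) a) - int (coef K A (\<delta>' v) a))"
        by (simp add: cong_0_iff D_def ac_simps)
      \<comment> \<open>D is invertible modulo K, so it can be cancelled from the difference of the
        two sides.\<close>
      moreover have "coprime (int K) (int D)" using K(2) by (simp only: coprime_int_iff)
      ultimately have "[int (coef K A (\<delta>' u) a) = int (coef K A (\<delta>' v) a)] (mod int K)"
        by (simp only: coprime_dvd_mult_right_iff cong_iff_dvd_diff)
      moreover have "coef K A (\<delta>' u) a < K" "coef K A (\<delta>' v) a < K"
        using hom_in[OF hom' EP(1)[OF uv]] hom_in[OF hom' EP(2)[OF uv]] K0 by (auto intro!: coef_less)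
      ultimately show "coef K A (\<delta>' u) a = coef K A (\<delta>' v) a" by (simp add: cong_def zmod_int[symmetric])
    qed
  qed
  have cl': "Some (\<delta>' (?g x)) \<in> Cl A (constraint \<Sigma> x)" if "x \<in> X" for x
    using z(2)[OF that] Some_in_Cl_iff[OF rational_lists[OF rat[OF that]]] dx'[OF that] by simp
  have "solution_mod (Ab \<pi>) \<Sigma> \<delta>'"
    unfolding solution_mod_def Let_def using hom' cl' dp' sat' unfolding defs by auto
  moreover have "\<delta>' (?g x) \<in> sigma_elems \<pi> A" if "x \<in> X" for x using z(1)[OF that] dx'[OF that] by simp
  ultimately show "\<exists>\<delta>. solution_mod (Ab \<pi>) \<Sigma> \<delta> \<and>
      (\<forall>x\<in>vars \<Sigma>. \<delta> (gen Fin_Sgrp (vars \<Sigma> \<union> params \<Sigma>) x) \<in> sigma_elems \<pi> (alphabet \<Sigma>))"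
    unfolding defs by blast
qed

theorem theorem2p7:
  fixes \<pi> :: supernatural
  assumes "recursive_supernatural \<pi>"
  shows "pseudovariety (Ab \<pi>) \<and> implicit_signature (sigma_pi \<pi>) \<and>
         completely_tame (sigma_pi \<pi>) (Ab \<pi>)"
  using pseudovariety_Ab implicit_signature_sigma_pi[OF assms] reducible_Ab
    decidable_word_problem_Ab[OF assms] re_class_Ab[OF assms]
  unfolding completely_tame_def tame_def by blast

end
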